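(* Let $U\cong\mathbb{R}^d$, $\Lambda\subseteq U$ a lattice, and $X\subseteq\Lambda$ a finite list spanning $U$. Then $\mathcal{P}^{\mathrm{per}}_{\mathbb{C}}(X)$ and $\mathcal{D}\mathcal{M}_{\mathbb{C}}(X)$ are dual under the pairing $\langle\cdot,\cdot\rangle_\nabla$. That is, the map $\mathcal{D}\mathcal{M}_{\mathbb{C}}(X)\to\mathcal{P}^{\mathrm{per}}_{\mathbb{C}}(X)^*$, $f\mapsto\langle\cdot,f\rangle_\nabla$, is an isomorphism.
   Context: **Basic setup.** Lists may contain repetitions. $V=U^*$. Via a basis of $\Lambda$, $\mathrm{Sym}(U_{\mathbb{C}})=\mathbb{C}[s_1,\dots,s_d]$ and $\mathrm{Sym}(V_{\mathbb{C}})=\mathbb{C}[t_1,\dots,t_d]$. $q(D)$ is the constant-coefficient differential operator obtained by $s_i\mapsto\partial/\partial t_i$. For $u\in U$, $p_u$ is the linear form, and $p_Y=\prod_{y\in Y}p_y$. The standard pairing is $\langle q,f\rangle=(q(D)f)(0)$. **Continuous spaces.** For $Y$ spanning $U$: - $\mathcal{P}_{\mathbb{C}}(Y)=\operatorname{span}\{p_Z:Z\subseteq Y,\ Y\setminus Z\text{ spans }U\}$. - A cocircuit of $Y$ is a minimal sublist $C$ with $Y\setminus C$ not spanning $U$, and $\mathcal{J}(Y)$ is the ideal generated by the $p_C$. - $\mathcal{D}_{\mathbb{C}}(Y)=\{f\in\mathrm{Sym}(V_{\mathbb{C}}):q(D)f=0\ \forall q\in\mathcal{J}(Y)\}$. **Periodic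 space.** $T(\Lambda)=\mathrm{Hom}(\Lambda,S^1)$, $\mathcal{V}(X)=\{e_\phi:e_\phi(b)=1\ \forall b\in B$ for some basis $B\subseteq X$ of $U\}$, and $X_\phi=(x\in X:e_\phi(x)=1)$. Then $$\mathcal{P}^{\mathrm{per}}_{\mathbb{C}}(X)=\bigoplus_{e_\phi\in\mathcal{V}(X)}e_\phi\,p_{X\setminus X_\phi}\mathcal{P}_{\mathbb{C}}(X_\phi)$$ (formal direct sum). **Discrete space.** $\mathbb{C}[\Lambda]$ is the group algebra, acting on functions $f:\Lambda\to\mathbb{C}$ by translations $\tau_\lambda f=f(\cdot-\lambda)$. $\mathcal{J}^\nabla_{\mathbb{C}}(X)$ is the ideal of $\mathbb{C}[\Lambda]$ generated by $\prod_{x\in C}(1-x)$ for cocircuits $C$ of $X$, and $$\mathcal{D}\mathcal{M}_{\mathbb{C}}(X)=\{f:\Lambda\to\mathbb{C}: qf=0\ \forall q\in\mathcal{J}^\nabla_{\mathbb{C}}(X)\}.$$ It is known that $\mathcal{D}\mathcal{M}_{\mathbb{C}}(X)=\bigoplus_{e_\phi\in\mathcal{V}(X)}e_\phi\,\mathcal{D}_{\mathbb{C}}(X_\phi)|_\Lambda$, and that restriction to $\Lambda$ identifies each $f_\phi\in\mathcal{D}_{\mathbb{C}}(X_\phi)|_\Lambda$ with a unique polynomial in $\mathcal{D}_{\mathbb{C}}(X_\phi)$. **Pairing.** For $p=\sum_\phi e_\phi p_{X\setminus X_\phi}q_\phi$ with $q_\phi\in\mathcal{P}_{\mathbb{C}}(X_\phi)$,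 and $f=\sum_\phi e_\phi f_\phi$, $$\langle p,f\rangle_\nabla:=\sum_{e_\phi\in\mathcal{V}(X)}\langle q_\phi,f_\phi\rangle.$$ *)

theory Defs
  imports Complex_Main "HOL-Library.Poly_Mapping" "HOL-Library.Function_Algebras"
begin

definition linear_on ::
    "'b::plus set \<Rightarrow> (complex \<Rightarrow> 'b \<Rightarrow> 'b) \<Rightarrow> (complex \<Rightarrow> 'c \<Rightarrow> 'c) \<Rightarrow> ('b \<Rightarrow> 'c::plus) \<Rightarrow> bool"
  where "linear_on S s1 s2 f \<longleftrightarrow>
    (\<forall>x\<in>S. \<forall>y\<in>S. f (x + y) = f x + f y) \<and> (\<forall>c. \<forall>x\<in>S. f (s1 c x) = s2 c (f x))"

text \<open>A functional on \<open>S\<close> is represented by its extension by zero to the whole type, so that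
  functionals on \<open>S\<close> are equal iff they agree on \<open>S\<close>.\<close>

definition zero_ext :: "'b set \<Rightarrow> ('b \<Rightarrow> complex) \<Rightarrow> 'b \<Rightarrow> complex"
  where "zero_ext S f = (\<lambda>x. if x \<in> S then f x else 0)"

definition dual_space ::
    "(complex \<Rightarrow> 'b \<Rightarrow> 'b) \<Rightarrow> 'b::plus set \<Rightarrow> ('b \<Rightarrow> complex) set"
  where "dual_space s S = {L. linear_on S s (*) L \<and> (\<forall>x. x \<notin> S \<longrightarrow> L x = 0)}"

definition linear_iso ::
    "(complex \<Rightarrow> 'b \<Rightarrow> 'b) \<Rightarrow> 'b::plus set \<Rightarrow> (complex \<Rightarrow> 'c \<Rightarrow> 'c) \<Rightarrow> 'c::plus set \<Rightarrow> ('b \<Rightarrow> 'c) \<Rightarrow> bool"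
  where "linear_iso s1 S s2 T f \<longleftrightarrow> linear_on S s1 s2 f \<and> bij_betw f S T"

definition fun_scale :: "complex \<Rightarrow> ('b \<Rightarrow> complex) \<Rightarrow> 'b \<Rightarrow> complex"
  where "fun_scale c f = (\<lambda>x. c * f x)"

definition ideal_gen :: "'r::comm_ring_1 set \<Rightarrow> 'r set \<Rightarrow> 'r set"
  where "ideal_gen R G = {\<Sum>g\<in>F. r g * g | r F. finite F \<and> F \<subseteq> G \<and> r ` F \<subseteq> R}"

text \<open>Polynomials in variables indexed by \<open>nat\<close>; those in the first \<open>d\<close> variables form
  \<open>cpolys d\<close>.  With \<open>d\<close> the length of a lattice basis, \<open>cpolys d\<close> serves both as
  \<open>\<complex>[s\<^sub>1,\<dots>,s\<^sub>d] = Sym(U)\<close> and as \<open>\<complex>[t\<^sub>1,\<dots>,t\<^sub>d] = Sym(V)\<close>.\<close>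

type_synonym cpoly = "(nat \<Rightarrow>\<^sub>0 nat) \<Rightarrow>\<^sub>0 complex"

definition cpolys :: "nat \<Rightarrow> cpoly set"
  where "cpolys d = {f. \<forall>m\<in>Poly_Mapping.keys f. Poly_Mapping.keys m \<subseteq> {..<d}}"

definition cconst :: "complex \<Rightarrow> cpoly"
  where "cconst c = Poly_Mapping.single 0 c"

definition cvar :: "nat \<Rightarrow> cpoly"
  where "cvar i = Poly_Mapping.single (Poly_Mapping.single i 1) 1"

definition cscale :: "complex \<Rightarrow> cpoly \<Rightarrow> cpoly"
  where "cscale c p = cconst c * p"

interpretation cpoly: vector_space cscale
  by unfold_locales
    (simp_all add: cscale_def cconst_def algebra_simps single_add mult_single
      flip: mult.assoc)

definition ceval :: "cpoly \<Rightarrow> (nat \<Rightarrow> complex) \<Rightarrow> complex"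
  where "ceval f v =
    (\<Sum>m\<in>Poly_Mapping.keys f.
      Poly_Mapping.lookup f m * (\<Prod>i\<in>Poly_Mapping.keys m. v i ^ Poly_Mapping.lookup m i))"

text \<open>The truncated subtraction in the exponent is harmless: if \<open>t\<^sub>i\<close> does not
  occur in \<open>m\<close>, the coefficient is zero.\<close>

definition partial_deriv :: "nat \<Rightarrow> cpoly \<Rightarrow> cpoly"
  where "partial_deriv i f =
    (\<Sum>m\<in>Poly_Mapping.keys f.
      Poly_Mapping.single (m - Poly_Mapping.single i 1)
        (of_nat (Poly_Mapping.lookup m i) * Poly_Mapping.lookup f m))"

definition monom_op :: "(nat \<Rightarrow>\<^sub>0 nat) \<Rightarrow> cpoly \<Rightarrow> cpoly"
  where "monom_op m f =
    foldr (\<lambda>i g. (partial_deriv i ^^ Poly_Mapping.lookup m i) g)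
      (sorted_list_of_set (Poly_Mapping.keys m)) f"

definition diff_op :: "cpoly \<Rightarrow> cpoly \<Rightarrow> cpoly"
  where "diff_op q f =
    (\<Sum>m\<in>Poly_Mapping.keys q. cscale (Poly_Mapping.lookup q m) (monom_op m f))"

definition std_pairing :: "cpoly \<Rightarrow> cpoly \<Rightarrow> complex"
  where "std_pairing q f = ceval (diff_op q f) (\<lambda>_. 0)"

text \<open>The real vector space \<open>U\<close> is the whole type \<open>'a\<close>; the existence of the finite list
  \<open>bs\<close> makes it finite-dimensional, of dimension \<open>length bs\<close> (possibly \<open>0\<close>).\<close>

definition lattice_basis :: "'a::real_vector list \<Rightarrow> 'a set \<Rightarrow> bool"
  where "lattice_basis bs \<Lambda> \<longleftrightarrow>
    distinct bs \<and> independent (set bs) \<and> span (set bs) = UNIV \<and>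
    \<Lambda> = {\<Sum>b\<in>set bs. of_int (n b) *\<^sub>R b | n. True}"

definition is_lattice :: "'a::real_vector set \<Rightarrow> bool"
  where "is_lattice \<Lambda> \<longleftrightarrow> (\<exists>bs. lattice_basis bs \<Lambda>)"

definition coord :: "'a::real_vector list \<Rightarrow> 'a \<Rightarrow> nat \<Rightarrow> real"
  where "coord bs u i = representation (set bs) u (bs ! i)"

definition lin_form :: "'a::real_vector list \<Rightarrow> 'a \<Rightarrow> cpoly"
  where "lin_form bs u = (\<Sum>i<length bs. cscale (of_real (coord bs u i)) (cvar i))"

definition lin_prod :: "'a::real_vector list \<Rightarrow> 'a list \<Rightarrow> cpoly"
  where "lin_prod bs Y = prod_list (map (lin_form bs) Y)"

definition eval_at :: "'a::real_vector list \<Rightarrow> cpoly \<Rightarrow> 'a \<Rightarrow> complex"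
  where "eval_at bs f u = ceval f (\<lambda>i. of_real (coord bs u i))"

text \<open>Sublists of \<open>Y\<close> are given by sets of positions, so repeated entries count as
  different elements: \<open>nths Y I\<close> is the sublist and \<open>nths Y (- I)\<close> its complement.\<close>

definition spans :: "'a::real_vector list \<Rightarrow> bool"
  where "spans Y \<longleftrightarrow> span (set Y) = UNIV"

definition P_space :: "'a::real_vector list \<Rightarrow> 'a list \<Rightarrow> cpoly set"
  where "P_space bs Y =
    cpoly.span {lin_prod bs (nths Y I) | I. I \<subseteq> {..<length Y} \<and> spans (nths Y (- I))}"

definition cocircuits :: "'a::real_vector list \<Rightarrow> 'a list set"
  where "cocircuits Y =
    {nths Y I | I. I \<subseteq> {..<length Y} \<and> \<not> spans (nths Y (- I)) \<and>
      (\<forall>J. J \<subset> I \<longrightarrow> spans (nths Y (- J)))}"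

definition J_ideal :: "'a::real_vector list \<Rightarrow> 'a list \<Rightarrow> cpoly set"
  where "J_ideal bs Y = ideal_gen (cpolys (length bs)) (lin_prod bs ` cocircuits Y)"

definition D_space :: "'a::real_vector list \<Rightarrow> 'a list \<Rightarrow> cpoly set"
  where "D_space bs Y = {f \<in> cpolys (length bs). \<forall>q\<in>J_ideal bs Y. diff_op q f = 0}"

text \<open>Functions on \<open>\<Lambda>\<close>, in particular characters, are represented by functions on \<open>'a\<close>
  that vanish outside \<open>\<Lambda>\<close>.\<close>

definition lattice_funs :: "'a set \<Rightarrow> ('a \<Rightarrow> complex) set"
  where "lattice_funs \<Lambda> = {f. \<forall>x. x \<notin> \<Lambda> \<longrightarrow> f x = 0}"

definition torus :: "'a::real_vector set \<Rightarrow> ('a \<Rightarrow> complex) set"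
  where "torus \<Lambda> = {e \<in> lattice_funs \<Lambda>.
    (\<forall>x\<in>\<Lambda>. cmod (e x) = 1) \<and> (\<forall>x\<in>\<Lambda>. \<forall>y\<in>\<Lambda>. e (x + y) = e x * e y)}"

definition vertices :: "'a::real_vector set \<Rightarrow> 'a list \<Rightarrow> ('a \<Rightarrow> complex) set"
  where "vertices \<Lambda> X = {e \<in> torus \<Lambda>.
    \<exists>B. B \<subseteq> set X \<and> independent B \<and> span B = UNIV \<and> (\<forall>b\<in>B. e b = 1)}"

definition fix_part :: "('a \<Rightarrow> complex) \<Rightarrow> 'a list \<Rightarrow> 'a list"
  where "fix_part e X = filter (\<lambda>x. e x = 1) X"

definition move_part :: "('a \<Rightarrow> complex) \<Rightarrow> 'a list \<Rightarrow> 'a list"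
  where "move_part e X = filter (\<lambda>x. e x \<noteq> 1) X"

text \<open>An element \<open>\<Sum>\<^sub>\<phi> e\<^sub>\<phi> p\<^sub>\<phi>\<close> of the formal direct sum is the finitely
  supported family \<open>e\<^sub>\<phi> \<mapsto> p\<^sub>\<phi>\<close>.\<close>

definition P_per :: "'a::real_vector list \<Rightarrow> 'a set \<Rightarrow> 'a list \<Rightarrow> (('a \<Rightarrow> complex) \<Rightarrow> cpoly) set"
  where "P_per bs \<Lambda> X = {p. finite {e. p e \<noteq> 0} \<and>
    (\<forall>e. e \<notin> vertices \<Lambda> X \<longrightarrow> p e = 0) \<and>
    (\<forall>e\<in>vertices \<Lambda> X. p e \<in> (*) (lin_prod bs (move_part e X)) ` P_space bs (fix_part e X))}"

definition per_scale :: "complex \<Rightarrow> ('e \<Rightarrow> cpoly) \<Rightarrow> 'e \<Rightarrow> cpoly"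
  where "per_scale c p = (\<lambda>e. cscale c (p e))"

text \<open>The finitely supported functions \<open>'a \<Rightarrow>\<^sub>0 complex\<close> carry the convolution product, so
  those supported in \<open>\<Lambda>\<close> form the group algebra of \<open>\<Lambda>\<close>.\<close>

definition group_alg :: "'a::real_vector set \<Rightarrow> ('a \<Rightarrow>\<^sub>0 complex) set"
  where "group_alg \<Lambda> = {q. Poly_Mapping.keys q \<subseteq> \<Lambda>}"

definition translate_action :: "('a::real_vector \<Rightarrow>\<^sub>0 complex) \<Rightarrow> ('a \<Rightarrow> complex) \<Rightarrow> 'a \<Rightarrow> complex"
  where "translate_action q f =
    (\<lambda>x. \<Sum>u\<in>Poly_Mapping.keys q. Poly_Mapping.lookup q u * f (x - u))"

definition nabla_prod :: "'a::real_vector list \<Rightarrow> 'a \<Rightarrow>\<^sub>0 complex"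
  where "nabla_prod C = prod_list (map (\<lambda>x. 1 - Poly_Mapping.single x 1) C)"

definition J_nabla :: "'a::real_vector set \<Rightarrow> 'a list \<Rightarrow> ('a \<Rightarrow>\<^sub>0 complex) set"
  where "J_nabla \<Lambda> X = ideal_gen (group_alg \<Lambda>) (nabla_prod ` cocircuits X)"

definition DM_space :: "'a::real_vector set \<Rightarrow> 'a list \<Rightarrow> ('a \<Rightarrow> complex) set"
  where "DM_space \<Lambda> X = {f \<in> lattice_funs \<Lambda>. \<forall>q\<in>J_nabla \<Lambda> X. translate_action q f = 0}"

definition per_component ::
    "'a::real_vector list \<Rightarrow> 'a list \<Rightarrow> (('a \<Rightarrow> complex) \<Rightarrow> cpoly) \<Rightarrow> ('a \<Rightarrow> complex) \<Rightarrow> cpoly"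
  where "per_component bs X p e =
    (THE q. q \<in> P_space bs (fix_part e X) \<and> p e = lin_prod bs (move_part e X) * q)"

text \<open>The unique family \<open>f\<^sub>\<phi> \<in> D(X\<^sub>\<phi>)\<close> with \<open>f = \<Sum>\<^sub>\<phi> e\<^sub>\<phi> f\<^sub>\<phi>\<close> on \<open>\<Lambda>\<close>,
  normalised to \<open>0\<close> off the vertex set.\<close>

definition DM_component ::
    "'a::real_vector list \<Rightarrow> 'a set \<Rightarrow> 'a list \<Rightarrow> ('a \<Rightarrow> complex) \<Rightarrow> ('a \<Rightarrow> complex) \<Rightarrow> cpoly"
  where "DM_component bs \<Lambda> X f =
    (THE F. (\<forall>e\<in>vertices \<Lambda> X. F e \<in> D_space bs (fix_part e X)) \<and>
      (\<forall>e. e \<notin> vertices \<Lambda> X \<longrightarrow> F e = 0) \<and>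
      (\<forall>x\<in>\<Lambda>. f x = (\<Sum>e\<in>vertices \<Lambda> X. e x * eval_at bs (F e) x)))"

definition nabla_pairing ::
    "'a::real_vector list \<Rightarrow> 'a set \<Rightarrow> 'a list \<Rightarrow> (('a \<Rightarrow> complex) \<Rightarrow> cpoly) \<Rightarrow> ('a \<Rightarrow> complex) \<Rightarrow> complex"
  where "nabla_pairing bs \<Lambda> X p f =
    (\<Sum>e\<in>vertices \<Lambda> X. std_pairing (per_component bs X p e) (DM_component bs \<Lambda> X f e))"

end

theory Submission
  imports Defs "HOL-Library.Multiset" "HOL-Computational_Algebra.Polynomial_Factorial"
begin

text \<open>
  Fix a vertex \<open>e\<close> and write \<open>Y = X\<^sub>e\<close>. That no \<open>f \<noteq> 0\<close> in \<open>D(Y)\<close> is orthogonal to \<open>P(Y)\<close>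
  follows by descending induction: all products of derivatives \<open>p\<^sub>Z(D) f\<close> vanish, because their own
  derivatives along the spanning list \<open>Y - Z\<close> vanish and their constant terms are pairings with
  \<open>P(Y)\<close>. Conversely, a functional on \<open>P(Y)\<close> extends to one killing \<open>J(Y)\<close>, hence is represented by
  an element of \<open>D(Y)\<close>, as soon as \<open>P(Y) \<inter> J(Y) = 0\<close>. After division by \<open>p\<^sub>Y\<close> this says that a
  combination of fractions \<open>1 / p\<^sub>T\<close> with \<open>T\<close> spanning is never a nonzero combination of fractions
  \<open>r / p\<^sub>T\<close> with \<open>T\<close> not spanning; comparing polar parts along each linear form reduces this to a
  space of smaller dimension.

  For the discrete space, all functions in \<open>DM(X)\<close> are nilpotent under \<open>1 - N b\<close> for a common period
  \<open>N\<close> and every lattice basis vector \<open>b\<close>, so by Newton's expansion on the cosets of \<open>N \<Lambda>\<close> they are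
  exponential polynomials \<open>\<Sum> e f\<^sub>e\<close>. On the polynomial \<open>f\<^sub>e\<close> the difference \<open>1 - x\<close> acts as an invertible
  differential operator if \<open>e(x) \<noteq> 1\<close> and as \<open>D\<^sub>x\<close> times an invertible operator if \<open>e(x) = 1\<close>; hence the
  cocircuit equations for \<open>f\<close> say precisely that \<open>f\<^sub>e \<in> D(X\<^sub>e)\<close>.

  All products and spans involved depend only on the multiset underlying a sublist.
\<close>

section \<open>Polynomials and constant-coefficient differential operators\<close>

text \<open>Both sides are handled one vertex at a time: the vertex set is finite, and the prefactor
  p_{X - X_e} cancels because zero vectors always lie in X_e, as e(0) = 1. For one Y, a functional
  on the infinite-dimensional polynomial ring need not be a pairing with a polynomial. It is one
  here because every product of more than |Y| linear forms lies in J(Y), which leaves finitely many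
  nonzero coefficients. The obstacle is that P(Y) and J(Y) meet only in 0. Division by p_Y turns the
  conditions on Z into a condition on the forms left in the denominator: they span or they do not.
  This condition passes to the quotient by a form x if a multiple of x is among those forms; hence
  only polar parts along x are compared and regular parts stay unconstrained. An element without
  poles is a polynomial, and it vanishes since 1 / p_T with T nonempty has negative degree. The
  period N exists because every spanning subset of X generates a sublattice of finite index in
  \<Lambda> and there are only finitely many such subsets; N also bounds the orders of the values of
  the vertices.\<close>

abbreviation "single \<equiv> Poly_Mapping.single"
abbreviation "lookup \<equiv> Poly_Mapping.lookup"
abbreviation "keys \<equiv> Poly_Mapping.keys"

abbreviation bdiff :: "'a \<Rightarrow> 'a::monoid_add \<Rightarrow>\<^sub>0 complex"
  where "bdiff u \<equiv> 1 - single u 1"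

lemma poly_mapping_sum_singles:
  fixes f :: "'a \<Rightarrow>\<^sub>0 'b::comm_monoid_add"
  shows "(\<Sum>m\<in>keys f. single m (lookup f m)) = f"
  by (rule poly_mapping_eqI)
    (simp add: lookup_sum lookup_single when_def in_keys_iff)

lemma poly_mapping_single_induct [case_names zero single add]:
  fixes f :: "'a \<Rightarrow>\<^sub>0 'b::comm_monoid_add"
  assumes "P 0" "\<And>m c. P (single m c)" "\<And>f g. P f \<Longrightarrow> P g \<Longrightarrow> P (f + g)"
  shows "P f"
proof -
  have "P (\<Sum>m\<in>A. single m (lookup f m))" if "finite A" for A
    using that by induction (auto intro: assms)
  from this[OF finite_keys, of f] show ?thesis unfolding poly_mapping_sum_singles .
qed

lemma keys_nat_add: "keys (m + n :: 'a \<Rightarrow>\<^sub>0 nat) = keys m \<union> keys n"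
  by (auto simp: in_keys_iff lookup_add)

section \<open>Evaluation homomorphisms of the polynomial ring\<close>

definition mpow :: "(nat \<Rightarrow> 'r::comm_monoid_mult) \<Rightarrow> (nat \<Rightarrow>\<^sub>0 nat) \<Rightarrow> 'r"
  where "mpow v m = (\<Prod>i\<in>keys m. v i ^ lookup m i)"

lemma mpow_superset:
  assumes "finite S" "keys m \<subseteq> S"
  shows "mpow v m = (\<Prod>i\<in>S. v i ^ lookup m i)"
  unfolding mpow_def using assms by (intro prod.mono_neutral_left) (auto simp: in_keys_iff)

lemma mpow_0 [simp]: "mpow v 0 = 1"
  by (simp add: mpow_def)

lemma mpow_single [simp]: "mpow v (single i k) = v i ^ k"
  by (cases "k = 0") (simp_all add: mpow_def)

lemma mpow_add: "mpow v (m + n) = mpow v m * mpow v n"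
proof -
  let ?S = "keys m \<union> keys n"
  have "mpow v (m + n) = (\<Prod>i\<in>?S. v i ^ lookup (m + n) i)"
    by (rule mpow_superset) (auto simp: keys_nat_add)
  also have "\<dots> = mpow v m * mpow v n"
    by (simp add: mpow_superset[of ?S m v] mpow_superset[of ?S n v] lookup_add power_add prod.distrib)
  finally show ?thesis .
qed

text \<open>The universal property of the polynomial ring, with values in an arbitrary commutative
  ring. Point evaluation, reduction modulo a linear form, homogenisation, restriction to a line and
  specialisation of all but one variable are instances.\<close>

definition ins :: "(complex \<Rightarrow> 'r::comm_ring_1) \<Rightarrow> (nat \<Rightarrow> 'r) \<Rightarrow> cpoly \<Rightarrow> 'r"
  where "ins h v f = (\<Sum>m\<in>keys f. h (lookup f m) * mpow v m)"

locale insertion =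
  fixes h :: "complex \<Rightarrow> 'r::comm_ring_1" and v :: "nat \<Rightarrow> 'r"
  assumes h_1: "h 1 = 1" and h_add: "h (a + b) = h a + h b" and h_mult: "h (a * b) = h a * h b"
begin

lemma h_0: "h 0 = 0"
  using h_add[of 0 0] by simp

lemma ins_superset:
  assumes "finite S" "keys f \<subseteq> S"
  shows "ins h v f = (\<Sum>m\<in>S. h (lookup f m) * mpow v m)"
  unfolding ins_def using assms by (intro sum.mono_neutral_left) (auto simp: in_keys_iff h_0)

lemma ins_add: "ins h v (f + g) = ins h v f + ins h v g"
proof -
  let ?S = "keys f \<union> keys g"
  have "ins h v (f + g) = (\<Sum>m\<in>?S. h (lookup (f + g) m) * mpow v m)"
    using Poly_Mapping.keys_add[of f g] by (intro ins_superset) auto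
  also have "\<dots> = ins h v f + ins h v g"
    by (simp add: ins_superset[of ?S f] ins_superset[of ?S g] lookup_add h_add sum.distrib algebra_simps)
  finally show ?thesis .
qed

lemma ins_0 [simp]: "ins h v 0 = 0"
  by (simp add: ins_def)

lemma ins_single [simp]: "ins h v (single m c) = h c * mpow v m"
  by (cases "c = 0") (simp_all add: ins_def h_0)

lemma ins_mult: "ins h v (f * g) = ins h v f * ins h v g"
proof (induction f rule: poly_mapping_single_induct)
  case (single m c)
  show ?case
    by (induction g rule: poly_mapping_single_induct)
      (simp_all add: mult_single mpow_add h_mult ins_add algebra_simps)
qed (simp_all add: ins_add algebra_simps)

lemma ins_1 [simp]: "ins h v 1 = 1"
  using ins_single[of 0 1] by (simp add: h_1)

lemma ins_cconst [simp]: "ins h v (cconst c) = h c"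
  by (simp add: cconst_def)

lemma ins_cvar [simp]: "ins h v (cvar i) = v i"
  by (simp add: cvar_def h_1)

lemma ins_cscale [simp]: "ins h v (cscale c f) = h c * ins h v f"
  by (simp add: cscale_def ins_mult)

lemma ins_sum: "ins h v (sum g A) = (\<Sum>a\<in>A. ins h v (g a))"
  by (induction A rule: infinite_finite_induct) (simp_all add: ins_add)

lemma ins_uminus: "ins h v (- f) = - ins h v f"
  using ins_add[of f "- f"] by (simp add: eq_neg_iff_add_eq_0 add.commute)

lemma ins_diff: "ins h v (f - g) = ins h v f - ins h v g"
  using ins_add[of f "- g"] ins_uminus[of g] by simp

lemma ins_power: "ins h v (f ^ n) = ins h v f ^ n"
  by (induction n) (simp_all add: ins_mult)

end

lemma ceval_eq_ins: "ceval f v = ins (\<lambda>c. c) v f"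
  by (simp add: ceval_def ins_def mpow_def)

interpretation ceval: insertion "\<lambda>c. c" v for v
  by unfold_locales auto

lemma cconst_add: "cconst (a + b) = cconst a + cconst b"
  by (simp add: cconst_def single_add)

lemma cconst_mult: "cconst (a * b) = cconst a * cconst b"
  by (simp add: cconst_def mult_single)

lemma cconst_0 [simp]: "cconst 0 = 0"
  unfolding cconst_def by (rule single_zero)

lemma cconst_1 [simp]: "cconst 1 = 1"
  unfolding cconst_def by (rule single_one)

lemma lookup_cscale [simp]: "lookup (cscale c f) m = c * lookup f m"
proof (induction f rule: poly_mapping_single_induct)
  case (single n d)
  then show ?case by (auto simp: cscale_def cconst_def mult_single lookup_single when_def)
qed (auto simp: cpoly.scale_right_distrib lookup_add algebra_simps)

lemma mult_cscale_left [simp]: "cscale c f * g = cscale c (f * g)"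
  by (simp add: cscale_def mult.assoc)

lemma mult_cscale_right [simp]: "f * cscale c g = cscale c (f * g)"
  by (simp add: cscale_def algebra_simps)

lemma mpow_cvar: "mpow cvar m = single m 1"
proof (induction m rule: poly_mapping_single_induct)
  case (single i k)
  have "cvar i ^ k = single (single i k) 1"
    by (induction k) (simp_all add: cvar_def mult_single flip: single_add)
  then show ?case by simp
qed (simp_all add: mpow_add mult_single)

text \<open>Monomials are products of variables, so sums and products reach every polynomial.
  Identities about maps built from \<open>ins\<close> are checked on generators through this
  rule.\<close>

lemma cpoly_generators_induct [case_names const var add mult]:
  assumes "\<And>c. P (cconst c)" "\<And>i. P (cvar i)" 
    "\<And>f g. P f \<Longrightarrow> P g \<Longrightarrow> P (f + g)" "\<And>f g. P f \<Longrightarrow> P g \<Longrightarrow> P (f * g)"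
  shows "P f"
proof (induction f rule: poly_mapping_single_induct)
  case zero
  then show ?case using assms(1)[of 0] by simp
next
  case (single m c)
  have "P (single m 1)"
  proof (induction m rule: poly_mapping_single_induct)
    case zero
    then show ?case using assms(1)[of 1] by simp
  next
    case (single i k)
    have "P (cvar i ^ k)" using assms(1)[of 1] by (induction k) (auto intro: assms)
    then show ?case by (simp flip: mpow_cvar)
  next
    case (add f g)
    then show ?case using assms(4)[OF add] by (simp add: mult_single)
  qed
  from assms(4)[OF assms(1)[of c] this] show ?case by (simp add: cconst_def mult_single)
qed (rule assms)

section \<open>Rescaled coefficients, differential operators and the pairing\<close>

definition mfact :: "(nat \<Rightarrow>\<^sub>0 nat) \<Rightarrow> complex"
  where "mfact m = (\<Prod>i\<in>keys m. fact (lookup m i))"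

lemma mfact_nonzero [simp]: "mfact m \<noteq> 0"
  by (simp add: mfact_def)

lemma mfact_0 [simp]: "mfact 0 = 1"
  by (simp add: mfact_def)

lemma mfact_Suc:
  "mfact (m + single i 1) = of_nat (Suc (lookup m i)) * mfact m"
proof -
  let ?S = "insert i (keys m)"
  have sup: "mfact n = (\<Prod>i\<in>?S. fact (lookup n i))" if "keys n \<subseteq> ?S" for n
    unfolding mfact_def using that by (intro prod.mono_neutral_left) (auto simp: in_keys_iff)
  have "mfact (m + single i 1) = (\<Prod>j\<in>?S. fact (lookup (m + single i 1) j))"
    by (rule sup) (auto simp: keys_nat_add)
  also have "\<dots> = fact (Suc (lookup m i)) * (\<Prod>j\<in>?S - {i}. fact (lookup m j))"
    by (subst prod.remove[of _ i]) (auto simp: lookup_add lookup_single when_def intro!: prod.cong)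
  also have "\<dots> = of_nat (Suc (lookup m i)) * (\<Prod>j\<in>?S. fact (lookup m j))"
    by (subst (2) prod.remove[of _ i]) (auto simp: fact_Suc)
  also have "\<dots> = of_nat (Suc (lookup m i)) * mfact m"
    by (subst sup[of m]) auto
  finally show ?thesis .
qed

text \<open>In the rescaled coefficients the derivatives become index shifts.\<close>

definition wcoef :: "cpoly \<Rightarrow> (nat \<Rightarrow>\<^sub>0 nat) \<Rightarrow> complex"
  where "wcoef f m = mfact m * lookup f m"

lemma wcoef_eqI: "(\<And>m. wcoef f m = wcoef g m) \<Longrightarrow> f = g"
  by (rule poly_mapping_eqI) (auto simp: wcoef_def)

lemma wcoef_0 [simp]: "wcoef 0 m = 0"
  by (simp add: wcoef_def)

lemma wcoef_add: "wcoef (f + g) m = wcoef f m + wcoef g m"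
  by (simp add: wcoef_def lookup_add algebra_simps)

lemma wcoef_cscale: "wcoef (cscale c f) m = c * wcoef f m"
  by (simp add: wcoef_def)

lemma wcoef_sum: "wcoef (sum g A) m = (\<Sum>a\<in>A. wcoef (g a) m)"
  by (induction A rule: infinite_finite_induct) (auto simp: wcoef_add)

lemma lookup_partial_deriv:
  "lookup (partial_deriv i f) n =
    of_nat (Suc (lookup n i)) * lookup f (n + single i 1)"
proof -
  let ?e = "single i (1::nat)"
  \<comment> \<open>Truncation merges the exponents 0 and 1 of variable \<open>i\<close>: an
    \<open>m\<close> other than \<open>n + ?e\<close> may satisfy \<open>m - ?e = n\<close>, but it
    does not contain the variable, so its coefficient is multiplied by 0.\<close>
  have *: "of_nat (lookup m i) * lookup f m = 0"
    if "m - ?e = n" "m \<noteq> n + ?e" for m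
  proof -
    have "lookup m i = 0"
    proof (rule ccontr)
      assume "lookup m i \<noteq> 0"
      then have "m = m - ?e + ?e"
        by (intro poly_mapping_eqI) (auto simp: lookup_add lookup_minus lookup_single when_def)
      with that show False by simp
    qed
    then show ?thesis by simp
  qed
  have "lookup (partial_deriv i f) n =
      (\<Sum>m\<in>keys f. of_nat (lookup m i) * lookup f m when m - ?e = n)"
    by (simp add: partial_deriv_def lookup_sum lookup_single)
  also have "\<dots> = (\<Sum>m\<in>keys f. if m = n + ?e then of_nat (lookup m i) * lookup f m else 0)"
    using * by (intro sum.cong) (auto simp: when_def)
  also have "\<dots> = of_nat (Suc (lookup n i)) * lookup f (n + ?e)"
    by (auto simp: in_keys_iff lookup_add)
  finally show ?thesis .
qed

lemma wcoef_partial_deriv: "wcoef (partial_deriv i f) n = wcoef f (n + single i 1)"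
  by (simp only: wcoef_def lookup_partial_deriv mfact_Suc) simp

lemma wcoef_partial_deriv_pow:
  "wcoef ((partial_deriv i ^^ k) f) n = wcoef f (n + single i k)"
  by (induction k arbitrary: n) (simp_all add: wcoef_partial_deriv add.assoc flip: single_add)

lemma wcoef_monom_op: "wcoef (monom_op m f) n = wcoef f (n + m)"
proof -
  have *: "wcoef (foldr (\<lambda>i g. (partial_deriv i ^^ lookup m i) g) xs f) n =
     wcoef f (n + (\<Sum>i\<in>set xs. single i (lookup m i)))"
    if "distinct xs" for xs n
    using that by (induction xs arbitrary: n) (simp_all add: wcoef_partial_deriv_pow add.assoc)
  show ?thesis
    unfolding monom_op_def by (simp add: * poly_mapping_sum_singles)
qed

text \<open>On rescaled coefficients a monomial operator is a pure index shift, so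
  \<open>diff_op q\<close> is the transpose of multiplication by \<open>q\<close>. Composition of
  operators then corresponds to multiplication of symbols.\<close>

lemma wcoef_diff_op:
  "wcoef (diff_op q f) n = (\<Sum>m\<in>keys q. lookup q m * wcoef f (n + m))"
  by (simp add: diff_op_def wcoef_sum wcoef_cscale wcoef_monom_op)

lemma wcoef_diff_op_superset:
  assumes "finite S" "keys q \<subseteq> S"
  shows "wcoef (diff_op q f) n = (\<Sum>m\<in>S. lookup q m * wcoef f (n + m))"
  unfolding wcoef_diff_op using assms by (intro sum.mono_neutral_left) (auto simp: in_keys_iff)

lemma diff_op_0_left [simp]: "diff_op 0 f = 0"
  by (simp add: diff_op_def)

lemma diff_op_0_right [simp]: "diff_op q 0 = 0"
  by (rule wcoef_eqI) (simp add: wcoef_diff_op)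

lemma diff_op_add_left: "diff_op (p + q) f = diff_op p f + diff_op q f"
proof (rule wcoef_eqI)
  fix n
  let ?S = "keys p \<union> keys q"
  have "wcoef (diff_op (p + q) f) n = (\<Sum>m\<in>?S. lookup (p + q) m * wcoef f (n + m))"
    using Poly_Mapping.keys_add[of p q] by (intro wcoef_diff_op_superset) auto
  also have "\<dots> = wcoef (diff_op p f + diff_op q f) n"
    by (simp add: wcoef_add wcoef_diff_op_superset[of ?S p] wcoef_diff_op_superset[of ?S q]
        lookup_add sum.distrib algebra_simps)
  finally show "wcoef (diff_op (p + q) f) n = wcoef (diff_op p f + diff_op q f) n" .
qed

lemma diff_op_add_right: "diff_op p (f + g) = diff_op p f + diff_op p g"
  by (rule wcoef_eqI) (simp add: wcoef_diff_op wcoef_add algebra_simps sum.distrib)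

lemma diff_op_cscale_right: "diff_op p (cscale c f) = cscale c (diff_op p f)"
  by (rule wcoef_eqI) (simp add: wcoef_diff_op wcoef_cscale algebra_simps sum_distrib_left)

lemma wcoef_diff_op_single [simp]:
  "wcoef (diff_op (single m c) f) n = c * wcoef f (n + m)"
  by (cases "c = 0") (simp_all add: wcoef_diff_op)

lemma diff_op_mult: "diff_op (p * q) f = diff_op p (diff_op q f)"
proof (induction p rule: poly_mapping_single_induct)
  case (single m c)
  show ?case
    by (induction q rule: poly_mapping_single_induct)
      (auto intro!: wcoef_eqI simp: mult_single diff_op_add_left diff_op_add_right wcoef_add algebra_simps)
qed (simp_all add: diff_op_add_left algebra_simps)

lemma diff_op_cconst [simp]: "diff_op (cconst c) f = cscale c f"
  by (rule wcoef_eqI) (simp add: cconst_def wcoef_cscale)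

lemma diff_op_1 [simp]: "diff_op 1 f = f"
  using diff_op_cconst[of 1 f] by simp

lemma diff_op_cscale_left: "diff_op (cscale c p) f = cscale c (diff_op p f)"
  unfolding cscale_def[of c p] by (simp add: diff_op_mult)

lemma diff_op_sum_left: "diff_op (sum g A) f = (\<Sum>a\<in>A. diff_op (g a) f)"
  by (induction A rule: infinite_finite_induct) (auto simp: diff_op_add_left)

lemma diff_op_cvar: "diff_op (cvar i) f = partial_deriv i f"
  by (rule wcoef_eqI) (simp add: cvar_def wcoef_partial_deriv)

lemma ceval_zero: "ceval f (\<lambda>_. 0) = wcoef f 0"
proof -
  have "ceval f (\<lambda>_. 0) = (\<Sum>m\<in>insert 0 (keys f). lookup f m * mpow (\<lambda>_. 0) m)"
    unfolding ceval_eq_ins by (rule ceval.ins_superset) auto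
  also have "\<dots> = (\<Sum>m\<in>insert 0 (keys f). if m = 0 then lookup f m else 0)"
  proof (intro sum.cong refl)
    fix m :: "nat \<Rightarrow>\<^sub>0 nat"
    show "lookup f m * mpow (\<lambda>_. 0) m = (if m = 0 then lookup f m else 0)"
    proof (cases "m = 0")
      case False
      then obtain i where "i \<in> keys m" by (metis ex_in_conv keys_eq_empty)
      then have "mpow (\<lambda>_. 0::complex) m = 0"
        unfolding mpow_def by (intro prod_zero) (auto simp: in_keys_iff)
      with False show ?thesis by simp
    qed simp
  qed
  finally show ?thesis by (simp add: wcoef_def)
qed

lemma std_pairing_wcoef: "std_pairing q f = wcoef (diff_op q f) 0"
  by (simp add: std_pairing_def ceval_zero)

lemma std_pairing_mult: "std_pairing (p * q) f = std_pairing p (diff_op q f)"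
  by (simp add: std_pairing_wcoef diff_op_mult)

lemma std_pairing_add_left: "std_pairing (p + q) f = std_pairing p f + std_pairing q f"
  by (simp add: std_pairing_wcoef diff_op_add_left wcoef_add)

lemma std_pairing_cscale_left: "std_pairing (cscale c p) f = c * std_pairing p f"
  by (simp add: std_pairing_wcoef diff_op_cscale_left wcoef_cscale)

lemma std_pairing_add_right: "std_pairing p (f + g) = std_pairing p f + std_pairing p g"
  by (simp add: std_pairing_wcoef diff_op_add_right wcoef_add)

lemma std_pairing_cscale_right: "std_pairing p (cscale c f) = c * std_pairing p f"
  by (simp add: std_pairing_wcoef diff_op_cscale_right wcoef_cscale)

text \<open>Monomials and rescaled coefficients are dual to each other; a functional on polynomials
  is later turned into a polynomial by prescribing its rescaled coefficients.\<close>

lemma std_pairing_single [simp]: "std_pairing (single m c) f = c * wcoef f m"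
  by (simp add: std_pairing_wcoef)

section \<open>Fractions with linear denominators\<close>

abbreviation "fscale c z \<equiv> to_fract (cconst c) * (z :: cpoly fract)"

interpretation fv: vector_space "\<lambda>c z. fscale c z"
  by unfold_locales (simp_all add: algebra_simps cconst_add cconst_mult)

abbreviation linear_forms :: "cpoly set"
  where "linear_forms \<equiv> cpoly.span (range cvar)"

abbreviation fract_prod :: "cpoly multiset \<Rightarrow> cpoly multiset \<Rightarrow> cpoly fract"
  where "fract_prod R T \<equiv> to_fract (\<Prod>\<^sub># R) / to_fract (\<Prod>\<^sub># T)"

text \<open>One definition covers both families, so that the expansion along \<open>x\<close> is
  carried out once: \<open>num\<close> allows products of forms as numerators, \<open>sp\<close>
  states whether the forms in the denominator span \<open>W\<close>. With \<open>num\<close> false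
  the numerator is the empty product 1, the source of the negative degree.\<close>

definition linear_fracts :: "bool \<Rightarrow> bool \<Rightarrow> cpoly set \<Rightarrow> cpoly fract set"
  where "linear_fracts num sp W =
    fv.span {fract_prod R T | R T. set_mset R \<subseteq> W \<and> (num \<or> R = {#}) \<and> set_mset T \<subseteq> W - {0} \<and>
      (cpoly.span (set_mset T) = W \<longleftrightarrow> sp)}"

abbreviation "polar_fracts \<equiv> linear_fracts False True"
abbreviation "degenerate_fracts \<equiv> linear_fracts True False"

lemma linear_fracts_subspace: "fv.subspace (linear_fracts num sp W)"
  by (simp add: linear_fracts_def fv.subspace_span)

lemma to_fract_pow: "to_fract (f ^ n :: cpoly) = to_fract f ^ n"
  by (induction n) auto

lemma fract_prod_mult: "fract_prod R1 T1 * fract_prod R2 T2 = fract_prod (R1 + R2) (T1 + T2)"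
  by simp

text \<open>A direct sum decomposition \<open>W = \<complex>x \<oplus> W'\<close> of a space of linear forms, with
  \<open>lam\<close> the coordinate along \<open>x\<close>. The ring \<open>regular\<close> is the localisation at the prime \<open>x\<close>,
  and \<open>expand k C\<close> consists of the fractions whose power series in \<open>x\<close> has its first \<open>k\<close>
  coefficients in \<open>C\<close>.\<close>

locale splitting =
  fixes x :: cpoly and lam :: "cpoly \<Rightarrow> complex" and W W' :: "cpoly set"
  assumes lam_add: "lam (u + v) = lam u + lam v"
    and lam_scale: "lam (cscale c u) = c * lam u"
    and lam_x: "lam x = 1"
    and W_linear: "W \<subseteq> linear_forms" and W_subspace: "cpoly.subspace W"
    and x_W: "x \<in> W" and W'_subspace: "cpoly.subspace W'"
    and W'_W: "W' \<subseteq> W" and lam_W': "w \<in> W' \<Longrightarrow> lam w = 0"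
    and proj_W: "w \<in> W \<Longrightarrow> w - cscale (lam w) x \<in> W'"
begin

definition proj :: "cpoly \<Rightarrow> cpoly"
  where "proj v = v - cscale (lam v) x"

text \<open>The quotient map modulo \<open>x\<close>, followed by the embedding of the quotient as
  the subring of polynomials fixed by \<open>subst\<close>. Since \<open>lam\<close> is defined on
  all of \<open>cpoly\<close>, variables outside \<open>W\<close> have a projection too.\<close>

definition subst :: "cpoly \<Rightarrow> cpoly"
  where "subst = ins cconst (\<lambda>i. proj (cvar i))"

sublocale S: insertion cconst "\<lambda>i. proj (cvar i)"
  by unfold_locales (auto simp: cconst_add cconst_mult)

lemma proj_add: "proj (u + v) = proj u + proj v"
  by (simp add: proj_def lam_add cpoly.scale_left_distrib)

lemma proj_scale: "proj (cscale c u) = cscale c (proj u)"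
  by (simp add: proj_def lam_scale cpoly.scale_right_diff_distrib)

lemma lam_0: "lam 0 = 0"
  using lam_add[of 0 0] by simp

lemma proj_0 [simp]: "proj 0 = 0"
  by (simp add: proj_def lam_0)

lemma subst_linear: "v \<in> linear_forms \<Longrightarrow> subst v = proj v"
proof (induction rule: cpoly.span_induct_alt)
  case base
  then show ?case by (simp add: subst_def)
next
  case (step c b y)
  then show ?case
    by (auto simp: subst_def S.ins_add proj_add proj_scale) (simp add: cscale_def)
qed

lemma subst_mult: "subst (f * g) = subst f * subst g"
  by (simp add: subst_def S.ins_mult)

lemma subst_add: "subst (f + g) = subst f + subst g"
  by (simp add: subst_def S.ins_add)

lemma subst_const [simp]: "subst (cconst c) = cconst c"
  by (simp add: subst_def)

lemma subst_1 [simp]: "subst 1 = 1"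
  by (simp add: subst_def)

lemma subst_x [simp]: "subst x = 0"
  using subst_linear[of x] x_W W_linear lam_x by (auto simp: proj_def)

lemma subst_W': "w \<in> W' \<Longrightarrow> subst w = w"
  using subst_linear[of w] W'_W W_linear lam_W'[of w] by (auto simp: proj_def)

lemma dvd_diff_subst: "x dvd f - subst f"
proof (induction f rule: cpoly_generators_induct)
  case (var i)
  then show ?case by (simp add: subst_def) (simp add: proj_def cscale_def)
next
  case (add f g)
  then show ?case using dvd_add[OF add] by (simp add: subst_add algebra_simps)
next
  case (mult f g)
  have "f * g - subst (f * g) = (f - subst f) * g + subst f * (g - subst g)"
    by (simp add: subst_mult algebra_simps)
  then show ?case using mult by simp
qed simp

text \<open>The kernel of \<open>subst\<close> is the principal ideal of \<open>x\<close>; as the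
  target is an integral domain, \<open>x\<close> is prime. The cancellation of denominator factors
  rests on this.\<close>

lemma dvd_iff_subst: "x dvd f \<longleftrightarrow> subst f = 0"
proof
  assume "x dvd f"
  then obtain g where "f = x * g" by blast
  then show "subst f = 0" by (simp add: subst_mult)
next
  assume "subst f = 0"
  then show "x dvd f" using dvd_diff_subst[of f] by simp
qed

lemma x_nonzero: "x \<noteq> 0"
  using lam_x lam_0 by auto

definition regular :: "cpoly fract set"
  where "regular = {to_fract a / to_fract b | a b. subst b \<noteq> 0}"

lemma regularI: "subst b \<noteq> 0 \<Longrightarrow> to_fract a / to_fract b \<in> regular"
  by (auto simp: regular_def)

lemma regularE:
  assumes "z \<in> regular"
  obtains a b where "z = to_fract a / to_fract b" "subst b \<noteq> 0" "b \<noteq> 0"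
  using assms S.ins_0 unfolding regular_def subst_def by force

lemma regular_to_fract [simp]: "to_fract a \<in> regular"
  using regularI[of 1 a] by simp

lemma regular_add: "z \<in> regular \<Longrightarrow> w \<in> regular \<Longrightarrow> z + w \<in> regular"
proof (elim regularE)
  fix a b c d assume *: "z = to_fract a / to_fract b" "subst b \<noteq> 0" "b \<noteq> 0"
    "w = to_fract c / to_fract d" "subst d \<noteq> 0" "d \<noteq> 0"
  then have "z + w = to_fract (a * d + c * b) / to_fract (b * d)"
    by (simp add: field_simps)
  then show ?thesis using * by (auto intro!: regularI simp: subst_mult simp del: to_fract_mult to_fract_add)
qed

lemma regular_mult: "z \<in> regular \<Longrightarrow> w \<in> regular \<Longrightarrow> z * w \<in> regular"
proof (elim regularE)
  fix a b c d assume *: "z = to_fract a / to_fract b" "subst b \<noteq> 0" "b \<noteq> 0"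
    "w = to_fract c / to_fract d" "subst d \<noteq> 0" "d \<noteq> 0"
  then have "z * w = to_fract (a * c) / to_fract (b * d)"
    by simp
  then show ?thesis using * by (auto intro!: regularI simp: subst_mult simp del: to_fract_mult to_fract_add)
qed

lemma regular_diff: "z \<in> regular \<Longrightarrow> w \<in> regular \<Longrightarrow> z - w \<in> regular"
  using regular_add[of z "to_fract (- 1) * w"] regular_mult[OF regular_to_fract[of "- 1"], of w]
  by (simp del: regular_to_fract)

text \<open>A copy of the residue field of \<open>regular\<close>: fractions of polynomials that do
  not involve \<open>x\<close>. Coefficients of power series in \<open>x\<close> are taken from
  here.\<close>

definition transversal :: "cpoly fract set"
  where "transversal = {to_fract a / to_fract b | a b. subst a = a \<and> subst b = b \<and> b \<noteq> 0}"

lemma transversal_subspace: "fv.subspace transversal"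
proof (rule fv.subspaceI)
  show "0 \<in> transversal"
    unfolding transversal_def by (intro CollectI exI[of _ 0] exI[of _ 1]) (simp add: subst_def)
next
  fix z w assume "z \<in> transversal" "w \<in> transversal"
  then obtain a b c d where *: "z = to_fract a / to_fract b" "subst a = a" "subst b = b" "b \<noteq> 0"
    "w = to_fract c / to_fract d" "subst c = c" "subst d = d" "d \<noteq> 0"
    unfolding transversal_def by blast
  then have "z + w = to_fract (a * d + c * b) / to_fract (b * d)"
    by (simp add: field_simps)
  with * show "z + w \<in> transversal"
    unfolding transversal_def
    by (intro CollectI exI[of _ "a * d + c * b"] exI[of _ "b * d"]) (simp add: subst_mult subst_add)
next
  fix c z assume "z \<in> transversal"
  then obtain a b where *: "z = to_fract a / to_fract b" "subst a = a" "subst b = b" "b \<noteq> 0"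
    unfolding transversal_def by blast
  then show "fscale c z \<in> transversal"
    unfolding transversal_def
    by (intro CollectI exI[of _ "cconst c * a"] exI[of _ b]) (simp add: subst_mult)
qed

lemma transversal_regular: "transversal \<subseteq> regular"
  unfolding transversal_def by (auto intro!: regularI)

text \<open>Modulo \<open>x\<close>, the cross-multiplied equation loses the side containing
  \<open>x\<close> and leaves the numerator times a nonzero factor. This makes the constant term of
  an expansion unique.\<close>

lemma transversal_0:
  assumes "z \<in> transversal" "z = to_fract x * w" "w \<in> regular"
  shows "z = 0"
proof -
  obtain a b where ab: "z = to_fract a / to_fract b" "subst a = a" "subst b = b" "b \<noteq> 0"
    using assms(1) unfolding transversal_def by blast
  obtain c d where cd: "w = to_fract c / to_fract d" "subst d \<noteq> 0" "d \<noteq> 0"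
    using assms(3) by (elim regularE)
  have "to_fract a / to_fract b = to_fract x * (to_fract c / to_fract d)"
    using assms(2) ab(1) cd(1) by metis
  then have "to_fract (a * d) = to_fract (x * c * b)"
    using ab(4) cd(3) by (simp add: field_simps)
  then have "a * d = x * c * b" by (simp only: to_fract_eq_iff)
  then have "subst (a * d) = 0" by (simp add: subst_mult)
  then have "a = 0" using ab cd by (simp add: subst_mult)
  then show ?thesis using ab by simp
qed

primrec expand :: "nat \<Rightarrow> cpoly fract set \<Rightarrow> cpoly fract set" where
  "expand 0 C = regular"
| "expand (Suc k) C = {c + to_fract x * z | c z. c \<in> C \<and> z \<in> expand k C}"

lemma expand_SucI: "c \<in> C \<Longrightarrow> z \<in> expand k C \<Longrightarrow> c + to_fract x * z \<in> expand (Suc k) C"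
  by auto

lemma expand_mono: "C \<subseteq> D \<Longrightarrow> expand k C \<subseteq> expand k D"
  by (induction k) auto

lemma expand_regular:
  assumes "C \<subseteq> transversal"
  shows "expand k C \<subseteq> regular"
  using assms transversal_regular by (induction k) (auto intro!: regular_add regular_mult)

lemma expand_add:
  assumes "fv.subspace C" "z \<in> expand k C" "w \<in> expand k C"
  shows "z + w \<in> expand k C"
  using assms(2,3)
proof (induction k arbitrary: z w)
  case (Suc k)
  then obtain c u d v where *: "z = c + to_fract x * u" "c \<in> C" "u \<in> expand k C"
    "w = d + to_fract x * v" "d \<in> C" "v \<in> expand k C" by auto
  then have "z + w = (c + d) + to_fract x * (u + v)" by (simp add: algebra_simps)
  moreover have "(c + d) + to_fract x * (u + v) \<in> expand (Suc k) C"
    using * Suc.IH fv.subspace_add[OF assms(1)] by (intro expand_SucI)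
  ultimately show ?case by simp
qed (simp add: regular_add)

lemma expand_0:
  assumes "fv.subspace C"
  shows "0 \<in> expand k C"
proof (induction k)
  case 0
  then show ?case using regular_to_fract[of 0] by simp
next
  case (Suc k)
  then show ?case using expand_SucI[OF fv.subspace_0[OF assms] Suc] by simp
qed

lemma expand_times_x:
  assumes "fv.subspace C" "z \<in> expand k C"
  shows "to_fract x * z \<in> expand (Suc k) C"
  using expand_SucI[OF fv.subspace_0[OF assms(1)] assms(2)] by simp

lemma expand_scale:
  assumes "fv.subspace C" "z \<in> expand k C"
  shows "fscale a z \<in> expand k C"
  using assms(2)
proof (induction k arbitrary: z)
  case 0
  then show ?case by (auto intro: regular_mult)
next
  case (Suc k)
  then obtain c u where "z = c + to_fract x * u" "c \<in> C" "u \<in> expand k C" by auto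
  moreover from this have "fscale a c + to_fract x * fscale a u \<in> expand (Suc k) C"
    using Suc.IH fv.subspace_scale[OF assms(1)] by (intro expand_SucI) auto
  ultimately show ?case by (simp add: algebra_simps)
qed

lemma expand_times_x_pow:
  assumes "fv.subspace C" "z \<in> expand k C"
  shows "to_fract x ^ n * z \<in> expand (n + k) C"
  using expand_times_x[OF assms(1)] assms(2) by (induction n) (auto simp: mult.assoc simp del: expand.simps)

lemma expand_Suc_subset:
  assumes "C \<subseteq> transversal"
  shows "expand (Suc k) C \<subseteq> expand k C"
proof (induction k)
  case 0
  then show ?case using expand_regular[OF assms, of 1] by simp
next
  case (Suc k)
  then show ?case unfolding expand.simps(2)[of "Suc k"] expand.simps(2)[of k C] by blast
qed

lemma expand_x_closed:
  assumes "fv.subspace C" "C \<subseteq> transversal" "z \<in> expand k C"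
  shows "to_fract x * z \<in> expand k C"
  using expand_times_x[OF assms(1,3)] expand_Suc_subset[OF assms(2)] by blast

lemma expand_times_coeff:
  assumes CD: "\<And>c d. c \<in> C \<Longrightarrow> d \<in> D \<Longrightarrow> c * d \<in> E" "C \<subseteq> transversal"
    and "c \<in> C" "z \<in> expand k D"
  shows "c * z \<in> expand k E"
  using assms(4)
proof (induction k arbitrary: z)
  case 0
  then show ?case using assms(2,3) transversal_regular by (auto intro: regular_mult)
next
  case (Suc k)
  then obtain d u where "z = d + to_fract x * u" "d \<in> D" "u \<in> expand k D" by auto
  with Suc.IH have "c * z = c * d + to_fract x * (c * u)" "c * d \<in> E" "c * u \<in> expand k E"
    using CD(1) assms(3) by (simp_all add: distrib_left mult.left_commute)
  then show ?case by (metis expand_SucI)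
qed

text \<open>The Cauchy product: (c + x u)(d + x v) = c d + x (c v + d u + x u v). The term x u v
  starts with the coefficient 0 and is truncated back to length \<open>k\<close>.\<close>

lemma expand_mult:
  assumes CD: "\<And>c d. c \<in> C \<Longrightarrow> d \<in> D \<Longrightarrow> c * d \<in> E" "C \<subseteq> transversal" "D \<subseteq> transversal" "E \<subseteq> transversal"
    and E: "fv.subspace E"
    and "z \<in> expand k C" "w \<in> expand k D"
  shows "z * w \<in> expand k E"
  using assms(6,7)
proof (induction k arbitrary: z w)
  case 0
  then show ?case by (auto intro: regular_mult)
next
  case (Suc k)
  then obtain c u d v where *: "z = c + to_fract x * u" "c \<in> C" "u \<in> expand k C"
    "w = d + to_fract x * v" "d \<in> D" "v \<in> expand k D" by auto
  have "c * v \<in> expand k E"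
    using * CD by (intro expand_times_coeff[of C D E]) auto
  moreover have "d * u \<in> expand k E"
  proof (rule expand_times_coeff[of D C E])
    show "d * c \<in> E" if "d \<in> D" "c \<in> C" for d c
      using CD(1)[OF that(2,1)] by (simp add: mult.commute)
  qed (use * CD in auto)
  moreover have "to_fract x * (u * v) \<in> expand k E"
    using Suc.IH * by (intro expand_x_closed E CD) auto
  ultimately have "c * v + d * u + to_fract x * (u * v) \<in> expand k E"
    using E by (intro expand_add)
  moreover have "z * w = c * d + to_fract x * (c * v + d * u + to_fract x * (u * v))"
    using * by (simp add: algebra_simps)
  ultimately show ?case using expand_SucI[of "c * d" E] * CD(1) by metis
qed

text \<open>By \<open>transversal_0\<close> the two expansions have equal coefficients, one after
  the other; each lies in \<open>C \<inter> D\<close> and so vanishes, and \<open>x\<close> can be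
  split off \<open>k\<close> times.\<close>

lemma expand_unique:
  assumes "fv.subspace C" "fv.subspace D" "C \<subseteq> transversal" "D \<subseteq> transversal" "C \<inter> D = {0}"
    and "z \<in> expand k C" "z \<in> expand k D"
  shows "\<exists>w\<in>regular. z = to_fract x ^ k * w"
  using assms(6,7)
proof (induction k arbitrary: z)
  case (Suc k)
  then obtain c u d v where *: "z = c + to_fract x * u" "c \<in> C" "u \<in> expand k C"
    "z = d + to_fract x * v" "d \<in> D" "v \<in> expand k D" unfolding expand.simps by blast
  have "c - d = to_fract x * (v - u)"
  proof -
    have "c + to_fract x * u = d + to_fract x * v" using * by metis
    then show ?thesis by (simp add: algebra_simps)
  qed
  moreover have "c - d \<in> transversal"
    using * assms(3,4) by (intro fv.subspace_diff transversal_subspace) auto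
  moreover have "v - u \<in> regular"
    using * expand_regular[OF assms(3)] expand_regular[OF assms(4)] by (intro regular_diff) auto
  ultimately have "c - d = 0" by (intro transversal_0) auto
  then have "c = d" by simp
  then have "c = 0" using * assms(5) by auto
  then have "u = v" using * \<open>c = d\<close> x_nonzero by auto
  then obtain w where "w \<in> regular" "u = to_fract x ^ k * w"
    using Suc.IH * by auto
  then show ?case using * \<open>c = 0\<close> by (auto simp: mult.assoc)
qed simp

text \<open>The span of the denominator is recorded exactly, and not only whether it is all of
  \<open>W'\<close>: exact spans are joined when fractions are multiplied, so an expansion can be
  assembled factor by factor.\<close>

definition coeff_fracts :: "bool \<Rightarrow> cpoly set \<Rightarrow> cpoly fract set"
  where "coeff_fracts num Y =
    fv.span {fract_prod R T | R T. set_mset R \<subseteq> W' \<and> (num \<or> R = {#}) \<and> set_mset T \<subseteq> W' - {0} \<and>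
      cpoly.span (set_mset T) = cpoly.span Y}"

lemma subst_prod_mset_W':
  assumes "set_mset R \<subseteq> W'"
  shows "subst (\<Prod>\<^sub># R) = \<Prod>\<^sub># R"
  using assms by (induction R) (auto simp: subst_mult subst_W')

lemma fract_prod_transversal:
  assumes "set_mset R \<subseteq> W'" "set_mset T \<subseteq> W' - {0}"
  shows "fract_prod R T \<in> transversal"
  unfolding transversal_def using assms
  by (intro CollectI exI[of _ "\<Prod>\<^sub># R"] exI[of _ "\<Prod>\<^sub># T"] conjI refl subst_prod_mset_W')
    (auto simp: prod_mset_zero_iff)

lemma fract_prod_coeff_fracts:
  assumes "set_mset R \<subseteq> W'" "num \<or> R = {#}" "set_mset T \<subseteq> W' - {0}"
  shows "fract_prod R T \<in> coeff_fracts num (set_mset T)"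
  unfolding coeff_fracts_def
  by (rule fv.span_base, rule CollectI, rule exI[of _ R], rule exI[of _ T]) (use assms in simp)

lemma coeff_fracts_transversal: "coeff_fracts num Y \<subseteq> transversal"
  unfolding coeff_fracts_def
  by (rule fv.span_minimal) (auto intro: fract_prod_transversal transversal_subspace)

lemma coeff_fracts_subspace: "fv.subspace (coeff_fracts num Y)"
  by (simp add: coeff_fracts_def fv.subspace_span)

lemma coeff_fracts_mult:
  assumes "c \<in> coeff_fracts num Y" "d \<in> coeff_fracts num Z"
  shows "c * d \<in> coeff_fracts num (Y \<union> Z)"
proof -
  let ?G = "\<lambda>Y. {fract_prod R T | R T. set_mset R \<subseteq> W' \<and> (num \<or> R = {#}) \<and> set_mset T \<subseteq> W' - {0} \<and>
      cpoly.span (set_mset T) = cpoly.span Y}"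
  have gen: "g * h \<in> ?G (Y \<union> Z)" if g: "g \<in> ?G Y" and h: "h \<in> ?G Z" for g h
  proof -
    obtain R T where 1: "g = fract_prod R T" "set_mset R \<subseteq> W'" "num \<or> R = {#}"
      "set_mset T \<subseteq> W' - {0}" "cpoly.span (set_mset T) = cpoly.span Y"
      using g by blast
    obtain R' T' where 2: "h = fract_prod R' T'" "set_mset R' \<subseteq> W'" "num \<or> R' = {#}"
      "set_mset T' \<subseteq> W' - {0}" "cpoly.span (set_mset T') = cpoly.span Z"
      using h by blast
    have "g * h = fract_prod (R + R') (T + T')" unfolding 1(1) 2(1) by (rule fract_prod_mult)
    moreover have "set_mset (R + R') \<subseteq> W'" "num \<or> R + R' = {#}" "set_mset (T + T') \<subseteq> W' - {0}"
      using 1(2-4) 2(2-4) by auto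
    moreover have "cpoly.span (set_mset (T + T')) = cpoly.span (Y \<union> Z)"
      unfolding set_mset_union cpoly.span_Un 1(5) 2(5) ..
    ultimately show ?thesis by (intro CollectI exI[of _ "R + R'"] exI[of _ "T + T'"] conjI)
  qed
  have 1: "g * d \<in> fv.span (?G (Y \<union> Z))" if "g \<in> ?G Y" "d \<in> fv.span (?G Z)" for g d
    using that(2)
  proof (induction rule: fv.span_induct_alt)
    case base
    then show ?case by (simp add: fv.span_zero)
  next
    case (step a h e)
    have eq: "g * (fscale a h + e) = fscale a (g * h) + g * e" by (simp add: algebra_simps)
    show ?case unfolding eq
      by (rule fv.span_add[OF fv.span_scale[OF fv.span_base[OF gen[OF that(1) step(1)]]] step(2)])
  qed
  show ?thesis
    using assms(1) unfolding coeff_fracts_def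
  proof (induction rule: fv.span_induct_alt)
    case base
    then show ?case by (simp add: fv.span_zero)
  next
    case (step a g e)
    have eq: "(fscale a g + e) * d = fscale a (g * d) + e * d" by (simp add: algebra_simps)
    show ?case unfolding eq
      by (rule fv.span_add[OF fv.span_scale[OF 1[OF step(1) assms(2)[unfolded coeff_fracts_def]]] step(2)])
  qed
qed

lemma expand_coeff_mult:
  assumes "z \<in> expand k (coeff_fracts num Y)" "w \<in> expand k (coeff_fracts num Z)"
  shows "z * w \<in> expand k (coeff_fracts num (Y \<union> Z))"
  using assms
  by (intro expand_mult[of "coeff_fracts num Y" "coeff_fracts num Z"] coeff_fracts_mult
      coeff_fracts_transversal coeff_fracts_subspace)

lemma expand_const: "to_fract (cconst c) \<in> expand k (coeff_fracts num {})"
proof (cases k)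
  case (Suc l)
  have "fract_prod {#} {#} \<in> coeff_fracts num {}"
    using fract_prod_coeff_fracts[of "{#}" num "{#}"] by simp
  from fv.subspace_scale[OF coeff_fracts_subspace this, of c]
  have "to_fract (cconst c) \<in> coeff_fracts num {}" by simp
  moreover have "0 \<in> expand l (coeff_fracts num {})" by (intro expand_0 coeff_fracts_subspace)
  ultimately show ?thesis using expand_SucI[of "to_fract (cconst c)" _ 0 l] Suc by simp
qed simp

lemma W_decomp: "y = proj y + cscale (lam y) x"
  by (simp add: proj_def)

lemma proj_in_W': "y \<in> W \<Longrightarrow> proj y \<in> W'"
  using proj_W by (simp add: proj_def)

lemma expand_linear:
  assumes "y \<in> W"
  shows "to_fract y \<in> expand k (coeff_fracts True {})"
proof (cases k)
  case (Suc l)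
  have "fract_prod {#proj y#} {#} \<in> coeff_fracts True {}"
    using fract_prod_coeff_fracts[of "{#proj y#}" True "{#}"] proj_in_W'[OF assms] by simp
  moreover have "to_fract y = fract_prod {#proj y#} {#} + to_fract x * to_fract (cconst (lam y))"
    by (subst W_decomp[of y]) (simp add: cscale_def)
  ultimately show ?thesis
    using expand_SucI[OF _ expand_const[of "lam y" l True]] unfolding Suc by metis
qed simp

text \<open>A geometric series: with P = \<open>proj y\<close> and l = \<open>lam y\<close>, 1/y =
  1/P - x (l/P)(1/y), and the induction hypothesis expands the 1/y on the right. The coefficients
  are constant multiples of powers of 1/P, so numerators stay constant and denominators keep the
  span of P.\<close>

lemma expand_inverse_linear:
  assumes "y \<in> W" "proj y \<noteq> 0"
  shows "1 / to_fract y \<in> expand k (coeff_fracts num {proj y})"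
proof (induction k)
  case 0
  show ?case using regularI[of y 1] assms subst_linear[of y] W_linear by auto
next
  case (Suc k)
  let ?C = "coeff_fracts num {proj y}"
  have y0: "y \<noteq> 0" using assms by auto
  have C: "1 / to_fract (proj y) \<in> ?C"
  proof -
    have "fract_prod {#} {#proj y#} \<in> ?C"
      using fract_prod_coeff_fracts[of "{#}" num "{#proj y#}"] proj_in_W'[OF assms(1)] assms(2) by simp
    then show ?thesis by simp
  qed
  have "fscale (- lam y) (1 / to_fract (proj y)) \<in> ?C"
    by (intro fv.subspace_scale coeff_fracts_subspace C)
  then have "fscale (- lam y) (1 / to_fract (proj y)) * (1 / to_fract y) \<in> expand k ?C"
    using coeff_fracts_mult[of _ num "{proj y}" _ "{proj y}"]
    by (intro expand_times_coeff[OF _ coeff_fracts_transversal _ Suc]) auto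
  moreover have "1 / to_fract y = 1 / to_fract (proj y) +
      to_fract x * (fscale (- lam y) (1 / to_fract (proj y)) * (1 / to_fract y))"
  proof -
    have eq: "to_fract y = to_fract (proj y) + to_fract (cconst (lam y)) * to_fract x"
      by (subst W_decomp[of y]) (simp add: cscale_def)
    have neg: "cconst (- lam y) = - cconst (lam y)"
      using cconst_add[of "- lam y" "lam y"] by (simp add: eq_neg_iff_add_eq_0)
    have *: "1 / Y = 1 / P + X * (- L * (1 / P) * (1 / Y))"
      if "Y = P + L * X" "Y \<noteq> 0" "P \<noteq> 0" for Y P L X :: "cpoly fract"
    proof -
      have "1 / P + X * (- L * (1 / P) * (1 / Y)) = (Y - L * X) / (P * Y)"
        using that(2,3) by (simp add: field_simps)
      also have "\<dots> = 1 / Y" using that by simp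
      finally show ?thesis by simp
    qed
    show ?thesis unfolding neg to_fract_uminus by (rule *[OF eq]) (use assms(2) y0 in simp_all)
  qed
  ultimately show ?case using expand_SucI[OF C] by metis
qed

lemma expand_fract_prod:
  assumes "set_mset R \<subseteq> W" "num \<or> R = {#}" "set_mset T \<subseteq> W" "\<And>y. y \<in># T \<Longrightarrow> proj y \<noteq> 0"
  shows "fract_prod R T \<in> expand k (coeff_fracts num (proj ` set_mset T))"
proof -
  have 1: "to_fract (\<Prod>\<^sub># R) \<in> expand k (coeff_fracts num {})"
    using assms(1,2)
  proof (induction R)
    case empty
    then show ?case using expand_const[of 1 k num] by simp
  next
    case (add y R)
    then show ?case
      using expand_coeff_mult[of "to_fract y" k num "{}" "to_fract (\<Prod>\<^sub># R)" "{}"] expand_linear[of y k] by simp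
  qed
  have 2: "1 / to_fract (\<Prod>\<^sub># T) \<in> expand k (coeff_fracts num (proj ` set_mset T))"
    using assms(3,4)
  proof (induction T)
    case empty
    then show ?case using expand_const[of 1 k num] by simp
  next
    case (add y T)
    then show ?case
      using expand_coeff_mult[of "1 / to_fract y" k num "{proj y}" "1 / to_fract (\<Prod>\<^sub># T)" "proj ` set_mset T"]
        expand_inverse_linear[of y k num] by simp
  qed
  show ?thesis using expand_coeff_mult[OF 1 2] by simp
qed

text \<open>Passage to the quotient by \<open>x\<close>. It depends on the nonzero multiple
  \<open>y\<close> of \<open>x\<close> in \<open>T\<close>: otherwise the projections could span
  \<open>W'\<close> while \<open>T\<close> fails to span \<open>W\<close>.\<close>

lemma span_proj:
  assumes "set_mset T \<subseteq> W" "y \<in># T" "proj y = 0" "y \<noteq> 0"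
  shows "cpoly.span (set_mset T) = W \<longleftrightarrow>
    cpoly.span (proj ` {y \<in> set_mset T. proj y \<noteq> 0}) = W'" (is "_ \<longleftrightarrow> cpoly.span ?Y = W'")
proof
  assume T: "cpoly.span (set_mset T) = W"
  have "proj w \<in> cpoly.span ?Y" if "w \<in> cpoly.span (set_mset T)" for w
    using that
  proof (induction rule: cpoly.span_induct_alt)
    case base
    then show ?case by (simp add: cpoly.span_zero)
  next
    case (step c b z)
    have "proj b \<in> cpoly.span ?Y"
      using step(1) by (cases "proj b = 0") (auto simp: cpoly.span_zero intro: cpoly.span_base)
    with step(2) show ?case by (simp add: proj_add proj_scale cpoly.span_add cpoly.span_scale)
  qed
  then have "W' \<subseteq> cpoly.span ?Y"
    using T W'_W lam_W' by (force simp: proj_def)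
  moreover have "cpoly.span ?Y \<subseteq> W'"
    using assms(1) by (intro cpoly.span_minimal W'_subspace) (auto intro: proj_in_W')
  ultimately show "cpoly.span ?Y = W'" by blast
next
  assume Y: "cpoly.span ?Y = W'"
  have "y = cscale (lam y) x" using assms(3) W_decomp[of y] by simp
  with assms(4) have "lam y \<noteq> 0" by auto
  then have "cscale (1 / lam y) y = x"
    using arg_cong[OF \<open>y = cscale (lam y) x\<close>, of "cscale (1 / lam y)"] by simp
  moreover have "cscale (1 / lam y) y \<in> cpoly.span (set_mset T)"
    using assms(2) by (intro cpoly.span_scale cpoly.span_base)
  ultimately have x: "x \<in> cpoly.span (set_mset T)" by simp
  have "?Y \<subseteq> cpoly.span (set_mset T)"
    using x by (auto simp: proj_def intro!: cpoly.span_diff cpoly.span_scale intro: cpoly.span_base)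
  then have *: "W' \<subseteq> cpoly.span (set_mset T)"
    using Y cpoly.span_minimal[OF _ cpoly.subspace_span] by blast
  have "w \<in> cpoly.span (set_mset T)" if "w \<in> W" for w
  proof (subst W_decomp[of w], intro cpoly.span_add cpoly.span_scale x)
    show "proj w \<in> cpoly.span (set_mset T)" using * proj_in_W'[OF that] by blast
  qed
  moreover have "cpoly.span (set_mset T) \<subseteq> W"
    using assms(1) W_subspace by (rule cpoly.span_minimal)
  ultimately show "cpoly.span (set_mset T) = W" by blast
qed

lemma expand_clear_denominator:
  assumes R: "set_mset R \<subseteq> W" "num \<or> R = {#}" and T: "set_mset T \<subseteq> W - {0}" and C: "fv.subspace C"
    and cC: "\<And>Y. Y = proj ` {y \<in> set_mset T. proj y \<noteq> 0} \<Longrightarrow>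
      (cpoly.span (set_mset T) = W \<longleftrightarrow> cpoly.span Y = W') \<Longrightarrow> coeff_fracts num Y \<subseteq> C"
  shows "\<exists>k. to_fract x ^ k * fract_prod R T \<in> expand k C"
proof -
  let ?T0 = "filter_mset (\<lambda>y. proj y \<noteq> 0) T" and ?T1 = "filter_mset (\<lambda>y. \<not> proj y \<noteq> 0) T"
  \<comment> \<open>A form with zero projection is a multiple of \<open>x\<close>, so these factors
    contribute a power of \<open>x\<close> up to a constant, which \<open>expand_scale\<close>
    absorbs at the end.\<close>
  have "\<exists>c. \<Prod>\<^sub># S = cscale c (x ^ size S) \<and> c \<noteq> 0"
    if "\<And>y. y \<in># S \<Longrightarrow> y \<noteq> 0 \<and> proj y = 0" for S
    using that
  proof (induction S)
    case empty
    then show ?case by (intro exI[of _ 1]) simp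
  next
    case (add y S)
    then obtain c where c: "\<Prod>\<^sub># S = cscale c (x ^ size S)" "c \<noteq> 0" by auto
    have y: "y = cscale (lam y) x" using add.prems W_decomp[of y] by simp
    have "lam y \<noteq> 0"
    proof
      assume "lam y = 0"
      then show False using y add.prems[of y] by simp
    qed
    moreover have "y * \<Prod>\<^sub># S = cscale (lam y) x * cscale c (x ^ size S)"
      using c(1) y by (rule_tac arg_cong2[of _ _ _ _ "(*)"])
    then have "\<Prod>\<^sub># (add_mset y S) = cscale (lam y * c) (x ^ size (add_mset y S))" by simp
    ultimately show ?case using c by auto
  qed
  from this[of ?T1] obtain c where c: "\<Prod>\<^sub># ?T1 = cscale c (x ^ size ?T1)" "c \<noteq> 0"
    using T by auto
  define k where "k = size ?T1"
  have "\<Prod>\<^sub># T = \<Prod>\<^sub># ?T0 * \<Prod>\<^sub># ?T1"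
    by (induction T) (auto simp: ac_simps)
  then have P: "\<Prod>\<^sub># T = cconst c * (\<Prod>\<^sub># ?T0 * x ^ k)"
    using c by (simp add: k_def cscale_def algebra_simps)
  have cc: "cconst c * cconst (1 / c) = 1" using c(2) by (simp flip: cconst_mult)
  then have cc': "1 / to_fract (cconst c) = to_fract (cconst (1 / c))"
  proof -
    have "to_fract (cconst c) * to_fract (cconst (1 / c)) = 1"
      using cc by (metis to_fract_1 to_fract_mult)
    then show ?thesis by (metis mult_eq_0_iff nonzero_mult_div_cancel_left zero_neq_one)
  qed
  have "to_fract x ^ k * fract_prod R T = 1 / to_fract (cconst c) * fract_prod R ?T0"
    using x_nonzero by (simp add: P to_fract_pow)
  then have eq: "to_fract x ^ k * fract_prod R T = fscale (1 / c) (fract_prod R ?T0)"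
    unfolding cc' .
  have ex: "fract_prod R ?T0 \<in> expand k (coeff_fracts num (proj ` set_mset ?T0))"
    using R T by (intro expand_fract_prod) auto
  have "fract_prod R ?T0 \<in> expand k C"
  proof (cases "?T1 = {#}")
    case True
    \<comment> \<open>Without a factor proportional to \<open>x\<close>, \<open>span_proj\<close>
      does not apply; but then \<open>k = 0\<close>, and \<open>expand 0 C\<close> asks only for
      regularity.\<close>
    have "k = 0" unfolding k_def True by simp
    then show ?thesis using ex by simp
  next
    case False
    then obtain y where y: "y \<in># T" "proj y = 0" by (auto simp: filter_mset_eq_conv)
    have "coeff_fracts num (proj ` set_mset ?T0) \<subseteq> C"
      using cC[of "proj ` set_mset ?T0"] span_proj[of T y] T y by (auto simp: set_mset_filter)
    then show ?thesis using ex expand_mono by blast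
  qed
  then have "fscale (1 / c) (fract_prod R ?T0) \<in> expand k C" by (rule expand_scale[OF C])
  then show ?thesis using eq by metis
qed

text \<open>Fractions whose polar part along \<open>x\<close> has all its coefficients in
  \<open>C\<close>; the regular part is unrestricted. Asking for all large \<open>n\<close> makes
  the set closed under sums of fractions with different pole orders.\<close>

definition expandable :: "cpoly fract set \<Rightarrow> cpoly fract set"
  where "expandable C = {z. \<exists>k. \<forall>n\<ge>k. to_fract x ^ n * z \<in> expand n C}"

lemma expandableI:
  assumes "fv.subspace C" "to_fract x ^ k * z \<in> expand k C"
  shows "z \<in> expandable C"
  unfolding expandable_def
proof (intro CollectI exI[of _ k] allI impI)
  fix n assume "k \<le> n"
  then have "to_fract x ^ n = to_fract x ^ (n - k) * to_fract x ^ k"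
    by (simp flip: power_add)
  then show "to_fract x ^ n * z \<in> expand n C"
    using expand_times_x_pow[OF assms, of "n - k"] \<open>k \<le> n\<close> by (simp add: mult.assoc)
qed

lemma expandable_subspace:
  assumes C: "fv.subspace C"
  shows "fv.subspace (expandable C)"
proof (rule fv.subspaceI)
  show "0 \<in> expandable C"
    using expand_0[OF C, of 0] by (intro expandableI[OF C, of 0]) simp
next
  fix z w assume "z \<in> expandable C" "w \<in> expandable C"
  then obtain k l where "\<forall>n\<ge>k. to_fract x ^ n * z \<in> expand n C" "\<forall>n\<ge>l. to_fract x ^ n * w \<in> expand n C"
    unfolding expandable_def by blast
  then have "to_fract x ^ n * (z + w) \<in> expand n C" if "n \<ge> max k l" for n
    using that expand_add[OF C] by (simp add: distrib_left)
  then show "z + w \<in> expandable C" unfolding expandable_def by blast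
next
  fix c z assume "z \<in> expandable C"
  then obtain k where "\<forall>n\<ge>k. to_fract x ^ n * z \<in> expand n C"
    unfolding expandable_def by blast
  then have "to_fract x ^ n * fscale c z \<in> expand n C" if "n \<ge> k" for n
    using that expand_scale[OF C, of "to_fract x ^ n * z" n c] by (simp add: mult.left_commute)
  then show "fscale c z \<in> expandable C" unfolding expandable_def by blast
qed

text \<open>The reduction of dimension: the polar coefficients along \<open>x\<close> belong to the
  same family over the smaller space \<open>W'\<close>, whether the denominators span or
  not.\<close>

lemma linear_fracts_expandable: "linear_fracts num sp W \<subseteq> expandable (linear_fracts num sp W')"
  unfolding linear_fracts_def[of num sp W]
proof (rule fv.span_minimal)
  let ?C = "linear_fracts num sp W'"
  note C = linear_fracts_subspace[of num sp W']
  show "fv.subspace (expandable ?C)" by (rule expandable_subspace[OF C])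
  show "{fract_prod R T | R T. set_mset R \<subseteq> W \<and> (num \<or> R = {#}) \<and> set_mset T \<subseteq> W - {0} \<and>
      (cpoly.span (set_mset T) = W \<longleftrightarrow> sp)} \<subseteq> expandable ?C"
  proof
    fix z assume "z \<in> {fract_prod R T | R T. set_mset R \<subseteq> W \<and> (num \<or> R = {#}) \<and> set_mset T \<subseteq> W - {0} \<and>
      (cpoly.span (set_mset T) = W \<longleftrightarrow> sp)}"
    then obtain R T where T: "set_mset R \<subseteq> W" "num \<or> R = {#}" "set_mset T \<subseteq> W - {0}"
      "cpoly.span (set_mset T) = W \<longleftrightarrow> sp" "z = fract_prod R T" by blast
    have "\<exists>k. to_fract x ^ k * fract_prod R T \<in> expand k ?C"
    proof (rule expand_clear_denominator[OF T(1,2,3) C])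
      fix Y assume "cpoly.span (set_mset T) = W \<longleftrightarrow> cpoly.span Y = W'"
      then have "cpoly.span Y = W' \<longleftrightarrow> sp" using T(4) by simp
      then show "coeff_fracts num Y \<subseteq> ?C"
        unfolding coeff_fracts_def linear_fracts_def
        by (intro fv.span_mono Collect_mono impI, elim exE conjE, intro exI conjI) (assumption | simp)+
    qed
    then show "z \<in> expandable ?C" unfolding T(5) using expandableI[OF C] by blast
  qed
qed

lemma linear_fracts_transversal: "linear_fracts num sp W' \<subseteq> transversal"
  unfolding linear_fracts_def
  by (rule fv.span_minimal[OF _ transversal_subspace]) (auto intro: fract_prod_transversal)

text \<open>The polar part along \<open>x\<close> has coefficients in both families over
  \<open>W'\<close>, which meet only in 0. Hence \<open>x ^ n * z\<close> is \<open>x ^ n\<close>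
  times a regular fraction, and the power cancels.\<close>

lemma polar_degenerate_regular:
  assumes "polar_fracts W' \<inter> degenerate_fracts W' \<subseteq> {0}"
    and z: "z \<in> polar_fracts W" "z \<in> degenerate_fracts W"
  shows "z \<in> regular"
proof -
  obtain k l where kl: "\<forall>n\<ge>k. to_fract x ^ n * z \<in> expand n (polar_fracts W')"
    "\<forall>n\<ge>l. to_fract x ^ n * z \<in> expand n (degenerate_fracts W')"
    using z linear_fracts_expandable unfolding expandable_def by blast
  define n where "n = max k l"
  have "\<exists>w\<in>regular. to_fract x ^ n * z = to_fract x ^ n * w"
  proof (rule expand_unique[OF linear_fracts_subspace linear_fracts_subspace
        linear_fracts_transversal linear_fracts_transversal])
    show "polar_fracts W' \<inter> degenerate_fracts W' = {0}"
      using assms(1) fv.subspace_0[OF linear_fracts_subspace] by blast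
    show "to_fract x ^ n * z \<in> expand n (polar_fracts W')" "to_fract x ^ n * z \<in> expand n (degenerate_fracts W')"
      using kl by (auto simp: n_def)
  qed
  then show ?thesis using x_nonzero by auto
qed

end

lemma degenerate_fracts_fraction:
  assumes "z \<in> degenerate_fracts W"
  shows "\<exists>h T. set_mset T \<subseteq> W - {0} \<and> z = to_fract h / to_fract (\<Prod>\<^sub># T)"
  using assms unfolding linear_fracts_def
proof (induction rule: fv.span_induct_alt)
  case base
  show ?case by (intro exI[of _ 0] exI[of _ "{#}"]) simp
next
  case (step c g z)
  then obtain h T R S where *: "set_mset T \<subseteq> W - {0}" "z = to_fract h / to_fract (\<Prod>\<^sub># T)"
    "g = fract_prod R S" "set_mset S \<subseteq> W - {0}" by blast
  then have "\<Prod>\<^sub># T \<noteq> 0" "\<Prod>\<^sub># S \<noteq> 0" by (auto simp: prod_mset_zero_iff)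
  then have "fscale c g + z = to_fract (cconst c * \<Prod>\<^sub># R * \<Prod>\<^sub># T + h * \<Prod>\<^sub># S) / to_fract (\<Prod>\<^sub># (S + T))"
    using * by (simp add: add_frac_eq)
  then show ?case using *
    by (intro exI[of _ "cconst c * \<Prod>\<^sub># R * \<Prod>\<^sub># T + h * \<Prod>\<^sub># S"] exI[of _ "S + T"]) auto
qed

text \<open>The polynomial f(t s_1, t s_2, ...) in an auxiliary variable t. Its degree in t is the
  total degree of \<open>f\<close>, which thereby becomes additive on products; the value at t = 1
  returns \<open>f\<close>, so nonzero polynomials stay nonzero.\<close>

definition homogenize :: "cpoly \<Rightarrow> cpoly poly"
  where "homogenize = ins (\<lambda>c. [:cconst c:]) (\<lambda>i. [:0, cvar i:])"

interpretation homogenize: insertion "\<lambda>c. [:cconst c:]" "\<lambda>i. [:0, cvar i:]"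
  by unfold_locales (simp_all add: cconst_add cconst_mult one_pCons)

lemma poly_homogenize_1: "poly (homogenize f) 1 = f"
  by (induction f rule: cpoly_generators_induct)
    (simp_all add: homogenize_def homogenize.ins_add homogenize.ins_mult)

lemma homogenize_eq_0_iff [simp]: "homogenize f = 0 \<longleftrightarrow> f = 0"
  using poly_homogenize_1[of f] by (auto simp: homogenize_def)

lemma homogenize_linear: "v \<in> linear_forms \<Longrightarrow> homogenize v = [:0, v:]"
proof (induction rule: cpoly.span_induct_alt)
  case base
  then show ?case by (simp add: homogenize_def)
next
  case (step c b y)
  then show ?case
    by (auto simp: homogenize_def homogenize.ins_add) (simp add: cscale_def)
qed

lemma degree_homogenize_prod_mset:
  assumes "set_mset T \<subseteq> linear_forms - {0}"
  shows "degree (homogenize (\<Prod>\<^sub># T)) = size T"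
  using assms
proof (induction T)
  case empty
  then show ?case by (simp add: homogenize_def)
next
  case (add y T)
  have "homogenize (y * \<Prod>\<^sub># T) = homogenize y * homogenize (\<Prod>\<^sub># T)"
    by (simp add: homogenize_def homogenize.ins_mult)
  moreover have "homogenize y \<noteq> 0" "homogenize (\<Prod>\<^sub># T) \<noteq> 0"
    using add.prems by (auto simp: prod_mset_zero_iff)
  ultimately show ?case
    using add homogenize_linear[of y] by (simp add: degree_mult_eq)
qed

text \<open>A denominator whose forms span \<open>W \<noteq> {0}\<close> has at least one factor, so
  each generator has negative degree; this survives addition over a common denominator.\<close>

lemma polar_fracts_negative_degree:
  assumes "z \<in> polar_fracts W" "W \<subseteq> linear_forms" "W \<noteq> {0}"
  shows "\<exists>h T. set_mset T \<subseteq> linear_forms - {0} \<and> z = to_fract h / to_fract (\<Prod>\<^sub># T) \<and>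
    (h = 0 \<or> degree (homogenize h) < size T)"
  using assms(1) unfolding linear_fracts_def
proof (induction rule: fv.span_induct_alt)
  case base
  show ?case by (intro exI[of _ 0] exI[of _ "{#}"]) simp
next
  case (step c g z)
  then obtain h T S where *: "set_mset T \<subseteq> linear_forms - {0}" "z = to_fract h / to_fract (\<Prod>\<^sub># T)"
    "h = 0 \<or> degree (homogenize h) < size T"
    "g = fract_prod {#} S" "set_mset S \<subseteq> linear_forms - {0}" "cpoly.span (set_mset S) = W"
    using assms(2) by blast
  have S: "S \<noteq> {#}" using * assms(3) by auto
  let ?h = "cconst c * \<Prod>\<^sub># T + h * \<Prod>\<^sub># S"
  have nz: "\<Prod>\<^sub># T \<noteq> 0" "\<Prod>\<^sub># S \<noteq> 0" using * by (auto simp: prod_mset_zero_iff)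
  then have eq: "fscale c g + z = to_fract ?h / to_fract (\<Prod>\<^sub># (S + T))"
    using * by (simp add: add_frac_eq)
  have "degree (homogenize (cconst c * \<Prod>\<^sub># T)) \<le> size T"
    using degree_homogenize_prod_mset[OF *(1)]
    degree_mult_le[of "[:cconst c:]" "homogenize (\<Prod>\<^sub># T)"]
    by (simp add: homogenize_def homogenize.ins_mult)
  then have d1: "degree (homogenize (cconst c * \<Prod>\<^sub># T)) < size (S + T)"
    using S by (simp add: nonempty_has_size order_le_less_trans)
  have d2: "degree (homogenize (h * \<Prod>\<^sub># S)) < size (S + T)"
  proof (cases "h = 0")
    case True
    then show ?thesis using S by (simp add: homogenize_def nonempty_has_size)
  next
    case False
    then show ?thesis using * degree_homogenize_prod_mset[OF *(5)]
      degree_mult_le[of "homogenize h" "homogenize (\<Prod>\<^sub># S)"]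
      by (simp add: homogenize_def homogenize.ins_mult)
  qed
  have "degree (homogenize ?h) < size (S + T)"
    using degree_add_less[OF d1 d2] by (simp add: homogenize_def homogenize.ins_add)
  then show ?case using eq * by (intro exI[of _ ?h] exI[of _ "S + T"]) auto
qed

text \<open>By induction on the dimension: a common element has no pole along any linear form, hence is
  a polynomial, but elements of \<open>polar_fracts W\<close> have negative degree.\<close>

lemma polar_degenerate_disjoint:
  assumes "finite A" "A \<subseteq> linear_forms"
  shows "polar_fracts (cpoly.span A) \<inter> degenerate_fracts (cpoly.span A) \<subseteq> {0}"
  using assms
proof (induction "card A" arbitrary: A rule: less_induct)
  case less
  let ?W = "cpoly.span A"
  have W: "?W \<subseteq> linear_forms" using less.prems(2) by (intro cpoly.span_minimal cpoly.subspace_span)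
  show ?case
  proof
    fix z assume z: "z \<in> polar_fracts ?W \<inter> degenerate_fracts ?W"
    have reg: "\<exists>lam W'. splitting x lam ?W W' \<and> z \<in> splitting.regular x lam" if x: "x \<in> ?W" "x \<noteq> 0" for x
    proof -
      have "cpoly.independent {x}" using x by simp
      then obtain B where B: "{x} \<subseteq> B" "B \<subseteq> ?W" "cpoly.independent B" "?W \<subseteq> cpoly.span B"
        using cpoly.maximal_independent_subset_extend[of "{x}" ?W] x by auto
      have finB: "finite B" and cardB: "card B \<le> card A"
        using cpoly.independent_span_bound[OF less.prems(1) B(3,2)] by auto
      have spanB: "cpoly.span B = ?W"
        using B by (metis cpoly.span_minimal cpoly.subspace_span subset_antisym)
      \<comment> \<open>\<open>lam\<close> has to be linear on all of \<open>cpoly\<close>; the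
        basis of \<open>?W\<close> is therefore extended to a basis of the full polynomial space,
        and \<open>lam\<close> is the coordinate at \<open>x\<close>.\<close>
      define E where "E = cpoly.extend_basis B"
      have E: "cpoly.independent E" "cpoly.span E = UNIV" "B \<subseteq> E"
        using B(3) by (simp_all add: E_def cpoly.independent_extend_basis cpoly.extend_basis_superset)
      define lam where "lam v = cpoly.representation E v x" for v
      let ?W' = "cpoly.span (B - {x})"
      have lam_B: "lam b = (if b = x then 1 else 0)" if "b \<in> B" for b
        using that E by (auto simp: lam_def cpoly.representation_basis)
      interpret splitting x lam ?W ?W'
      proof
        show add: "lam (u + v) = lam u + lam v" for u v
          using E by (simp add: lam_def cpoly.representation_add)
        show scale: "lam (cscale c u) = c * lam u" for c u
          using E by (simp add: lam_def cpoly.representation_scale)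
        show "lam x = 1" using lam_B[of x] B(1) by simp
        show "?W \<subseteq> linear_forms" by (rule W)
        show "?W' \<subseteq> ?W" using spanB cpoly.span_mono[of "B - {x}" B] by auto
        have lam0: "lam 0 = 0" using add[of 0 0] by simp
        show "lam w = 0" if "w \<in> ?W'" for w
          using that
        proof (induction rule: cpoly.span_induct_alt)
          case (step c b y)
          then show ?case using lam_B[of b] by (simp add: add scale)
        qed (rule lam0)
        show "w - cscale (lam w) x \<in> ?W'" if "w \<in> ?W" for w
          using that unfolding spanB[symmetric]
        proof (induction rule: cpoly.span_induct_alt)
          case base
          then show ?case by (simp add: lam0 cpoly.span_zero)
        next
          case (step c b y)
          have "b - cscale (lam b) x \<in> ?W'"
            using lam_B[OF step(1)] step(1) by (auto simp: cpoly.span_zero intro: cpoly.span_base)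
          then have "cscale c (b - cscale (lam b) x) + (y - cscale (lam y) x) \<in> ?W'"
            using step(2) by (intro cpoly.span_add cpoly.span_scale)
          then show ?case
            by (simp add: add scale cpoly.scale_left_distrib cpoly.scale_right_diff_distrib algebra_simps)
        qed
      qed (auto simp: cpoly.subspace_span x)
      have "card (B - {x}) < card A"
        using finB cardB B(1) by (metis card_Diff1_less insert_subset order_less_le_trans)
      then have "polar_fracts ?W' \<inter> degenerate_fracts ?W' \<subseteq> {0}"
        using finB B(2) W by (intro less.hyps) auto
      then have "z \<in> regular" using z by (intro polar_degenerate_regular) auto
      then show ?thesis using splitting_axioms by blast
    qed
    \<comment> \<open>A representation of \<open>z\<close> with the fewest linear factors in the
      denominator is taken; any remaining factor \<open>x\<close> would cancel, because
      \<open>z\<close> is regular at \<open>x\<close>.\<close>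
    define Q where "Q n \<longleftrightarrow> (\<exists>h T. set_mset T \<subseteq> ?W - {0} \<and> z = to_fract h / to_fract (\<Prod>\<^sub># T) \<and> size T = n)" for n
    have "\<exists>n. Q n" using degenerate_fracts_fraction z unfolding Q_def by blast
    define n where "n = (LEAST n. Q n)"
    have "Q n" unfolding n_def using \<open>\<exists>n. Q n\<close> by (rule LeastI_ex)
    then obtain h T where T: "set_mset T \<subseteq> ?W - {0}" "z = to_fract h / to_fract (\<Prod>\<^sub># T)" "size T = n"
      unfolding Q_def by blast
    have "T = {#}"
    proof (rule ccontr)
      assume "T \<noteq> {#}"
      then obtain x T' where x: "T = add_mset x T'" by (metis multiset_cases)
      then have "x \<in> ?W" "x \<noteq> 0" using T(1) by auto
      from reg[OF this] obtain lam W' where "splitting x lam ?W W'" and zr: "z \<in> splitting.regular x lam" by blast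
      interpret splitting x lam ?W W' by fact
      obtain a b where ab: "z = to_fract a / to_fract b" "subst b \<noteq> 0" "b \<noteq> 0"
        using zr by (elim regularE)
      have nz: "\<Prod>\<^sub># T \<noteq> 0" "\<Prod>\<^sub># T' \<noteq> 0" using T(1) x by (auto simp: prod_mset_zero_iff)
      have "to_fract (h * b) = to_fract (a * \<Prod>\<^sub># T)"
        using ab T(2) nz by (simp add: frac_eq_eq)
      then have "h * b = a * \<Prod>\<^sub># T" by (simp only: to_fract_eq_iff)
      then have "subst h * subst b = 0" using x by (simp flip: subst_mult) (simp add: subst_mult)
      then have "x dvd h" using ab(2) by (simp add: dvd_iff_subst)
      then obtain h' where "h = x * h'" by blast
      then have "z = to_fract h' / to_fract (\<Prod>\<^sub># T')"
        using T(2) x \<open>x \<noteq> 0\<close> by simp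
      then have "Q (size T')" using T(1) x unfolding Q_def by auto
      then have "n \<le> size T'" unfolding n_def by (rule Least_le)
      then show False using T(3) x by simp
    qed
    then have zh: "z = to_fract h" using T(2) by simp
    show "z \<in> {0}"
    proof (cases "?W = {0}")
      case True
      then have "degenerate_fracts ?W = {0}"
        unfolding linear_fracts_def by auto
      then show ?thesis using z by auto
    next
      case False
      then obtain g S where S: "set_mset S \<subseteq> linear_forms - {0}" "z = to_fract g / to_fract (\<Prod>\<^sub># S)"
        "g = 0 \<or> degree (homogenize g) < size S"
        using polar_fracts_negative_degree[of z ?W] z W by auto
      have nz: "\<Prod>\<^sub># S \<noteq> 0" using S(1) by (auto simp: prod_mset_zero_iff)
      have "to_fract g = to_fract (h * \<Prod>\<^sub># S)" using S(2) nz zh by (simp add: field_simps)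
      then have g: "g = h * \<Prod>\<^sub># S" by (simp only: to_fract_eq_iff)
      have "h = 0"
      proof (rule ccontr)
        assume "h \<noteq> 0"
        then have "degree (homogenize g) = degree (homogenize h) + size S"
          using nz degree_homogenize_prod_mset[OF S(1)] homogenize_eq_0_iff[of h] homogenize_eq_0_iff[of "\<Prod>\<^sub># S"]
          by (simp add: g homogenize_def homogenize.ins_mult degree_mult_eq)
        then show False using S(3) \<open>h \<noteq> 0\<close> nz g by auto
      qed
      then show ?thesis using zh by simp
    qed
  qed
qed

section \<open>Duality of the continuous spaces\<close>

lemma add_mset_subseteqI:
  assumes "Z \<subseteq># M" "x \<in># M - Z"
  shows "add_mset x Z \<subseteq># M"
proof -
  have "Z + {#x#} \<subseteq># Z + (M - Z)" using assms(2) by (intro subset_mset.add_left_mono) simp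
  then show ?thesis using assms(1) by simp
qed

lemma mset_nths_Un_complement: "mset (nths Y I) + mset (nths Y (- I)) = mset Y"
proof (induction Y arbitrary: I)
  case (Cons x Y)
  have "{j. Suc j \<in> - I} = - {j. Suc j \<in> I}" by auto
  then show ?case using Cons[of "{j. Suc j \<in> I}"] by (simp add: nths_Cons)
qed simp

lemma mset_nths_mono: "I \<subseteq> J \<Longrightarrow> mset (nths Y I) \<subseteq># mset (nths Y J)"
proof (induction Y arbitrary: I J)
  case (Cons x Y)
  have "{j. Suc j \<in> I} \<subseteq> {j. Suc j \<in> J}" using Cons.prems by auto
  then have *: "mset (nths Y {j. Suc j \<in> I}) \<subseteq># mset (nths Y {j. Suc j \<in> J})" by (rule Cons.IH)
  show ?case
  proof (cases "0 \<in> I")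
    case True
    then show ?thesis using * Cons.prems by (auto simp: nths_Cons)
  next
    case False
    then show ?thesis using * subset_mset.add_increasing[of "{#x#}", OF _ *] by (simp add: nths_Cons)
  qed
qed simp

lemma submset_eq_mset_nths:
  assumes "Z \<subseteq># mset Y"
  shows "\<exists>I\<subseteq>{..<length Y}. mset (nths Y I) = Z"
  using assms
proof (induction Y arbitrary: Z)
  case Nil
  then show ?case by simp
next
  case (Cons x Y)
  show ?case
  proof (cases "x \<in># Z")
    case True
    then obtain Z' where Z': "Z = add_mset x Z'" by (metis multi_member_split)
    with Cons.prems obtain I where I: "I \<subseteq> {..<length Y}" "mset (nths Y I) = Z'"
      using Cons.IH[of Z'] by auto
    have "{j. Suc j \<in> insert 0 (Suc ` I)} = I" by auto
    then show ?thesis using I Z' by (intro exI[of _ "insert 0 (Suc ` I)"]) (auto simp: nths_Cons)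
  next
    case False
    have "Z \<subseteq># mset Y"
      unfolding subseteq_mset_def
    proof
      fix a show "count Z a \<le> count (mset Y) a"
        using False Cons.prems mset_subset_eq_count[of Z "mset (x # Y)" a]
        by (cases "a = x") (auto simp: not_in_iff)
    qed
    then obtain I where I: "I \<subseteq> {..<length Y}" "mset (nths Y I) = Z"
      using Cons.IH[of Z] by auto
    have "{j. Suc j \<in> Suc ` I} = I" by auto
    then show ?thesis using I by (intro exI[of _ "Suc ` I"]) (auto simp: nths_Cons)
  qed
qed

lemma mset_nths_complement: "mset (nths Y (- I)) = mset Y - mset (nths Y I)"
  using mset_nths_Un_complement[of Y I] by (metis add_diff_cancel_left')

lemma spans_nths_complement:
  "spans (nths Y (- I)) \<longleftrightarrow> span (set_mset (mset Y - mset (nths Y I))) = UNIV"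
  unfolding spans_def by (simp flip: mset_nths_complement)

lemma mset_nths_subset: "mset (nths Y I) \<subseteq># mset Y"
  using mset_nths_Un_complement[of Y I] by (metis mset_subset_eq_add_left)

lemma cocircuit_nonspanning:
  assumes "C \<in> cocircuits Y"
  shows "mset C \<subseteq># mset Y" "span (set_mset (mset Y - mset C)) \<noteq> UNIV"
  using assms unfolding cocircuits_def spans_nths_complement by (auto intro: mset_nths_subset)

text \<open>Minimality is sought among sets of positions, as in the definition of cocircuits.
  Cocircuits can thus be replaced by arbitrary \<open>Z\<close> with nonspanning complement, a class
  closed under enlarging \<open>Z\<close>.\<close>

lemma nonspanning_contains_cocircuit:
  assumes "Z \<subseteq># mset Y" "span (set_mset (mset Y - Z)) \<noteq> UNIV"
  shows "\<exists>C\<in>cocircuits Y. mset C \<subseteq># Z"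
proof -
  obtain I where I: "I \<subseteq> {..<length Y}" "mset (nths Y I) = Z"
    using submset_eq_mset_nths[OF assms(1)] by blast
  let ?S = "{J. J \<subseteq> I \<and> \<not> spans (nths Y (- J))}"
  have fin: "finite ?S" using I(1) by (intro finite_subset[of ?S "Pow {..<length Y}"]) auto
  have "I \<in> ?S" using assms(2) I(2) by (simp add: spans_nths_complement)
  then have "?S \<noteq> {}" by blast
  from finite_has_minimal[OF fin this] obtain J where J: "J \<subseteq> I" "\<not> spans (nths Y (- J))"
    and min: "\<And>K. K \<in> ?S \<Longrightarrow> K \<subseteq> J \<Longrightarrow> J = K" by auto
  have "spans (nths Y (- K))" if "K \<subset> J" for K
    using min[of K] that J(1) by blast
  then have "nths Y J \<in> cocircuits Y"
    unfolding cocircuits_def using J I(1) by (intro CollectI exI[of _ J]) auto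
  then show ?thesis using mset_nths_mono[of J I Y] J(1) I(2) by auto
qed

section \<open>Degrees of monomials, and polynomials in finitely many variables\<close>

definition mdeg :: "(nat \<Rightarrow>\<^sub>0 nat) \<Rightarrow> nat"
  where "mdeg m = (\<Sum>i\<in>keys m. lookup m i)"

lemma mdeg_add: "mdeg (m + n) = mdeg m + mdeg n"
proof -
  let ?S = "keys m \<union> keys n"
  have sup: "mdeg k = (\<Sum>i\<in>?S. lookup k i)" if "keys k \<subseteq> ?S" for k
    unfolding mdeg_def using that by (intro sum.mono_neutral_left) (auto simp: in_keys_iff)
  show ?thesis
    by (simp add: sup[of m] sup[of n] sup[of "m + n"] keys_nat_add lookup_add sum.distrib)
qed

lemma monomial_eq_prod_mset:
  "\<exists>R. set_mset R \<subseteq> cvar ` keys m \<and> single m 1 = \<Prod>\<^sub># R \<and> size R = mdeg m"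
proof (induction m rule: poly_mapping_single_induct)
  case zero
  show ?case by (intro exI[of _ "{#}"]) (simp add: mdeg_def)
next
  case (single i k)
  have "single (single i k) 1 = cvar i ^ k"
    by (simp flip: mpow_cvar)
  then show ?case
    by (intro exI[of _ "replicate_mset k (cvar i)"]) (auto simp: mdeg_def in_keys_iff)
next
  case (add m n)
  then obtain R S where *: "set_mset R \<subseteq> cvar ` keys m" "single m 1 = \<Prod>\<^sub># R" "size R = mdeg m"
    "set_mset S \<subseteq> cvar ` keys n" "single n 1 = \<Prod>\<^sub># S" "size S = mdeg n" by blast
  have "single (m + n) 1 = single m 1 * single n (1::complex)"
    by (simp add: mult_single)
  with * show ?case
    by (intro exI[of _ "R + S"]) (auto simp: keys_nat_add mdeg_add)
qed

lemma finite_bounded_monomials: "finite {m. keys m \<subseteq> {..<k} \<and> mdeg m \<le> n}"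
proof (rule finite_imageD)
  have le: "lookup m i \<le> mdeg m" for m i
    unfolding mdeg_def by (cases "i \<in> keys m") (auto intro: member_le_sum simp: in_keys_iff)
  have "lookup ` {m. keys m \<subseteq> {..<k} \<and> mdeg m \<le> n} \<subseteq>
      {g. \<forall>i. (i \<in> {..<k} \<longrightarrow> g i \<in> {..n}) \<and> (i \<notin> {..<k} \<longrightarrow> g i = 0)}"
  proof (intro subsetI CollectI allI conjI impI, elim imageE CollectE conjE)
    fix g m i assume *: "g = lookup m" "mdeg m \<le> n"
    show "g i \<in> {..n}" using order_trans[OF le[of m i] *(2)] by (simp add: *(1))
  next
    fix g i assume "g \<in> lookup ` {m. keys m \<subseteq> {..<k} \<and> mdeg m \<le> n}" "i \<notin> {..<k}"
    then show "g i = 0" by (auto simp: subset_iff in_keys_iff)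
  qed
  moreover have "finite {g::nat \<Rightarrow> nat. \<forall>i. (i \<in> {..<k} \<longrightarrow> g i \<in> {..n}) \<and> (i \<notin> {..<k} \<longrightarrow> g i = 0)}"
    by (rule finite_set_of_finite_funs) auto
  ultimately show "finite (lookup ` {m. keys m \<subseteq> {..<k} \<and> mdeg m \<le> n})"
    by (rule finite_subset)
  show "inj_on lookup {m. keys m \<subseteq> {..<k} \<and> mdeg m \<le> n}"
    by (auto intro: inj_onI poly_mapping_eqI)
qed

lemma wcoef_cpolys: "f \<in> cpolys n \<longleftrightarrow> (\<forall>m. wcoef f m \<noteq> 0 \<longrightarrow> keys m \<subseteq> {..<n})"
  by (auto simp: cpolys_def wcoef_def in_keys_iff)

lemma diff_op_cpolys:
  assumes "f \<in> cpolys n"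
  shows "diff_op q f \<in> cpolys n"
  unfolding wcoef_cpolys
proof (intro allI impI)
  fix m assume "wcoef (diff_op q f) m \<noteq> 0"
  then obtain k where "wcoef f (m + k) \<noteq> 0"
    unfolding wcoef_diff_op by (metis (no_types, lifting) mult_eq_0_iff sum.neutral)
  then show "keys m \<subseteq> {..<n}"
    using assms unfolding wcoef_cpolys by (metis Un_subset_iff keys_nat_add)
qed

lemma cpolys_subspace: "cpoly.subspace (cpolys n)"
proof (rule cpoly.subspaceI)
  fix f g assume "f \<in> cpolys n" "g \<in> cpolys n"
  then show "f + g \<in> cpolys n"
    unfolding cpolys_def using Poly_Mapping.keys_add[of f g] by blast
qed (auto simp: wcoef_cpolys wcoef_cscale)

lemma cpolys_mult:
  assumes "f \<in> cpolys n" "g \<in> cpolys n"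
  shows "f * g \<in> cpolys n"
  unfolding cpolys_def
proof (intro CollectI ballI)
  fix m assume "m \<in> keys (f * g)"
  then obtain a b where "m = a + b" "a \<in> keys f" "b \<in> keys g"
    using keys_mult[of f g] by blast
  then show "keys m \<subseteq> {..<n}"
    using assms unfolding cpolys_def by (simp add: keys_nat_add)
qed

lemma cpolys_single: "keys m \<subseteq> {..<n} \<Longrightarrow> single m c \<in> cpolys n"
  by (auto simp: cpolys_def)

lemma cpolys_1: "1 \<in> cpolys n"
  using cpolys_single[of 0 n 1] by simp

section \<open>Coordinates and the linear forms of vectors\<close>

locale coordinates =
  fixes bs :: "'a::real_vector list"
  assumes distinct_bs: "distinct bs" and independent_bs: "independent (set bs)"
    and span_bs: "span (set bs) = UNIV"
begin

abbreviation "co \<equiv> coord bs"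
abbreviation "lf \<equiv> lin_form bs"
abbreviation "d \<equiv> length bs"

definition lprod :: "'a multiset \<Rightarrow> cpoly"
  where "lprod Z = (\<Prod>x\<in>#Z. lf x)"

definition forms :: "cpoly set"
  where "forms = cpoly.span (cvar ` {..<d})"

lemma lin_prod_eq: "lin_prod bs Y = lprod (mset Y)"
  by (simp add: lin_prod_def lprod_def flip: prod_mset_prod_list mset_map)

lemma co_add: "co (u + v) i = co u i + co v i"
  by (simp add: coord_def representation_add independent_bs span_bs)

lemma co_scale: "co (r *\<^sub>R u) i = r * co u i"
  by (simp add: coord_def representation_scale independent_bs span_bs)

lemma co_0 [simp]: "co 0 i = 0"
  by (simp add: coord_def representation_zero)

lemma co_diff: "co (u - v) i = co u i - co v i"
  by (simp add: coord_def representation_diff independent_bs span_bs)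

lemma co_basis: "i < d \<Longrightarrow> j < d \<Longrightarrow> co (bs ! i) j = (if i = j then 1 else 0)"
  using distinct_bs by (simp add: coord_def representation_basis independent_bs nth_eq_iff_index_eq)

lemma sum_set_bs: "(\<Sum>b\<in>set bs. g b) = (\<Sum>i<d. g (bs ! i))"
  by (metis distinct_bs bij_betw_nth lessThan_atLeast0 sum.reindex_bij_betw)

lemma co_expansion: "(\<Sum>i<d. co u i *\<^sub>R bs ! i) = u"
proof -
  have "(\<Sum>b\<in>set bs. representation (set bs) u b *\<^sub>R b) = u"
    by (rule sum_representation_eq) (auto simp: independent_bs span_bs)
  then show ?thesis by (simp add: coord_def sum_set_bs)
qed

lemma co_eqI:
  assumes "\<And>i. i < d \<Longrightarrow> co u i = co v i"
  shows "u = v"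
proof -
  have "(\<Sum>i<d. co u i *\<^sub>R bs ! i) = (\<Sum>i<d. co v i *\<^sub>R bs ! i)"
    using assms by (intro sum.cong) auto
  then show ?thesis by (simp add: co_expansion)
qed

lemma lf_add: "lf (u + v) = lf u + lf v"
  by (simp add: lin_form_def co_add cpoly.scale_left_distrib sum.distrib)

lemma lf_scale: "lf (r *\<^sub>R u) = cscale (of_real r) (lf u)"
  by (simp add: lin_form_def co_scale cpoly.scale_sum_right)

lemma lf_0 [simp]: "lf 0 = 0"
  by (simp add: lin_form_def)

lemma lf_basis: "i < d \<Longrightarrow> lf (bs ! i) = cvar i"
proof -
  assume i: "i < d"
  then have "lf (bs ! i) = (\<Sum>j<d. if i = j then cvar j else 0)"
    unfolding lin_form_def by (intro sum.cong) (auto simp: co_basis)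
  with i show ?thesis by simp
qed

lemma lookup_lf: "lookup (lf u) (single i 1) = (if i < d then of_real (co u i) else 0)"
proof -
  have *: "single j (1::nat) = single i 1 \<longleftrightarrow> j = i" for j
    by (metis keys_single one_neq_zero singleton_inject)
  have "lookup (lf u) (single i 1) =
    (\<Sum>j<d. if j = i then of_real (co u j) else 0)"
    unfolding lin_form_def lookup_sum cvar_def lookup_cscale lookup_single when_def *
    by (intro sum.cong) auto
  then show ?thesis by simp
qed

lemma lf_eq_0_iff [simp]: "lf u = 0 \<longleftrightarrow> u = 0"
proof
  assume "lf u = 0"
  then have "co u i = 0" if "i < d" for i
    using lookup_lf[of u i] that by simp
  then show "u = 0" by (intro co_eqI) simp
qed simp

lemma lf_forms: "lf u \<in> forms"
  unfolding lin_form_def forms_def by (intro cpoly.span_sum cpoly.span_scale cpoly.span_base) auto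

lemma lf_span: "u \<in> span T \<Longrightarrow> lf u \<in> cpoly.span (lf ` T)"
proof (induction rule: span_induct_alt)
  case base
  then show ?case by (simp add: cpoly.span_zero)
next
  case (step c x y)
  then show ?case
    by (simp add: lf_add lf_scale cpoly.span_add cpoly.span_scale cpoly.span_base)
qed

text \<open>Complexification of a real space. To return from complex to real spanning, the real
  parts of the coefficients of a combination are taken; they still represent a real vector because
  the coordinates of \<open>T\<close> are real.\<close>

lemma span_lf_iff: "cpoly.span (lf ` T) = forms \<longleftrightarrow> span T = UNIV"
proof
  assume *: "cpoly.span (lf ` T) = forms"
  have re: "\<exists>u\<in>span T. \<forall>i<d. co u i = Re (lookup p (single i 1))"
    if "p \<in> cpoly.span (lf ` T)" for p
    using that
  proof (induction rule: cpoly.span_induct_alt)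
    case base
    show ?case by (intro bexI[of _ 0]) (auto simp: span_zero)
  next
    case (step c b y)
    then obtain t u where *: "t \<in> T" "b = lf t" "u \<in> span T"
      "\<forall>i<d. co u i = Re (lookup y (single i 1))" by blast
    have "Re c *\<^sub>R t + u \<in> span T"
      using span_add[OF span_scale[OF span_base]] * by blast
    moreover have "co (Re c *\<^sub>R t + u) i = Re (lookup (cscale c b + y) (single i 1))"
      if "i < d" for i
    proof -
      have "co u i = Re (lookup y (single i 1))" using * that by blast
      moreover have "lookup b (single i 1) = of_real (co t i)"
        unfolding *(2) lookup_lf using that by (rule if_P)
      ultimately show ?thesis
        unfolding lookup_add lookup_cscale co_add co_scale by simp
    qed
    ultimately show ?case by blast
  qed
  have "v \<in> span T" for v
  proof -
    have "lf v \<in> cpoly.span (lf ` T)" using * lf_forms by blast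
    then obtain u where u: "u \<in> span T" "\<forall>i<d. co u i = Re (lookup (lf v) (single i 1))"
      using re by blast
    have "u = v"
    proof (rule co_eqI)
      fix i assume i: "i < d"
      then have "co u i = Re (lookup (lf v) (single i 1))" using u(2) by blast
      also have "\<dots> = co v i" unfolding lookup_lf using i by simp
      finally show "co u i = co v i" .
    qed
    with u show ?thesis by simp
  qed
  then show "span T = UNIV" by blast
next
  assume "span T = UNIV"
  then have "lf (bs ! i) \<in> cpoly.span (lf ` T)" for i
    by (intro lf_span) auto
  then have "cvar ` {..<d} \<subseteq> cpoly.span (lf ` T)"
    by (metis (no_types, lifting) image_subsetI lessThan_iff lf_basis)
  then have "forms \<subseteq> cpoly.span (lf ` T)"
    unfolding forms_def by (intro cpoly.span_minimal cpoly.subspace_span)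
  moreover have "cpoly.span (lf ` T) \<subseteq> forms"
    by (rule cpoly.span_minimal) (auto simp: lf_forms, simp add: forms_def)
  ultimately show "cpoly.span (lf ` T) = forms" by blast
qed

lemma lprod_empty [simp]: "lprod {#} = 1"
  and lprod_add_mset [simp]: "lprod (add_mset x Z) = lf x * lprod Z"
  and lprod_union: "lprod (Z + Z') = lprod Z * lprod Z'"
  by (simp_all add: lprod_def)

lemma lprod_nonzero: "0 \<notin># Z \<Longrightarrow> lprod Z \<noteq> 0"
  by (induction Z) auto

lemma lprod_zero: "0 \<in># Z \<Longrightarrow> lprod Z = 0"
  by (induction Z) auto

lemma P_space_eq:
  "P_space bs Y = cpoly.span {lprod Z | Z. Z \<subseteq># mset Y \<and> span (set_mset (mset Y - Z)) = UNIV}"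
proof -
  have "{lin_prod bs (nths Y I) | I. I \<subseteq> {..<length Y} \<and> spans (nths Y (- I))} =
      {lprod Z | Z. Z \<subseteq># mset Y \<and> span (set_mset (mset Y - Z)) = UNIV}"
    unfolding lin_prod_eq spans_nths_complement
  proof (intro subset_antisym subsetI)
    fix p assume "p \<in> {lprod Z | Z. Z \<subseteq># mset Y \<and> span (set_mset (mset Y - Z)) = UNIV}"
    then obtain Z where Z: "p = lprod Z" "Z \<subseteq># mset Y" "span (set_mset (mset Y - Z)) = UNIV" by blast
    obtain I where "I \<subseteq> {..<length Y}" "mset (nths Y I) = Z"
      using submset_eq_mset_nths[OF Z(2)] by blast
    then show "p \<in> {lprod (mset (nths Y I)) | I. I \<subseteq> {..<length Y} \<and>
        span (set_mset (mset Y - mset (nths Y I))) = UNIV}" using Z by blast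
  qed (auto intro: mset_nths_subset)
  then show ?thesis by (simp add: P_space_def)
qed

lemma lf_cpolys: "lf u \<in> cpolys d"
  unfolding lin_form_def cvar_def
  by (intro cpoly.subspace_sum cpoly.subspace_scale cpolys_subspace cpolys_single) auto

lemma lprod_cpolys: "lprod Z \<in> cpolys d"
  by (induction Z) (auto intro: cpolys_mult lf_cpolys cpolys_1)

lemma P_space_cpolys: "P_space bs Y \<subseteq> cpolys d"
  unfolding P_space_eq by (rule cpoly.span_minimal[OF _ cpolys_subspace]) (auto intro: lprod_cpolys)

text \<open>Annihilation by the ideal is tested on its generators, and a product over a
  \<open>Z\<close> with nonspanning complement is a multiple of the product over a cocircuit inside
  \<open>Z\<close>.\<close>

lemma D_space_iff:
  "f \<in> D_space bs Y \<longleftrightarrow> f \<in> cpolys d \<and>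
    (\<forall>Z. Z \<subseteq># mset Y \<longrightarrow> span (set_mset (mset Y - Z)) \<noteq> UNIV \<longrightarrow> diff_op (lprod Z) f = 0)"
proof (cases "f \<in> cpolys d")
  case True
  have 1: "(\<forall>q\<in>J_ideal bs Y. diff_op q f = 0) \<longleftrightarrow> (\<forall>C\<in>cocircuits Y. diff_op (lprod (mset C)) f = 0)"
  proof (intro iffI ballI)
    fix C assume *: "\<forall>q\<in>J_ideal bs Y. diff_op q f = 0" "C \<in> cocircuits Y"
    have "lin_prod bs C \<in> J_ideal bs Y"
      unfolding J_ideal_def ideal_gen_def
      by (intro CollectI exI[of _ "\<lambda>_. 1"] exI[of _ "{lin_prod bs C}"]) (use * in \<open>auto simp: cpolys_def\<close>)
    then show "diff_op (lprod (mset C)) f = 0" using * by (simp add: lin_prod_eq)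
  next
    fix q assume *: "\<forall>C\<in>cocircuits Y. diff_op (lprod (mset C)) f = 0" "q \<in> J_ideal bs Y"
    then obtain r F where "q = (\<Sum>g\<in>F. r g * g)" "F \<subseteq> lin_prod bs ` cocircuits Y"
      unfolding J_ideal_def ideal_gen_def by blast
    then show "diff_op q f = 0"
      using *(1) by (auto simp: diff_op_sum_left diff_op_mult lin_prod_eq intro!: sum.neutral)
  qed
  have 2: "diff_op (lprod Z) f = 0" 
    if C: "\<forall>C\<in>cocircuits Y. diff_op (lprod (mset C)) f = 0" and Z: "Z \<subseteq># mset Y" "span (set_mset (mset Y - Z)) \<noteq> UNIV" for Z
  proof -
    obtain C where C': "C \<in> cocircuits Y" "mset C \<subseteq># Z" using nonspanning_contains_cocircuit[OF Z] by blast
    then have "lprod Z = lprod (Z - mset C) * lprod (mset C)"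
      by (simp flip: lprod_union)
    then show ?thesis using C C' by (simp add: diff_op_mult)
  qed
  show ?thesis unfolding D_space_def using True 1 2 cocircuit_nonspanning[of _ Y] by auto
qed (simp add: D_space_def)

text \<open>A spanning set of directions yields all partial derivatives, and every nonconstant
  rescaled coefficient of \<open>f\<close> is a rescaled coefficient of one of them.\<close>

lemma const_if_derivatives_0:
  assumes "f \<in> cpolys d" "span T = UNIV" "\<And>x. x \<in> T \<Longrightarrow> diff_op (lf x) f = 0" "wcoef f 0 = 0"
  shows "f = 0"
proof (rule wcoef_eqI)
  fix m
  have d0: "diff_op (lf u) f = 0" if "u \<in> span T" for u
    using that
  proof (induction rule: span_induct_alt)
    case (step c x y)
    then show ?case using assms(3)[of x] by (simp add: lf_add lf_scale diff_op_add_left diff_op_cscale_left)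
  qed simp
  show "wcoef f m = wcoef 0 m"
  proof (cases "m = 0 \<or> \<not> keys m \<subseteq> {..<d}")
    case True
    then show ?thesis using assms(1,4) unfolding wcoef_cpolys by auto
  next
    case False
    then obtain i where i: "i \<in> keys m" "i < d"
      by (metis keys_eq_empty ex_in_conv lessThan_iff subsetD)
    have "m = m - single i 1 + single i 1"
      using i(1) by (intro poly_mapping_eqI) (auto simp: lookup_add lookup_minus lookup_single when_def in_keys_iff)
    then have "wcoef f m = wcoef (partial_deriv i f) (m - single i 1)"
      by (simp add: wcoef_partial_deriv)
    also have "partial_deriv i f = 0"
      using d0[of "bs ! i"] assms(2) i(2) by (simp add: lf_basis diff_op_cvar)
    finally show ?thesis by simp
  qed
qed

theorem D_space_eq_0:
  assumes f: "f \<in> D_space bs Y" and P: "\<And>q. q \<in> P_space bs Y \<Longrightarrow> std_pairing q f = 0"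
  shows "f = 0"
proof -
  have fc: "f \<in> cpolys d" using f by (simp add: D_space_iff)
  have "diff_op (lprod Z) f = 0" if "Z \<subseteq># mset Y" for Z
    using that
  proof (induction "size (mset Y - Z)" arbitrary: Z rule: less_induct)
    case less
    show ?case
    proof (cases "span (set_mset (mset Y - Z)) = UNIV")
      case False
      then show ?thesis using f less.prems by (simp add: D_space_iff)
    next
      case True
      show ?thesis
      proof (rule const_if_derivatives_0[OF diff_op_cpolys[OF fc] True])
        fix x assume x: "x \<in> set_mset (mset Y - Z)"
        then have sub: "add_mset x Z \<subseteq># mset Y"
          using less.prems by (intro add_mset_subseteqI) auto
        have "size (mset Y - add_mset x Z) < size (mset Y - Z)"
          using x size_Diff1_less[of x "mset Y - Z"] by simp
        from less.hyps[OF this sub] show "diff_op (lf x) (diff_op (lprod Z) f) = 0"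
          by (simp add: diff_op_mult)
      next
        have "lprod Z \<in> P_space bs Y"
          unfolding P_space_eq using less.prems True by (intro cpoly.span_base) blast
        then show "wcoef (diff_op (lprod Z) f) 0 = 0" using P by (simp add: std_pairing_wcoef)
      qed
    qed
  qed
  from this[of "{#}"] show ?thesis by simp
qed

text \<open>The ideal J(Y) for \<open>M = mset Y\<close>, written as a linear span: monomials are
  products of forms, and after division the generators match those of
  \<open>degenerate_fracts\<close>.\<close>

definition J_space :: "'a multiset \<Rightarrow> cpoly set"
  where "J_space M = cpoly.span {lprod Z * \<Prod>\<^sub># R | Z R.
    Z \<subseteq># M \<and> span (set_mset (M - Z)) \<noteq> UNIV \<and> set_mset R \<subseteq> forms}"

lemma to_fract_cscale: "to_fract (cscale c f) = fscale c (to_fract f)"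
  by (simp add: cscale_def)

lemma P_space_Int_J_space: "P_space bs Y \<inter> J_space (mset Y) \<subseteq> {0}"
proof
  fix q assume q: "q \<in> P_space bs Y \<inter> J_space (mset Y)"
  \<comment> \<open>Zero vectors are dropped to keep the common denominator nonzero. Generators with
    0 in \<open>Z\<close> vanish, and for the others zeros do not affect the span of the
    complement.\<close>
  define M where "M = filter_mset (\<lambda>x. x \<noteq> 0) (mset Y)"
  define F where "F p = to_fract p / to_fract (lprod M)" for p
  have nz: "lprod N \<noteq> 0" if "N \<subseteq># M" for N
    using that mset_subset_eqD by (intro lprod_nonzero) (fastforce simp: M_def)
  have Fadd: "F (cscale c p + p') = fscale c (F p) + F p'" for c p p'
    by (simp add: F_def to_fract_cscale add_divide_distrib)
  have gen: "Z \<subseteq># M \<and> F (lprod Z * \<Prod>\<^sub># R) = fract_prod R (image_mset lf (M - Z)) \<and>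
      set_mset (image_mset lf (M - Z)) \<subseteq> forms - {0} \<and>
      (cpoly.span (set_mset (image_mset lf (M - Z))) = forms \<longleftrightarrow> span (set_mset (mset Y - Z)) = UNIV)"
    if Z: "Z \<subseteq># mset Y" "0 \<notin># Z" for Z R
  proof (intro conjI)
    show ZM: "Z \<subseteq># M"
      unfolding subseteq_mset_def M_def
    proof
      fix a show "count Z a \<le> count (filter_mset (\<lambda>x. x \<noteq> 0) (mset Y)) a"
        using Z mset_subset_eq_count[of Z "mset Y" a] by (cases "a = 0") (auto simp: not_in_iff)
    qed
    have "M = Z + (M - Z)" using ZM by simp
    then have "lprod M = lprod Z * lprod (M - Z)" by (metis lprod_union)
    then show "F (lprod Z * \<Prod>\<^sub># R) = fract_prod R (image_mset lf (M - Z))"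
      using nz[OF ZM] by (simp add: F_def lprod_def)
    have "x \<noteq> 0" if "x \<in># M - Z" for x
      using that in_diffD[of x M Z] by (auto simp: M_def)
    then show "set_mset (image_mset lf (M - Z)) \<subseteq> forms - {0}" using lf_forms by auto
    have "set_mset (M - Z) = set_mset (mset Y - Z) - {0}"
      unfolding M_def using Z(2) by (auto simp: in_diff_count not_in_iff split: if_splits)
    then have "span (set_mset (M - Z)) = span (set_mset (mset Y - Z))"
      by (simp add: span_delete_0)
    then show "cpoly.span (set_mset (image_mset lf (M - Z))) = forms \<longleftrightarrow> span (set_mset (mset Y - Z)) = UNIV"
      by (simp add: span_lf_iff)
  qed
  have fracts: "F p \<in> linear_fracts num sp forms"
    if "p \<in> cpoly.span {lprod Z * \<Prod>\<^sub># R | Z R. Z \<subseteq># mset Y \<and>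
      (span (set_mset (mset Y - Z)) = UNIV \<longleftrightarrow> sp) \<and> set_mset R \<subseteq> forms \<and> (num \<or> R = {#})}" for p num sp
    using that
  proof (induction rule: cpoly.span_induct_alt)
    case base
    then show ?case by (simp add: F_def fv.subspace_0 linear_fracts_subspace)
  next
    case (step c b y)
    then obtain Z R where Z: "b = lprod Z * \<Prod>\<^sub># R" "Z \<subseteq># mset Y" "span (set_mset (mset Y - Z)) = UNIV \<longleftrightarrow> sp"
      "set_mset R \<subseteq> forms" "num \<or> R = {#}" by blast
    have "F b \<in> linear_fracts num sp forms"
    proof (cases "0 \<in># Z")
      case True
      then show ?thesis using Z by (simp add: lprod_zero F_def fv.subspace_0 linear_fracts_subspace)
    next
      case False
      have "F b = fract_prod R (image_mset lf (M - Z))"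
        using gen[OF Z(2) False, of R] Z(1) by simp
      then show ?thesis using gen[OF Z(2) False, of R] Z(3-5)
        unfolding linear_fracts_def by (intro fv.span_base) blast
    qed
    then show ?case using step(2) unfolding Fadd linear_fracts_def by (intro fv.span_add fv.span_scale)
  qed
  have "{lprod Z | Z. Z \<subseteq># mset Y \<and> span (set_mset (mset Y - Z)) = UNIV} \<subseteq>
      {lprod Z * \<Prod>\<^sub># R | Z R. Z \<subseteq># mset Y \<and> (span (set_mset (mset Y - Z)) = UNIV \<longleftrightarrow> True) \<and>
        set_mset R \<subseteq> forms \<and> (False \<or> R = {#})}" by fastforce
  then have "F q \<in> polar_fracts forms"
    using q cpoly.span_mono unfolding P_space_eq by (intro fracts) blast
  moreover have "F q \<in> degenerate_fracts forms"
    using q unfolding J_space_def by (intro fracts) simp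
  moreover have "polar_fracts forms \<inter> degenerate_fracts forms \<subseteq> {0}"
    unfolding forms_def by (intro polar_degenerate_disjoint) (auto intro: cpoly.span_base)
  ultimately have "F q = 0" by blast
  then show "q \<in> {0}" using nz[of M] by (simp add: F_def)
qed

text \<open>As long as \<open>M - Z\<close> spans, a factor of \<open>R\<close> is a combination of
  the forms of \<open>M - Z\<close>, and each term moves one vector into \<open>Z\<close>. Both
  sizes drop by one, so \<open>R\<close> outlasts \<open>M - Z\<close>: in the end the complement no
  longer spans or the combination is empty. For \<open>Z = {#}\<close> all monomials of degree above
  \<open>size M\<close> fall into the ideal.\<close>

lemma J_space_high_degree:
  assumes "Z \<subseteq># M" "set_mset R \<subseteq> forms" "size (M - Z) < size R"
  shows "lprod Z * \<Prod>\<^sub># R \<in> J_space M"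
  using assms
proof (induction "size (M - Z)" arbitrary: Z R rule: less_induct)
  case less
  show ?case
  proof (cases "span (set_mset (M - Z)) = UNIV")
    case False
    then show ?thesis unfolding J_space_def using less.prems by (intro cpoly.span_base) blast
  next
    case True
    from less.prems(3) have "R \<noteq> {#}" by auto
    then obtain r R' where R: "R = add_mset r R'" by (metis multiset_cases)
    then have "r \<in> cpoly.span (lf ` set_mset (M - Z))"
      using less.prems(2) True by (simp add: span_lf_iff[THEN iffD2])
    then have "lprod Z * (r * \<Prod>\<^sub># R') \<in> J_space M"
    proof (induction rule: cpoly.span_induct_alt)
      case base
      then show ?case by (simp add: J_space_def cpoly.span_zero)
    next
      case (step c b y)
      then obtain x where x: "b = lf x" "x \<in># M - Z" by blast
      have "size (M - add_mset x Z) < size (M - Z)"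
        using x(2) size_Diff1_less[of x "M - Z"] by simp
      moreover have "add_mset x Z \<subseteq># M"
        using less.prems(1) x(2) by (rule add_mset_subseteqI)
      ultimately have "lprod (add_mset x Z) * \<Prod>\<^sub># R' \<in> J_space M"
        using less.prems R by (intro less.hyps) auto
      then have "cscale c (lprod (add_mset x Z) * \<Prod>\<^sub># R') + lprod Z * (y * \<Prod>\<^sub># R') \<in> J_space M"
        using step(2) unfolding J_space_def by (intro cpoly.span_add cpoly.span_scale)
      then show ?case by (simp add: x(1) algebra_simps)
    qed
    then show ?thesis by (simp add: R)
  qed
qed

text \<open>On S + J the functional is \<open>L\<close> of the S-component, which is unique because
  \<open>S \<inter> J\<close> is trivial; a basis of S + J carries it to the whole space.\<close>

lemma extend_functional:
  assumes "linear_on S cscale (*) L" "cpoly.subspace S" "cpoly.subspace J" "S \<inter> J \<subseteq> {0}"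
  shows "\<exists>G. (\<forall>p q. G (p + q) = G p + G q) \<and> (\<forall>c p. G (cscale c p) = c * G p) \<and>
    (\<forall>p\<in>S. G p = L p) \<and> (\<forall>p\<in>J. G p = (0::complex))"
proof -
  interpret pair: vector_space_pair cscale cscale ..
  obtain C where C: "C \<subseteq> J" "cpoly.independent C" "J \<subseteq> cpoly.span C"
    by (rule cpoly.maximal_independent_subset)
  have spanC: "cpoly.span C = J"
    using C assms(3) by (metis cpoly.span_minimal subset_antisym)
  obtain B where B: "C \<subseteq> B" "B \<subseteq> cpoly.span (S \<union> J)" "cpoly.independent B" "cpoly.span (S \<union> J) \<subseteq> cpoly.span B"
  proof (rule cpoly.maximal_independent_subset_extend[OF _ C(2)])
    show "C \<subseteq> cpoly.span (S \<union> J)" using C(1) cpoly.span_superset[of "S \<union> J"] by blast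
  qed
  have dec: "\<exists>s\<in>S. \<exists>j\<in>J. p = s + j" if "p \<in> cpoly.span (S \<union> J)" for p
  proof -
    have "cpoly.span S = S" "cpoly.span J = J" using assms(2,3) by (simp_all only: cpoly.span_eq_iff)
    with that show ?thesis unfolding cpoly.span_Un by auto
  qed
  define h where "h p = (SOME s. s \<in> S \<and> p - s \<in> J)" for p
  have h: "h p \<in> S \<and> p - h p \<in> J" if p: "p \<in> cpoly.span (S \<union> J)" for p
  proof -
    obtain s j where "s \<in> S" "j \<in> J" "p = s + j" using dec[OF p] by blast
    then have "s \<in> S \<and> p - s \<in> J" by simp
    then show ?thesis unfolding h_def by (rule someI)
  qed
  have h_unique: "h p = s" if "s \<in> S" "p - s \<in> J" "p \<in> cpoly.span (S \<union> J)" for p s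
  proof -
    have "(p - s) - (p - h p) \<in> J"
      by (rule cpoly.subspace_diff[OF assms(3)]) (use that h[OF that(3)] in blast)+
    moreover have "h p - s \<in> S"
      by (rule cpoly.subspace_diff[OF assms(2)]) (use that h[OF that(3)] in blast)+
    ultimately have "h p - s \<in> S \<inter> J" by simp
    then have "h p - s \<in> {0}" using assms(4) by blast
    then show ?thesis by simp
  qed
  \<comment> \<open>The values are wrapped as constant polynomials, so that \<open>K\<close> maps
    \<open>cpoly\<close> to itself; \<open>G\<close> unwraps them by reading the constant
    coefficient.\<close>
  define K where "K = pair.construct B (\<lambda>b. cconst (L (h b)))"
  interpret K: Vector_Spaces.linear cscale cscale K
    unfolding K_def by (rule pair.linear_construct[OF B(3)])
  define G where "G p = lookup (K p) 0" for p
  have G_add: "G (p + q) = G p + G q" and G_scale: "G (cscale c p) = c * G p" for p q c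
    by (simp_all add: G_def K.add K.scale lookup_add)
  have G0: "G 0 = 0" using G_add[of 0 0] by simp
  have L0: "L 0 = 0"
  proof -
    have "L (cscale 0 0) = 0 * L 0"
      using assms(1,2) cpoly.subspace_0 unfolding linear_on_def by blast
    then show ?thesis by simp
  qed
  have Gh: "p \<in> cpoly.span (S \<union> J) \<and> G p = L (h p)" if "p \<in> cpoly.span B" for p
    using that
  proof (induction rule: cpoly.span_induct_alt)
    case base
    have "h 0 = 0" using assms(2,3) by (intro h_unique) (auto simp: cpoly.subspace_0 cpoly.span_zero)
    then show ?case by (simp add: G0 L0 cpoly.span_zero)
  next
    case (step c b y)
    have b: "b \<in> cpoly.span (S \<union> J)" using step(1) B(2) by blast
    have y: "y \<in> cpoly.span (S \<union> J)" using step(2) by blast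
    have "G b = L (h b)"
      unfolding G_def K_def pair.construct_basis[OF B(3) step(1)] by (simp add: cconst_def)
    then have "G (cscale c b + y) = c * L (h b) + L (h y)"
      using step(2) by (simp add: G_add G_scale)
    also have "\<dots> = L (cscale c (h b) + h y)"
      using assms(1) h[OF b] h[OF y] cpoly.subspace_scale[OF assms(2), of "h b" c]
      unfolding linear_on_def by simp
    also have "cscale c (h b) + h y = h (cscale c b + y)"
    proof (rule h_unique[symmetric])
      show "cscale c (h b) + h y \<in> S"
        using h[OF b] h[OF y] cpoly.subspace_add[OF assms(2) cpoly.subspace_scale[OF assms(2)]] by blast
      have "cscale c (b - h b) + (y - h y) \<in> J"
        using h[OF b] h[OF y] cpoly.subspace_add[OF assms(3) cpoly.subspace_scale[OF assms(3)]] by blast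
      then show "cscale c b + y - (cscale c (h b) + h y) \<in> J"
        by (simp add: cpoly.scale_right_diff_distrib algebra_simps)
    qed (use b y in \<open>simp add: cpoly.span_add cpoly.span_scale\<close>)
    finally show ?case using b y by (simp add: cpoly.span_add cpoly.span_scale)
  qed
  show ?thesis
  proof (intro exI[of _ G] conjI allI ballI)
    show "G p = L p" if "p \<in> S" for p
    proof -
      have p: "p \<in> cpoly.span (S \<union> J)" using that by (simp add: cpoly.span_base)
      then have "h p = p" using that assms(3) by (intro h_unique) (auto simp: cpoly.subspace_0)
      then show ?thesis using Gh[of p] p B(4) by auto
    qed
    show "G p = 0" if "p \<in> J" for p
    proof -
      have p: "p \<in> cpoly.span (S \<union> J)" using that by (simp add: cpoly.span_base)
      then have "h p = 0" using that assms(2) by (intro h_unique) (auto simp: cpoly.subspace_0)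
      then show ?thesis using Gh[of p] p B(4) L0 by auto
    qed
  qed (simp_all add: G_add G_scale)
qed

theorem D_space_represents:
  assumes L: "linear_on (P_space bs Y) cscale (*) L"
  shows "\<exists>f\<in>D_space bs Y. \<forall>q\<in>P_space bs Y. std_pairing q f = L q"
proof -
  let ?M = "mset Y"
  have sub: "cpoly.subspace (P_space bs Y)" "cpoly.subspace (J_space ?M)"
    by (simp_all add: P_space_def J_space_def)
  obtain G where G': "(\<forall>p q. G (p + q) = G p + G q) \<and> (\<forall>c p. G (cscale c p) = c * G p) \<and>
    (\<forall>p\<in>P_space bs Y. G p = L p) \<and> (\<forall>p\<in>J_space ?M. G p = 0)"
    using extend_functional[OF L sub P_space_Int_J_space] ..
  then have G: "G (p + q) = G p + G q" "G (cscale c p) = c * G p"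
    "p \<in> P_space bs Y \<Longrightarrow> G p = L p" "p \<in> J_space ?M \<Longrightarrow> G p = 0" for p q c
    by simp_all
  \<comment> \<open>The bound is \<open>size ?M\<close> because \<open>G\<close> vanishes on every
    monomial of larger degree by \<open>J_space_high_degree\<close>; this finite set captures all
    coefficients.\<close>
  define S where "S = {m. keys m \<subseteq> {..<d} \<and> mdeg m \<le> size ?M}"
  have finS: "finite S" unfolding S_def by (rule finite_bounded_monomials)
  \<comment> \<open>Division by \<open>mfact m\<close> makes the rescaled coefficient at
    \<open>m\<close>, which is the pairing of that monomial with \<open>f\<close>, equal to the
    value of \<open>G\<close>.\<close>
  define f :: cpoly where "f = (\<Sum>m\<in>S. single m (G (single m 1) / mfact m))"
  have mono_forms: "\<exists>R. set_mset R \<subseteq> forms \<and> single m 1 = \<Prod>\<^sub># R \<and> size R = mdeg m"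
    if "keys m \<subseteq> {..<d}" for m
  proof -
    obtain R where R: "set_mset R \<subseteq> cvar ` keys m" "single m 1 = \<Prod>\<^sub># R" "size R = mdeg m"
      using monomial_eq_prod_mset[of m] by blast
    have "cvar ` keys m \<subseteq> forms"
      unfolding forms_def using that by (auto intro: cpoly.span_base)
    with R show ?thesis by blast
  qed
  have wf: "wcoef f m = (if keys m \<subseteq> {..<d} then G (single m 1) else 0)" for m
  proof -
    have "wcoef f m = (if m \<in> S then G (single m 1) else 0)"
      using finS by (simp add: wcoef_def f_def lookup_sum lookup_single when_def)
    moreover have "G (single m 1) = 0" if mk: "keys m \<subseteq> {..<d}" "m \<notin> S"
    proof -
      obtain R where "set_mset R \<subseteq> forms" "single m 1 = \<Prod>\<^sub># R" "size R = mdeg m"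
        using mono_forms[OF mk(1)] by blast
      then show ?thesis
        using J_space_high_degree[of "{#}" ?M R] mk G(4) by (simp add: S_def)
    qed
    ultimately show ?thesis by (auto simp: S_def)
  qed
  have fc: "f \<in> cpolys d" unfolding wcoef_cpolys by (simp add: wf)
  have G0: "G 0 = 0" using G(1)[of 0 0] by simp
  have pair: "std_pairing q f = G q" if "q \<in> cpolys d" for q
  proof -
    have "std_pairing (\<Sum>m\<in>A. single m (lookup q m)) f =
        G (\<Sum>m\<in>A. single m (lookup q m))"
      if "finite A" "\<And>m. m \<in> A \<Longrightarrow> keys m \<subseteq> {..<d}" for A
      using that
    proof (induction A)
      case empty
      then show ?case by (simp add: G0 std_pairing_wcoef)
    next
      case (insert m A)
      let ?c = "lookup q m"
      have eq: "single m ?c = cscale ?c (single m 1)"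
        by (simp add: cscale_def cconst_def mult_single)
      have "G (single m ?c) = ?c * G (single m 1)"
        unfolding eq by (rule G(2))
      with insert show ?case by (simp add: std_pairing_add_left G(1) wf)
    qed
    from this[of "keys q"] show ?thesis
      using that by (auto simp: poly_mapping_sum_singles cpolys_def)
  qed
  have "diff_op (lprod Z) f = 0" if Z: "Z \<subseteq># ?M" "span (set_mset (?M - Z)) \<noteq> UNIV" for Z
  proof (rule wcoef_eqI)
    fix m
    show "wcoef (diff_op (lprod Z) f) m = wcoef 0 m"
    proof (cases "keys m \<subseteq> {..<d}")
      case True
      obtain R where R: "set_mset R \<subseteq> forms" "single m 1 = \<Prod>\<^sub># R"
        using mono_forms[OF True] by blast
      \<comment> \<open>Each coefficient is a pairing with a multiple of \<open>lprod Z\<close>,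
        which lies in the ideal killed by \<open>G\<close>.\<close>
      have "wcoef (diff_op (lprod Z) f) m = std_pairing (single m 1 * lprod Z) f"
        by (simp add: std_pairing_mult)
      also have "\<dots> = G (single m 1 * lprod Z)"
        using True by (intro pair cpolys_mult cpolys_single lprod_cpolys)
      also have "single m 1 * lprod Z = lprod Z * \<Prod>\<^sub># R"
        unfolding R(2) by (rule mult.commute)
      also have "\<dots> \<in> J_space ?M" unfolding J_space_def using Z R(1) by (intro cpoly.span_base) blast
      then have "G (lprod Z * \<Prod>\<^sub># R) = 0" by (rule G(4))
      finally show ?thesis by simp
    next
      case False
      then show ?thesis using diff_op_cpolys[OF fc] unfolding wcoef_cpolys by auto
    qed
  qed
  then have "f \<in> D_space bs Y" using fc by (simp add: D_space_iff)
  then show ?thesis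
  proof (rule bexI[rotated], intro ballI)
    fix q assume q: "q \<in> P_space bs Y"
    then have "std_pairing q f = G q" using P_space_cpolys by (intro pair) blast
    then show "std_pairing q f = L q" using G(3)[OF q] by simp
  qed
qed

end

section \<open>Translations as differential operators\<close>

lemma partial_deriv_add: "partial_deriv i (f + g) = partial_deriv i f + partial_deriv i g"
  by (simp add: diff_op_add_right flip: diff_op_cvar)

lemma partial_deriv_0 [simp]: "partial_deriv i 0 = 0"
  by (simp flip: diff_op_cvar)

lemma partial_deriv_single:
  "partial_deriv i (single m c) =
    single (m - single i 1) (of_nat (lookup m i) * c)"
  by (cases "c = 0") (simp_all add: partial_deriv_def)

lemma diff_single_add:
  assumes "lookup m i \<noteq> 0"
  shows "m - single i (1::nat) + n = m + n - single i 1"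
  using assms
  by (intro poly_mapping_eqI) (auto simp: lookup_add lookup_minus lookup_single when_def)

lemma partial_deriv_mult: "partial_deriv i (f * g) = partial_deriv i f * g + f * partial_deriv i g"
proof (induction f rule: poly_mapping_single_induct)
  case (single m a)
  show ?case
  proof (induction g rule: poly_mapping_single_induct)
    case (single n b)
    let ?e = "single i (1::nat)" and ?a = "lookup m i" and ?b = "lookup n i"
    have 1: "single (m - ?e + n) (of_nat ?a * (a * b)) = single (m + n - ?e) (of_nat ?a * (a * b))"
      using diff_single_add[of m i n] by (cases "?a = 0") auto
    have 2: "single (m + (n - ?e)) (of_nat ?b * (a * b)) = single (m + n - ?e) (of_nat ?b * (a * b))"
      using diff_single_add[of n i m] by (cases "?b = 0") (auto simp: add.commute)
    have "partial_deriv i (single m a * single n b) =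
        single (m + n - ?e) (of_nat ?a * (a * b)) + single (m + n - ?e) (of_nat ?b * (a * b))"
      unfolding mult_single partial_deriv_single lookup_add of_nat_add distrib_right single_add ..
    also have "\<dots> = partial_deriv i (single m a) * single n b +
        single m a * partial_deriv i (single n b)"
      unfolding partial_deriv_single mult_single 1[symmetric] 2[symmetric] by (simp add: ac_simps)
    finally show ?case .
  qed (simp_all add: partial_deriv_add algebra_simps)
qed (simp_all add: partial_deriv_add algebra_simps)

text \<open>Apart from its constant term, \<open>g\<close> lowers degrees; so at a monomial of top
  degree in \<open>f\<close>, the coefficient of \<open>f\<close> is merely multiplied by the
  constant term of \<open>g\<close>.\<close>

lemma diff_op_eq_0_imp:
  assumes "diff_op g f = 0" "ceval g (\<lambda>_. 0) \<noteq> 0"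
  shows "f = 0"
proof (rule ccontr)
  assume "f \<noteq> 0"
  then have ne: "keys f \<noteq> {}" by simp
  then have "Max (mdeg ` keys f) \<in> mdeg ` keys f" by (intro Max_in) auto
  then obtain n where n: "n \<in> keys f" "mdeg n = Max (mdeg ` keys f)" by auto
  have n_max: "mdeg m \<le> mdeg n" if "m \<in> keys f" for m
    unfolding n(2) using that by (intro Max_ge) auto
  have deg0: "mdeg m = 0 \<longleftrightarrow> m = 0" for m
    by (auto simp: mdeg_def in_keys_iff intro: poly_mapping_eqI)
  have "wcoef (diff_op g f) n = (\<Sum>m\<in>insert 0 (keys g). lookup g m * wcoef f (n + m))"
    by (rule wcoef_diff_op_superset) auto
  also have "\<dots> = (\<Sum>m\<in>insert 0 (keys g). if m = 0 then lookup g 0 * wcoef f n else 0)"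
  proof (intro sum.cong refl)
    fix m
    have "n + m \<notin> keys f" if "m \<noteq> 0"
      using n_max[of "n + m"] that deg0[of m] by (auto simp: mdeg_add)
    then show "lookup g m * wcoef f (n + m) = (if m = 0 then lookup g 0 * wcoef f n else 0)"
      by (auto simp: wcoef_def in_keys_iff)
  qed
  also have "\<dots> = lookup g 0 * wcoef f n" by simp
  also have "lookup g 0 = ceval g (\<lambda>_. 0)" by (simp add: ceval_zero wcoef_def)
  finally show False using assms n(1) by (simp add: wcoef_def in_keys_iff)
qed

text \<open>The strict bound makes \<open>deg_less 0\<close> the zero space, the base case for the
  nilpotency of directional derivatives.\<close>

definition deg_less :: "nat \<Rightarrow> cpoly set"
  where "deg_less k = {f. \<forall>m. wcoef f m \<noteq> 0 \<longrightarrow> mdeg m < k}"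

lemma deg_less_0: "f \<in> deg_less 0 \<longleftrightarrow> f = 0"
  by (auto simp: deg_less_def intro: wcoef_eqI)

lemma deg_less_mono: "k \<le> l \<Longrightarrow> deg_less k \<subseteq> deg_less l"
  unfolding deg_less_def by (auto intro: order_less_le_trans)

lemma ex_deg_less: "\<exists>k. f \<in> deg_less k"
proof -
  have "mdeg m < Suc (Max (mdeg ` keys f))" if "wcoef f m \<noteq> 0" for m
    using that by (intro le_imp_less_Suc Max_ge) (auto simp: wcoef_def in_keys_iff)
  then show ?thesis unfolding deg_less_def by blast
qed

lemma diff_op_deg_less:
  assumes "f \<in> deg_less k"
  shows "diff_op q f \<in> deg_less k"
  unfolding deg_less_def
proof (intro CollectI allI impI)
  fix m assume "wcoef (diff_op q f) m \<noteq> 0"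
  then obtain n where "wcoef f (m + n) \<noteq> 0"
    unfolding wcoef_diff_op by (metis (no_types, lifting) mult_eq_0_iff sum.neutral)
  then show "mdeg m < k" using assms unfolding deg_less_def by (force simp: mdeg_add)
qed

lemma partial_deriv_deg_less:
  assumes "f \<in> deg_less (Suc k)"
  shows "partial_deriv i f \<in> deg_less k"
  unfolding deg_less_def
proof (intro CollectI allI impI)
  fix m assume "wcoef (partial_deriv i f) m \<noteq> 0"
  then have "mdeg (m + single i 1) < Suc k"
    using assms unfolding deg_less_def wcoef_partial_deriv by blast
  then show "mdeg m < k" by (simp add: mdeg_add mdeg_def[of "single _ _"])
qed

lemma deg_less_subspace: "cpoly.subspace (deg_less k)"
proof (rule cpoly.subspaceI)
  fix f g assume "f \<in> deg_less k" "g \<in> deg_less k"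
  then show "f + g \<in> deg_less k"
    unfolding deg_less_def by (auto simp: wcoef_add) (metis add.right_neutral)
qed (auto simp: deg_less_def wcoef_cscale)

section \<open>The action of the group algebra on functions\<close>

lemma translate_action_superset:
  assumes "finite S" "keys q \<subseteq> S"
  shows "translate_action q f x = (\<Sum>u\<in>S. lookup q u * f (x - u))"
  unfolding translate_action_def using assms by (intro sum.mono_neutral_left) (auto simp: in_keys_iff)

lemma translate_action_0 [simp]: "translate_action 0 f = 0"
  by (simp add: translate_action_def fun_eq_iff)

lemma translate_action_single [simp]: "translate_action (single u c) f = (\<lambda>x. c * f (x - u))"
  by (cases "c = 0") (simp_all add: translate_action_def)

lemma translate_action_add: "translate_action (p + q) f = translate_action p f + translate_action q f"
proof
  fix x
  let ?S = "keys p \<union> keys q"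
  have "translate_action (p + q) f x = (\<Sum>u\<in>?S. lookup (p + q) u * f (x - u))"
    using Poly_Mapping.keys_add[of p q] by (intro translate_action_superset) auto
  then show "translate_action (p + q) f x = (translate_action p f + translate_action q f) x"
    by (simp add: translate_action_superset[of ?S p] translate_action_superset[of ?S q] lookup_add sum.distrib algebra_simps)
qed

lemma translate_action_add_right: "translate_action p (\<lambda>x. f x + g x) = (\<lambda>x. translate_action p f x + translate_action p g x)"
  by (simp add: translate_action_def sum.distrib algebra_simps)

lemma translate_action_mult: "translate_action (p * q) f = translate_action p (translate_action q f)"
proof (induction p rule: poly_mapping_single_induct)
  case (single u a)
  show ?case
  proof (induction q rule: poly_mapping_single_induct)
    case zero
    then show ?case by (simp add: fun_eq_iff)
  next
    case (single v b)
    then show ?case by (simp add: mult_single fun_eq_iff diff_diff_eq add.commute)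
  next
    case (add q r)
    then show ?case by (simp add: distrib_left translate_action_add fun_eq_iff algebra_simps)
  qed
next
  case zero
  then show ?case by simp
qed (simp_all add: distrib_right translate_action_add)

lemma translate_action_1 [simp]: "translate_action 1 f = f"
  using translate_action_single[of 0 1 f] by simp

lemma translate_action_diff_single:
  "translate_action (bdiff u) f x = f x - f (x - u)"
proof -
  have "bdiff u = 1 + single u (- 1)"
    by (simp add: single_uminus)
  then show ?thesis
    by (simp only: translate_action_add translate_action_1 translate_action_single) simp
qed

lemma translate_action_sum_left: "translate_action (sum g A) f = (\<lambda>x. \<Sum>a\<in>A. translate_action (g a) f x)"
  by (induction A rule: infinite_finite_induct) (auto simp: translate_action_add fun_eq_iff)

lemma translate_action_sum_right:
  "translate_action p (\<lambda>x. \<Sum>a\<in>A. g a x) = (\<lambda>x. \<Sum>a\<in>A. translate_action p (g a) x)"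
  by (induction A rule: infinite_finite_induct) (auto simp: translate_action_add_right translate_action_def)

context coordinates
begin

text \<open>The restriction of \<open>f\<close> to the line t \<mapsto> v - t u, with the sign of
  the translation action. Taylor's formula for the shift by \<open>u\<close> then relates the
  coefficients of a univariate polynomial to its value at t = 1.\<close>

definition line :: "'a \<Rightarrow> (nat \<Rightarrow> complex) \<Rightarrow> cpoly \<Rightarrow> complex poly"
  where "line u v = ins (\<lambda>c. [:c:]) (\<lambda>i. [:v i, if i < d then - of_real (co u i) else 0:])"

sublocale line: insertion "\<lambda>c. [:c:]" "\<lambda>i. [:v i, if i < d then - of_real (co u i) else 0:]" for u v
  by unfold_locales (simp_all add: one_pCons)

lemma poly_line: "poly (line u v f) t = ceval f (\<lambda>i. v i - (if i < d then t * of_real (co u i) else 0))"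
  by (induction f rule: cpoly_generators_induct)
    (auto simp: line_def line.ins_add line.ins_mult ceval_eq_ins ceval.ins_add ceval.ins_mult)

lemma diff_op_lf: "diff_op (lf u) f = (\<Sum>i<d. cscale (of_real (co u i)) (partial_deriv i f))"
  by (simp add: lin_form_def diff_op_sum_left diff_op_cscale_left diff_op_cvar)

lemma diff_op_lf_mult: "diff_op (lf u) (f * g) = diff_op (lf u) f * g + f * diff_op (lf u) g"
  by (simp add: diff_op_lf partial_deriv_mult cpoly.scale_right_distrib sum.distrib sum_distrib_left sum_distrib_right)

text \<open>The chain rule; both sides obey the product rule, so constants and variables
  suffice.\<close>

lemma pderiv_line: "pderiv (line u v f) = - line u v (diff_op (lf u) f)"
proof (induction f rule: cpoly_generators_induct)
  case (const c)
  have "partial_deriv i (cconst c) = 0" for i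
    by (simp add: cconst_def partial_deriv_single)
  then show ?case by (simp add: diff_op_lf line_def pderiv_pCons)
next
  case (var j)
  have "partial_deriv i (cvar j) = (if i = j then 1 else 0)" for i
    by (simp add: cvar_def partial_deriv_single lookup_single when_def)
  then have "diff_op (lf u) (cvar j) = (\<Sum>i<d. if i = j then cconst (of_real (co u j)) else 0)"
    unfolding diff_op_lf by (intro sum.cong) (auto simp: cscale_def)
  then have "diff_op (lf u) (cvar j) = (if j < d then cconst (of_real (co u j)) else 0)" by simp
  then show ?case by (simp add: line_def pderiv_pCons)
next
  case (add f g)
  then show ?case by (simp add: line_def line.ins_add diff_op_add_right pderiv_add)
next
  case (mult f g)
  then show ?case
    by (simp add: line_def line.ins_add line.ins_mult diff_op_lf_mult pderiv_mult algebra_simps)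
qed

lemma higher_pderiv_line: "(pderiv ^^ k) (line u v f) = line u v (diff_op (cconst ((- 1) ^ k) * lf u ^ k) f)"
proof (induction k)
  case (Suc k)
  have "(pderiv ^^ Suc k) (line u v f) = - line u v (diff_op (lf u * (cconst ((- 1) ^ k) * lf u ^ k)) f)"
    by (simp add: Suc pderiv_line diff_op_mult)
  also have "\<dots> = line u v (- (diff_op (lf u * (cconst ((- 1) ^ k) * lf u ^ k)) f))"
    by (simp add: line_def line.ins_uminus)
  also have "- (diff_op (lf u * (cconst ((- 1) ^ k) * lf u ^ k)) f) =
      diff_op (cconst (- 1) * (lf u * (cconst ((- 1) ^ k) * lf u ^ k))) f"
    by (simp only: diff_op_mult[of "cconst (- 1)"] diff_op_cconst) simp
  also have "cconst (- 1) * (lf u * (cconst ((- 1) ^ k) * lf u ^ k)) = cconst ((- 1) ^ Suc k) * lf u ^ Suc k"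
    unfolding power_Suc cconst_mult by (simp only: ac_simps)
  finally show ?case .
qed simp

lemma diff_op_lf_deg_less: "f \<in> deg_less (Suc k) \<Longrightarrow> diff_op (lf u) f \<in> deg_less k"
  unfolding diff_op_lf
  by (intro cpoly.subspace_sum cpoly.subspace_scale deg_less_subspace partial_deriv_deg_less)

lemma diff_op_lf_pow_eq_0: "f \<in> deg_less k \<Longrightarrow> diff_op (lf u ^ k) f = 0"
proof (induction k arbitrary: f)
  case (Suc k)
  have "diff_op (lf u ^ Suc k) f = diff_op (lf u ^ k) (diff_op (lf u) f)"
    by (simp only: power_Suc2 diff_op_mult)
  then show ?case using Suc diff_op_lf_deg_less by simp
qed (simp add: deg_less_0)

text \<open>On polynomials of degree less than \<open>k\<close>, translation by \<open>u\<close> is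
  \<open>exp (- D\<^sub>u) = 1 - D\<^sub>u \<circ> ((1 - exp (- D\<^sub>u)) / D\<^sub>u)\<close>, with the second factor truncated.\<close>

definition texp :: "nat \<Rightarrow> 'a \<Rightarrow> cpoly"
  where "texp k u = (\<Sum>j<Suc k. cconst ((- 1) ^ j / fact (Suc j)) * lf u ^ j)"

definition shift :: "nat \<Rightarrow> 'a \<Rightarrow> cpoly"
  where "shift k u = 1 - lf u * texp k u"

text \<open>\<open>shift\<close> is defined in factored form, which exhibits \<open>lf u\<close> as
  a divisor of \<open>1 - shift k u\<close>; here it is identified with the Taylor polynomial of the
  exponential up to degree k + 1.\<close>

lemma shift_eq: "shift k u = (\<Sum>j<Suc (Suc k). cconst ((- 1) ^ j / fact j) * lf u ^ j)"
proof -
  have "lf u * texp k u = (\<Sum>j<Suc k. cconst ((- 1) ^ j / fact (Suc j)) * lf u ^ Suc j)"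
    unfolding texp_def sum_distrib_left by (intro sum.cong refl) (simp only: power_Suc ac_simps)
  also have "\<dots> = - (\<Sum>j<Suc k. cconst ((- 1) ^ Suc j / fact (Suc j)) * lf u ^ Suc j)"
  proof -
    have "cconst ((- 1) ^ Suc j / fact (Suc j)) = - cconst ((- 1) ^ j / fact (Suc j))" for j
      by (simp add: cconst_def single_uminus)
    then show ?thesis by (simp only: mult_minus_left sum_negf minus_minus)
  qed
  finally show ?thesis
    unfolding shift_def sum.lessThan_Suc_shift[of _ "Suc k"] by simp
qed

lemma ceval_shift:
  assumes "f \<in> deg_less k"
  shows "ceval (diff_op (shift k u) f) v = ceval f (\<lambda>i. v i - (if i < d then of_real (co u i) else 0))"
proof -
  let ?p = "line u v f" and ?g = "\<lambda>j. diff_op (cconst ((- 1) ^ j) * lf u ^ j) f"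
  have coeff: "coeff ?p j = ceval (?g j) v / fact j" for j
  proof -
    have "coeff ((pderiv ^^ j) ?p) 0 = fact j * coeff ?p j"
      by (simp add: coeff_higher_pderiv pochhammer_fact)
    moreover have "coeff ((pderiv ^^ j) ?p) 0 = ceval (?g j) v"
      unfolding higher_pderiv_line poly_0_coeff_0[symmetric] poly_line by (rule arg_cong2[of _ _ _ _ ceval]) auto
    ultimately show ?thesis by (simp add: field_simps)
  qed
  have zero: "coeff ?p j = 0" if "j \<ge> k" for j
  proof -
    have "diff_op (lf u ^ j) f = 0"
      using diff_op_lf_pow_eq_0 deg_less_mono[OF that] assms by blast
    then show ?thesis by (simp add: coeff diff_op_mult ceval_eq_ins)
  qed
  have "ceval f (\<lambda>i. v i - (if i < d then of_real (co u i) else 0)) = poly ?p 1"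
    unfolding poly_line by (simp cong: if_cong)
  also have "\<dots> = (\<Sum>j\<le>degree ?p. coeff ?p j)" by (simp add: poly_altdef)
  \<comment> \<open>Two ranges are reconciled through their union: coefficients above the degree
    vanish, and those of index at least \<open>k\<close> vanish because the corresponding
    derivatives of \<open>f\<close> do.\<close>
  also have "\<dots> = (\<Sum>j\<in>{..degree ?p} \<union> {..<Suc (Suc k)}. coeff ?p j)"
    by (intro sum.mono_neutral_left) (auto simp: coeff_eq_0)
  also have "\<dots> = (\<Sum>j<Suc (Suc k). coeff ?p j)"
    by (intro sum.mono_neutral_right) (auto simp: zero)
  also have "\<dots> = ceval (diff_op (shift k u) f) v"
  proof -
    have "cconst ((- 1) ^ j / fact j) * lf u ^ j = cscale (1 / fact j) (cconst ((- 1) ^ j) * lf u ^ j)" for j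
      by (simp add: cscale_def flip: cconst_mult mult.assoc)
    then show ?thesis
      unfolding shift_eq by (simp only: diff_op_sum_left diff_op_cscale_left ceval_eq_ins ceval.ins_sum
          ceval.ins_cscale coeff) simp
  qed
  finally show ?thesis ..
qed

lemma eval_at_eq: "eval_at bs f x = ceval f (\<lambda>i. of_real (co x i))"
  by (simp add: eval_at_def)

lemma ceval_cong:
  assumes "f \<in> cpolys n" "\<And>i. i < n \<Longrightarrow> v i = w i"
  shows "ceval f v = ceval f w"
  unfolding ceval_def using assms
  by (intro sum.cong refl arg_cong2[of _ _ _ _ "(*)"] prod.cong arg_cong2[of _ _ _ _ "(^)"]) (auto simp: cpolys_def)

lemma eval_at_shift:
  assumes "f \<in> deg_less k" "f \<in> cpolys d"
  shows "eval_at bs (diff_op (shift k u) f) x = eval_at bs f (x - u)"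
  unfolding eval_at_eq ceval_shift[OF assms(1)]
  by (rule ceval_cong[OF assms(2)]) (simp add: co_diff)

lemma ceval_lf_0: "ceval (lf u) (\<lambda>_. 0) = 0"
  by (simp add: lin_form_def ceval_eq_ins ceval.ins_sum)

lemma ceval_texp_0: "ceval (texp k u) (\<lambda>_. 0) = 1"
proof -
  have "ceval (texp k u) (\<lambda>_. 0) = (\<Sum>j<Suc k. if j = 0 then 1 else 0)"
    unfolding texp_def ceval_eq_ins ceval.ins_sum ceval.ins_mult ceval.ins_power ceval.ins_cconst
    using ceval_lf_0[of u, unfolded ceval_eq_ins] by (intro sum.cong) auto
  then show ?thesis by simp
qed

lemma ceval_shift_0: "ceval (shift k u) (\<lambda>_. 0) = 1"
  using ceval_lf_0[of u] by (simp add: shift_def ceval_eq_ins ceval.ins_diff ceval.ins_mult)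

end

section \<open>Exponential polynomials on a lattice\<close>

locale lattice = coordinates bs for bs :: "'a::real_vector list" +
  fixes \<Lambda> :: "'a set"
  assumes lattice_eq: "\<Lambda> = {\<Sum>b\<in>set bs. of_int (n b) *\<^sub>R b | n. True}"
begin

definition lat :: "(nat \<Rightarrow> int) \<Rightarrow> 'a"
  where "lat n = (\<Sum>i<d. of_int (n i) *\<^sub>R bs ! i)"

lemma co_sum: "co (sum g A) j = (\<Sum>a\<in>A. co (g a) j)"
  by (induction A rule: infinite_finite_induct) (simp_all add: co_add)

lemma co_lat: "j < d \<Longrightarrow> co (lat n) j = of_int (n j)"
  by (simp add: lat_def co_sum co_scale co_basis if_distrib sum.delta cong: if_cong)

lemma lat_in: "lat n \<in> \<Lambda>"
proof -
  have "lat n = (\<Sum>b\<in>set bs. of_int (n (the_inv_into {..<d} (nth bs) b)) *\<^sub>R b)"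
    using distinct_bs by (simp add: lat_def sum_set_bs the_inv_into_f_f inj_on_nth)
  then show ?thesis unfolding lattice_eq by (intro CollectI exI[of _ "\<lambda>b. n (the_inv_into {..<d} (nth bs) b)"]) simp
qed

lemma lattice_cases:
  assumes "x \<in> \<Lambda>"
  shows "x = lat (\<lambda>i. \<lfloor>co x i\<rfloor>)"
proof -
  obtain n where x: "x = (\<Sum>b\<in>set bs. of_int (n b) *\<^sub>R b)" using assms lattice_eq by blast
  then have "x = lat (\<lambda>i. n (bs ! i))" by (simp add: lat_def sum_set_bs)
  then show ?thesis by (metis (no_types, lifting) co_eqI co_lat floor_of_int)
qed

lemma co_lattice: "x \<in> \<Lambda> \<Longrightarrow> i < d \<Longrightarrow> co x i = of_int \<lfloor>co x i\<rfloor>"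
  using lattice_cases co_lat by metis

lemma lat_add: "lat m + lat n = lat (\<lambda>i. m i + n i)"
  by (simp add: lat_def scaleR_left_distrib sum.distrib)

lemma lat_diff: "lat m - lat n = lat (\<lambda>i. m i - n i)"
  by (simp add: lat_def scaleR_left_diff_distrib sum_subtractf)

lemma lattice_add: "x \<in> \<Lambda> \<Longrightarrow> y \<in> \<Lambda> \<Longrightarrow> x + y \<in> \<Lambda>"
  using lattice_cases lat_add lat_in by metis

lemma lattice_diff: "x \<in> \<Lambda> \<Longrightarrow> y \<in> \<Lambda> \<Longrightarrow> x - y \<in> \<Lambda>"
  using lattice_cases lat_diff lat_in by metis

lemma lattice_0: "0 \<in> \<Lambda>"
  using lat_in[of "\<lambda>_. 0"] by (simp add: lat_def)

lemma lattice_basis_in: "i < d \<Longrightarrow> bs ! i \<in> \<Lambda>"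
proof -
  assume i: "i < d"
  have "lat (\<lambda>j. if j = i then 1 else 0) = (\<Sum>j<d. if j = i then bs ! j else 0)"
    unfolding lat_def by (intro sum.cong) auto
  then show ?thesis using lat_in[of "\<lambda>j. if j = i then 1 else 0"] i by simp
qed

lemma lattice_diff_iff: "u \<in> \<Lambda> \<Longrightarrow> x - u \<in> \<Lambda> \<longleftrightarrow> x \<in> \<Lambda>"
  using lattice_add[of "x - u" u] lattice_diff[of x u] by auto

text \<open>\<open>k\<close> counts the coordinates already freed from the integers. Freeing one
  more amounts to a univariate polynomial that has all integers as roots and is therefore
  zero.\<close>

lemma ceval_eq_0_extend:
  assumes f: "f \<in> cpolys d" and zero: "\<And>x. x \<in> \<Lambda> \<Longrightarrow> eval_at bs f x = 0"
    and "k \<le> d" "\<And>i. k \<le> i \<Longrightarrow> i < d \<Longrightarrow> v i \<in> \<int>"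
  shows "ceval f v = 0"
  using assms(3,4)
proof (induction k arbitrary: v)
  case 0
  then have "\<forall>i. \<exists>n. i < d \<longrightarrow> v i = of_int n" by (metis Ints_cases le0)
  then obtain n where n: "\<And>i. i < d \<Longrightarrow> v i = of_int (n i)" by metis
  have "ceval f v = eval_at bs f (lat n)"
    unfolding eval_at_eq by (rule ceval_cong[OF f]) (simp add: n co_lat)
  then show ?case using zero lat_in by simp
next
  case (Suc k)
  let ?w = "\<lambda>i. if i = k then [:0, 1:] else [:v i:]"
  interpret w: insertion "\<lambda>c. [:c:]" ?w
    by unfold_locales (simp_all add: one_pCons)
  let ?p = "ins (\<lambda>c. [:c:]) ?w f"
  have p: "poly ?p t = ceval f (v(k := t))" for t
    by (induction f rule: cpoly_generators_induct)
      (auto simp: w.ins_add w.ins_mult ceval_eq_ins ceval.ins_add ceval.ins_mult)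
  have "\<int> \<subseteq> {t. poly ?p t = 0}"
  proof
    fix t :: complex assume "t \<in> \<int>"
    then have "ceval f (v(k := t)) = 0"
      using Suc.prems by (intro Suc.IH) auto
    then show "t \<in> {t. poly ?p t = 0}" by (simp add: p)
  qed
  moreover have "infinite (\<int> :: complex set)"
  proof
    assume "finite (\<int> :: complex set)"
    then have "finite (range (of_int :: int \<Rightarrow> complex))" by (simp only: Ints_def)
    then have "finite (UNIV :: int set)" by (rule finite_imageD) (simp add: inj_on_def)
    then show False by simp
  qed
  ultimately have "infinite {t. poly ?p t = 0}" using finite_subset by blast
  then have "?p = 0" using poly_roots_finite by blast
  then show ?case using p[of "v k"] by simp
qed

text \<open>Vanishing on the lattice extends to all complex points, hence to all iterated partial
  derivatives, whose values at the origin are the rescaled coefficients.\<close>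

lemma cpoly_eq_0_if_vanishing:
  assumes f: "f \<in> cpolys d" and zero: "\<And>x. x \<in> \<Lambda> \<Longrightarrow> eval_at bs f x = 0"
  shows "f = 0"
proof (rule wcoef_eqI)
  fix m
  have step: "\<forall>v. ceval (diff_op (cvar i) g) v = 0" if "i < d" "\<forall>v. ceval g v = 0" for i g
  proof
    fix v
    have "poly (line (bs ! i) v g) t = 0" for t using that(2) by (simp add: poly_line)
    then have "line (bs ! i) v g = 0" using poly_all_0_iff_0 by blast
    then have "poly (line (bs ! i) v (diff_op (cvar i) g)) 0 = 0"
      using pderiv_line[of "bs ! i" v g] lf_basis[OF that(1)] by simp
    moreover have "(\<lambda>j. v j - (if j < d then 0 * of_real (co (bs ! i) j) else 0)) = v" by auto
    ultimately show "ceval (diff_op (cvar i) g) v = 0" unfolding poly_line by simp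
  qed
  have all: "\<forall>v. ceval (diff_op (\<Prod>\<^sub># R) f) v = 0" if "set_mset R \<subseteq> cvar ` {..<d}" for R
    using that
  proof (induction R)
    case empty
    show ?case using ceval_eq_0_extend[OF f zero, of d] by simp
  next
    case (add y R)
    then obtain i where "y = cvar i" "i < d" by auto
    then show ?case using add step[of i] by (simp add: diff_op_mult)
  qed
  show "wcoef f m = wcoef 0 m"
  proof (cases "keys m \<subseteq> {..<d}")
    case True
    obtain R where "set_mset R \<subseteq> cvar ` keys m" "single m 1 = \<Prod>\<^sub># R"
      using monomial_eq_prod_mset by blast
    then have "ceval (diff_op (single m 1) f) (\<lambda>_. 0) = 0"
      using all[of R] True by (metis image_mono subset_trans)
    then show ?thesis by (simp add: ceval_zero)
  next
    case False
    then show ?thesis using f unfolding wcoef_cpolys by auto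
  qed
qed

section \<open>Characters and difference operators on exponential polynomials\<close>

lemma torus_0: "e \<in> torus \<Lambda> \<Longrightarrow> e 0 = 1"
proof -
  assume e: "e \<in> torus \<Lambda>"
  then have "e 0 = e 0 * e 0" "cmod (e 0) = 1"
    using lattice_0 unfolding torus_def by (metis (mono_tags, lifting) add_0 mem_Collect_eq)+
  then show ?thesis by auto
qed

lemma torus_outside: "e \<in> torus \<Lambda> \<Longrightarrow> x \<notin> \<Lambda> \<Longrightarrow> e x = 0"
  by (auto simp: torus_def lattice_funs_def)

lemma torus_add: "e \<in> torus \<Lambda> \<Longrightarrow> x \<in> \<Lambda> \<Longrightarrow> y \<in> \<Lambda> \<Longrightarrow> e (x + y) = e x * e y"
  by (auto simp: torus_def)

lemma torus_norm: "e \<in> torus \<Lambda> \<Longrightarrow> x \<in> \<Lambda> \<Longrightarrow> cmod (e x) = 1"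
  by (auto simp: torus_def)

lemma torus_cnj: "e \<in> torus \<Lambda> \<Longrightarrow> x \<in> \<Lambda> \<Longrightarrow> e x * cnj (e x) = 1"
  using torus_norm[of e x] by (simp flip: complex_norm_square)

lemma torus_cnj': "e \<in> torus \<Lambda> \<Longrightarrow> x \<in> \<Lambda> \<Longrightarrow> cnj (e x) * e x = 1"
  using torus_cnj[of e x] by (simp add: mult.commute)

lemma torus_diff:
  assumes "e \<in> torus \<Lambda>" "x \<in> \<Lambda>" "u \<in> \<Lambda>"
  shows "e (x - u) = e x * cnj (e u)"
proof -
  have "e x = e (x - u) * e u"
    using torus_add[OF assms(1) lattice_diff[OF assms(2,3)] assms(3)] by simp
  then have "e x * cnj (e u) = e (x - u) * (e u * cnj (e u))" by simp
  then show ?thesis using torus_cnj[OF assms(1,3)] by simp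
qed

text \<open>The operator by which \<open>f(x) - c f(x - u)\<close> acts on the polynomial part of \<open>e f\<close>.\<close>

definition twisted :: "complex \<Rightarrow> nat \<Rightarrow> 'a \<Rightarrow> cpoly"
  where "twisted c k u = 1 - cscale c (shift k u)"

lemma twisted_1: "twisted 1 k u = lf u * texp k u"
  by (simp add: twisted_def shift_def)

lemma ceval_twisted_0: "ceval (twisted c k u) (\<lambda>_. 0) = 1 - c"
  using ceval_shift_0[of k u] by (simp add: twisted_def ceval_eq_ins ceval.ins_diff)

lemma twisted_action:
  assumes "e \<in> torus \<Lambda>" "f \<in> deg_less k" "f \<in> cpolys d" "u \<in> \<Lambda>"
  shows "e x * eval_at bs f x - c * (e (x - u) * eval_at bs f (x - u)) =
    e x * eval_at bs (diff_op (twisted (c * cnj (e u)) k u) f) x"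
proof (cases "x \<in> \<Lambda>")
  case True
  have "diff_op (twisted (c * cnj (e u)) k u) f = f + cscale (- (c * cnj (e u))) (diff_op (shift k u) f)"
  proof -
    have "twisted (c * cnj (e u)) k u = 1 + cscale (- (c * cnj (e u))) (shift k u)"
      by (simp add: twisted_def)
    then show ?thesis by (simp only: diff_op_add_left diff_op_cscale_left diff_op_1)
  qed
  then have *: "eval_at bs (diff_op (twisted (c * cnj (e u)) k u) f) x =
      eval_at bs f x - c * cnj (e u) * eval_at bs f (x - u)"
    using eval_at_shift[OF assms(2,3), of u x] by (simp add: eval_at_eq ceval_eq_ins ceval.ins_diff)
  show ?thesis unfolding * torus_diff[OF assms(1) True assms(4)] by (simp add: algebra_simps)
next
  case False
  then show ?thesis using torus_outside[OF assms(1)] lattice_diff_iff[OF assms(4)] by simp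
qed

definition nab :: "'a multiset \<Rightarrow> 'a \<Rightarrow>\<^sub>0 complex"
  where "nab S = (\<Prod>u\<in>#S. bdiff u)"

lemma nabla_prod_eq: "nabla_prod C = nab (mset C)"
  by (simp add: nabla_prod_def nab_def flip: prod_mset_prod_list mset_map)

definition twisted_prod :: "('a \<Rightarrow> complex) \<Rightarrow> nat \<Rightarrow> 'a multiset \<Rightarrow> cpoly"
  where "twisted_prod e k S = (\<Prod>u\<in>#S. twisted (cnj (e u)) k u)"

lemma nab_action:
  assumes "e \<in> torus \<Lambda>" "f \<in> deg_less k" "f \<in> cpolys d" "set_mset S \<subseteq> \<Lambda>"
  shows "translate_action (nab S) (\<lambda>x. e x * eval_at bs f x) =
    (\<lambda>x. e x * eval_at bs (diff_op (twisted_prod e k S) f) x)"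
  using assms(2-4)
proof (induction S arbitrary: f)
  case empty
  then show ?case by (simp add: nab_def twisted_prod_def)
next
  case (add u S)
  let ?f = "diff_op (twisted (cnj (e u)) k u) f"
  have "translate_action (bdiff u) (\<lambda>x. e x * eval_at bs f x) = (\<lambda>x. e x * eval_at bs ?f x)"
    using twisted_action[OF assms(1) add.prems(1,2), of u _ 1] add.prems(3)
    by (simp add: translate_action_diff_single fun_eq_iff)
  moreover have "nab (add_mset u S) = nab S * bdiff u"
    "twisted_prod e k (add_mset u S) = twisted_prod e k S * twisted (cnj (e u)) k u"
    by (simp_all add: nab_def twisted_prod_def mult.commute)
  ultimately show ?case
    using add.IH[of ?f] add.prems by (simp add: translate_action_mult diff_op_mult diff_op_deg_less diff_op_cpolys)
qed

lemma diff_op_twisted_prod_eq_0_iff: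
  assumes "e \<in> torus \<Lambda>" "set_mset S \<subseteq> \<Lambda>"
  shows "diff_op (twisted_prod e k S) f = 0 \<longleftrightarrow> diff_op (lprod (filter_mset (\<lambda>u. e u = 1) S)) f = 0"
proof -
  have "\<exists>g. twisted_prod e k S = g * lprod (filter_mset (\<lambda>u. e u = 1) S) \<and> ceval g (\<lambda>_. 0) \<noteq> 0"
    using assms(2)
  proof (induction S)
    case empty
    show ?case by (intro exI[of _ 1]) (simp add: twisted_prod_def ceval_eq_ins)
  next
    case (add u S)
    then obtain g where g: "twisted_prod e k S = g * lprod (filter_mset (\<lambda>u. e u = 1) S)" "ceval g (\<lambda>_. 0) \<noteq> 0"
      by auto
    have tp: "twisted_prod e k (add_mset u S) = twisted (cnj (e u)) k u * twisted_prod e k S"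
      by (simp add: twisted_prod_def)
    show ?case
    proof (cases "e u = 1")
      case True
      then show ?thesis using g tp ceval_texp_0[of k u]
        by (intro exI[of _ "g * texp k u"]) (simp add: twisted_1 ceval_eq_ins ceval.ins_mult)
    next
      case False
      have "cnj (e u) \<noteq> 1" using False by (metis complex_cnj_cnj complex_cnj_one)
      then show ?thesis using g tp ceval_twisted_0[of "cnj (e u)" k u] False
        by (intro exI[of _ "g * twisted (cnj (e u)) k u"]) (simp add: ceval_eq_ins ceval.ins_mult)
    qed
  qed
  then obtain g where "twisted_prod e k S = g * lprod (filter_mset (\<lambda>u. e u = 1) S)" "ceval g (\<lambda>_. 0) \<noteq> 0" by blast
  then show ?thesis using diff_op_eq_0_imp[of g] by (auto simp: diff_op_mult)
qed

lemma exists_common_deg_less: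
  assumes "finite E"
  shows "\<exists>k. \<forall>e\<in>E. F e \<in> deg_less k"
  using assms
proof induction
  case (insert e E)
  then obtain k where k: "\<forall>e\<in>E. F e \<in> deg_less k" by blast
  obtain l where l: "F e \<in> deg_less l" using ex_deg_less by blast
  have "\<forall>e'\<in>insert e E. F e' \<in> deg_less (max k l)"
    using k l deg_less_mono[of k "max k l"] deg_less_mono[of l "max k l"] by auto
  then show ?case by blast
qed simp

text \<open>At a point \<open>v\<close> where \<open>e0\<close> and \<open>e1\<close> differ, the
  \<open>k\<close>-th power of the operator taking f(x) to f(x) - e1(v) f(x - v) annihilates the
  \<open>e1\<close> summand, whose polynomial has degree below \<open>k\<close>, and acts on the
  \<open>e0\<close> summand with nonzero constant term. The induction hypothesis applies to the
  characters that remain.\<close>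

theorem exponential_polynomials_independent:
  assumes "finite E" "E \<subseteq> torus \<Lambda>" "\<And>e. e \<in> E \<Longrightarrow> F e \<in> cpolys d"
    and "\<And>x. x \<in> \<Lambda> \<Longrightarrow> (\<Sum>e\<in>E. e x * eval_at bs (F e) x) = 0"
  shows "\<forall>e\<in>E. F e = 0"
  using assms
proof (induction E arbitrary: F rule: finite_induct)
  case (insert e1 E)
  obtain k where k: "\<And>e. e \<in> insert e1 E \<Longrightarrow> F e \<in> deg_less k"
    using exists_common_deg_less[of "insert e1 E" F] insert.hyps(1) by auto
  have E0: "F e0 = 0" if e0: "e0 \<in> E" for e0
  proof -
    have "e0 \<noteq> e1" using e0 insert.hyps(2) by auto
    then obtain v where "e0 v \<noteq> e1 v" by auto
    moreover from this have v: "v \<in> \<Lambda>"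
    proof (rule_tac ccontr)
      assume "v \<notin> \<Lambda>"
      then have "e0 v = 0" "e1 v = 0" using torus_outside insert.prems(1) e0 by auto
      then show False using \<open>e0 v \<noteq> e1 v\<close> by simp
    qed
    ultimately have ne: "e1 v * cnj (e0 v) \<noteq> 1"
    proof -
      assume "e0 v \<noteq> e1 v"
      moreover have "e1 v * (cnj (e0 v) * e0 v) = e1 v"
        using torus_cnj'[of e0 v] v e0 insert.prems(1) by auto
      ultimately show ?thesis by (metis mult.assoc mult_1)
    qed
    \<comment> \<open>The polynomial parts after \<open>n\<close> applications of that
      operator.\<close>
    define F' where "F' n e = diff_op (twisted (e1 v * cnj (e v)) k v ^ n) (F e)" for n e
    have F': "F' n e \<in> deg_less k" "F' n e \<in> cpolys d" if "e \<in> insert e1 E" for n e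
      using k[OF that] insert.prems(2)[OF that] by (simp_all add: F'_def diff_op_deg_less diff_op_cpolys)
    have sum0: "(\<Sum>e\<in>insert e1 E. e x * eval_at bs (F' n e) x) = 0" if "x \<in> \<Lambda>" for n x
      using that
    proof (induction n arbitrary: x)
      case 0
      then show ?case using insert.prems(3) by (simp add: F'_def)
    next
      case (Suc n)
      have "(\<Sum>e\<in>insert e1 E. e x * eval_at bs (F' (Suc n) e) x) =
          (\<Sum>e\<in>insert e1 E. e x * eval_at bs (F' n e) x - e1 v * (e (x - v) * eval_at bs (F' n e) (x - v)))"
      proof (rule sum.cong[OF refl])
        fix e assume e: "e \<in> insert e1 E"
        have "F' (Suc n) e = diff_op (twisted (e1 v * cnj (e v)) k v) (F' n e)"
          by (simp add: F'_def diff_op_mult)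
        then show "e x * eval_at bs (F' (Suc n) e) x =
            e x * eval_at bs (F' n e) x - e1 v * (e (x - v) * eval_at bs (F' n e) (x - v))"
          using twisted_action[of e "F' n e" k v x "e1 v"] insert.prems(1) e F'[OF e] v by auto
      qed
      also have "\<dots> = (\<Sum>e\<in>insert e1 E. e x * eval_at bs (F' n e) x) -
          e1 v * (\<Sum>e\<in>insert e1 E. e (x - v) * eval_at bs (F' n e) (x - v))"
        by (simp only: sum_subtractf sum_distrib_left)
      also have "\<dots> = 0"
        using Suc.IH[OF Suc.prems] Suc.IH[OF lattice_diff[OF Suc.prems v]] by simp
      finally show ?case .
    qed
    have "F' k e1 = 0"
    proof -
      have "twisted (e1 v * cnj (e1 v)) k v ^ k = texp k v ^ k * lf v ^ k"
        using torus_cnj[of e1 v] insert.prems(1) v by (simp add: twisted_1 power_mult_distrib mult.commute)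
      then show ?thesis using diff_op_lf_pow_eq_0[OF k[of e1], of v] by (simp add: F'_def diff_op_mult)
    qed
    then have "(\<Sum>e\<in>E. e x * eval_at bs (F' k e) x) = 0" if "x \<in> \<Lambda>" for x
      using sum0[OF that, of k] insert.hyps by (simp add: eval_at_eq ceval_eq_ins)
    then have "\<forall>e\<in>E. F' k e = 0"
      using insert.prems(1) F' by (intro insert.IH) auto
    then have "diff_op (twisted (e1 v * cnj (e0 v)) k v ^ k) (F e0) = 0"
      using e0 by (simp add: F'_def)
    then show ?thesis
    proof (rule diff_op_eq_0_imp)
      show "ceval (twisted (e1 v * cnj (e0 v)) k v ^ k) (\<lambda>_. 0) \<noteq> 0"
        using ne ceval_twisted_0[of "e1 v * cnj (e0 v)" k v] by (simp add: ceval_eq_ins ceval.ins_power)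
    qed
  qed
  have "F e1 = 0"
  proof (rule cpoly_eq_0_if_vanishing)
    fix x assume x: "x \<in> \<Lambda>"
    have "e1 x * eval_at bs (F e1) x = 0"
      using insert.prems(3)[OF x] insert.hyps E0 by (simp add: eval_at_eq ceval_eq_ins)
    moreover have "e1 x \<noteq> 0" using torus_norm[of e1 x] insert.prems(1) x by auto
    ultimately show "eval_at bs (F e1) x = 0" by simp
  qed (use insert.prems(2) in simp)
  then show ?case using E0 by blast
qed simp

end

section \<open>Periods and vertices\<close>

lemma int_combination_closed:
  fixes B :: "'a::real_vector set"
  assumes "P 0" "\<And>x y. P x \<Longrightarrow> P y \<Longrightarrow> P (x + y)" "\<And>x. P x \<Longrightarrow> P (- x)" "\<And>b. b \<in> B \<Longrightarrow> P b"
  shows "P (\<Sum>b\<in>B. of_int (n b) *\<^sub>R b)"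
proof -
  have nat: "P (of_nat m *\<^sub>R b)" if "P b" for m and b :: 'a
    by (induction m) (auto simp: assms(1) scaleR_left_distrib intro: assms(2) that)
  have int: "P (of_int k *\<^sub>R b)" if "P b" for k and b :: 'a
  proof (cases k rule: int_cases2)
    case (nonneg m)
    then show ?thesis using nat[OF that] by simp
  next
    case (nonpos m)
    then show ?thesis using assms(3)[OF nat[OF that, of m]] by simp
  qed
  show ?thesis
    using assms(4) by (induction B rule: infinite_finite_induct) (auto intro: assms(1,2) int)
qed

lemma common_multiple:
  assumes "finite A" "\<And>a. a \<in> A \<Longrightarrow> \<exists>n>0::nat. Q a n" "\<And>a m n. Q a n \<Longrightarrow> Q a (m * n)"
  shows "\<exists>n>0. \<forall>a\<in>A. Q a n"
  using assms(1,2)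
proof induction
  case (insert a A)
  then obtain n m where *: "n > 0" "\<forall>a\<in>A. Q a n" "m > 0" "Q a m" by blast
  then have "\<forall>a'\<in>insert a A. Q a' (m * n)"
    using assms(3)[of _ n m] assms(3)[of a m n] by (auto simp: mult.commute)
  then show ?case using * by (intro exI[of _ "m * n"]) auto
qed auto

context lattice
begin

text \<open>Over \<open>\<rat>\<close>, an independent set of \<open>d\<close> lattice vectors already spans the lattice basis.\<close>

lemma spanning_multiple:
  assumes T: "finite T" "T \<subseteq> \<Lambda>" "span T = UNIV" and j: "j < d"
  shows "\<exists>m>0::nat. \<exists>n. of_nat m *\<^sub>R (bs ! j) = (\<Sum>t\<in>T. of_int (n t) *\<^sub>R t)"
proof -
  \<comment> \<open>Restriction of scalars: real independence implies rational independence, and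
    every lattice vector lies in the rational span of \<open>bs\<close>.\<close>
  interpret Q: vector_space "\<lambda>r v. of_rat r *\<^sub>R (v::'a)"
    by unfold_locales (simp_all add: of_rat_add of_rat_mult scaleR_right_distrib scaleR_left_distrib)
  obtain B where B: "B \<subseteq> T" "independent B" "T \<subseteq> span B"
    by (rule maximal_independent_subset)
  have finB: "finite B" using B(1) T(1) by (rule finite_subset)
  have "span B = UNIV" using B(3) T(3) by (metis span_minimal subspace_span top.extremum_uniqueI)
  then have card: "d \<le> card B"
    using independent_span_bound[OF finB independent_bs] distinct_card[OF distinct_bs] by simp
  have QB: "Q.independent B"
    unfolding Q.dependent_explicit
  proof clarify
    fix t u v assume *: "finite t" "t \<subseteq> B" "(\<Sum>v\<in>t. of_rat (u v) *\<^sub>R v) = 0" "v \<in> t" "u v \<noteq> 0"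
    then have "dependent B"
      unfolding dependent_explicit by (intro exI[of _ t] exI[of _ "\<lambda>v. of_rat (u v)"]) auto
    then show False using B(2) by simp
  qed
  have Qspan: "B \<subseteq> Q.span (set bs)"
  proof
    fix b assume "b \<in> B"
    then obtain n where b: "b = (\<Sum>c\<in>set bs. of_int (n c) *\<^sub>R c)"
      using B(1) T(2) unfolding lattice_eq by blast
    have "(\<Sum>c\<in>set bs. of_rat (of_int (n c)) *\<^sub>R c) \<in> Q.span (set bs)"
      by (intro Q.span_sum Q.span_scale Q.span_base)
    then show "b \<in> Q.span (set bs)" by (simp add: b)
  qed
  have "bs ! j \<in> Q.span B"
  proof (rule ccontr)
    \<comment> \<open>Otherwise \<open>B\<close> together with \<open>bs ! j\<close> would give more
      than \<open>d\<close> rationally independent vectors in a rational space generated by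
      \<open>d\<close> vectors.\<close>
    assume nin: "bs ! j \<notin> Q.span B"
    then have ind: "Q.independent (insert (bs ! j) B)" using QB by (rule Q.independent_insertI)
    have "insert (bs ! j) B \<subseteq> Q.span (set bs)"
      using Qspan j by (auto intro: Q.span_base)
    then have "card (insert (bs ! j) B) \<le> card (set bs)"
      using Q.independent_span_bound[OF _ ind] by auto
    moreover have "bs ! j \<notin> B" using nin Q.span_base by blast
    ultimately show False using finB card distinct_card[OF distinct_bs] by simp
  qed
  then obtain r where r: "bs ! j = (\<Sum>b\<in>B. of_rat (r b) *\<^sub>R b)"
    unfolding Q.span_finite[OF finB] by blast
  have "\<exists>m>0::nat. \<forall>b\<in>B. \<exists>k::int. of_nat m * r b = of_int k"
  proof (rule common_multiple[OF finB])
    fix b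
    obtain p q where pq: "quotient_of (r b) = (p, q)" by (cases "quotient_of (r b)")
    then have "q > 0" by (rule quotient_of_denom_pos)
    moreover have "r b = of_int p / of_int q" using pq by (rule quotient_of_div)
    ultimately have "of_nat (nat q) * r b = of_int p" by simp
    then show "\<exists>m>0::nat. \<exists>k::int. of_nat m * r b = of_int k" using \<open>q > 0\<close>
      by (intro exI[of _ "nat q"]) auto
  next
    fix b and m n :: nat assume "\<exists>k::int. of_nat n * r b = of_int k"
    then obtain k :: int where k: "of_nat n * r b = of_int k" by blast
    have "of_nat (m * n) * r b = of_int (int m * k)" by (simp add: k mult.assoc)
    then show "\<exists>k::int. of_nat (m * n) * r b = of_int k" by blast
  qed
  then obtain m :: nat where m: "m > 0" "\<forall>b\<in>B. \<exists>k::int. of_nat m * r b = of_int k" by blast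
  then obtain k where k: "\<And>b. b \<in> B \<Longrightarrow> of_nat m * r b = of_int (k b)" by metis
  have "of_nat m *\<^sub>R (bs ! j) = (\<Sum>b\<in>B. of_rat (of_nat m * r b) *\<^sub>R b)"
    unfolding arg_cong[OF r, of "(*\<^sub>R) (of_nat m)"] scaleR_sum_right
    by (simp only: of_rat_mult of_rat_of_nat_eq scaleR_scaleR)
  also have "\<dots> = (\<Sum>b\<in>B. of_int (k b) *\<^sub>R b)"
    by (intro sum.cong refl) (simp only: k of_rat_of_int_eq)
  also have "\<dots> = (\<Sum>t\<in>T. of_int (if t \<in> B then k t else 0) *\<^sub>R t)"
    using T(1) B(1) by (intro sum.mono_neutral_cong_left) auto
  finally show ?thesis
    using m(1) by (intro exI[of _ m] conjI exI[of _ "\<lambda>t. if t \<in> B then k t else 0"])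
qed

text \<open>Spanning subsets and basis vectors are finite in number, so one multiple serves all of
  them. It bounds the orders of the values of vertices and is the period \<open>N\<close> of the
  Newton expansion.\<close>

lemma common_period:
  assumes X: "finite X" "X \<subseteq> \<Lambda>"
  shows "\<exists>m>0::nat. \<forall>T j. T \<subseteq> X \<longrightarrow> span T = UNIV \<longrightarrow> j < d \<longrightarrow>
    (\<exists>n. of_nat m *\<^sub>R (bs ! j) = (\<Sum>t\<in>T. of_int (n t) *\<^sub>R t))"
proof -
  let ?A = "{T. T \<subseteq> X \<and> span T = UNIV} \<times> {..<d}"
  have "\<exists>m>0::nat. \<forall>a\<in>?A. \<exists>n. of_nat m *\<^sub>R (bs ! snd a) = (\<Sum>t\<in>fst a. of_int (n t) *\<^sub>R t)"
  proof (rule common_multiple)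
    have "{T. T \<subseteq> X \<and> span T = UNIV} \<subseteq> Pow X" by blast
    then have "finite {T. T \<subseteq> X \<and> span T = UNIV}" using finite_Pow_iff[THEN iffD2, OF X(1)] by (rule finite_subset)
    then show "finite ?A" by (rule finite_cartesian_product) (rule finite_lessThan)
  next
    fix a assume "a \<in> ?A"
    then have "fst a \<subseteq> X" "span (fst a) = UNIV" "snd a < d" by auto
    then show "\<exists>m>0::nat. \<exists>n. of_nat m *\<^sub>R (bs ! snd a) = (\<Sum>t\<in>fst a. of_int (n t) *\<^sub>R t)"
      using X finite_subset[of "fst a" X] by (intro spanning_multiple) simp_all
  next
    fix a :: "'a set \<times> nat" and m n :: nat
    assume "\<exists>k. of_nat n *\<^sub>R (bs ! snd a) = (\<Sum>t\<in>fst a. of_int (k t) *\<^sub>R t)"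
    then obtain k where k: "of_nat n *\<^sub>R (bs ! snd a) = (\<Sum>t\<in>fst a. of_int (k t) *\<^sub>R t)" by blast
    have "of_nat (m * n) *\<^sub>R (bs ! snd a) = of_nat m *\<^sub>R (of_nat n *\<^sub>R (bs ! snd a))"
      by (simp only: of_nat_mult scaleR_scaleR)
    also have "\<dots> = (\<Sum>t\<in>fst a. of_int (int m * k t) *\<^sub>R t)"
      unfolding k scaleR_sum_right
      by (intro sum.cong refl) (simp only: of_int_mult of_int_of_nat_eq scaleR_scaleR)
    finally show "\<exists>k. of_nat (m * n) *\<^sub>R (bs ! snd a) = (\<Sum>t\<in>fst a. of_int (k t) *\<^sub>R t)"
      by (intro exI[of _ "\<lambda>t. int m * k t"])
  qed
  then obtain m :: nat where m: "m > 0 \<and>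
    (\<forall>a\<in>?A. \<exists>n. of_nat m *\<^sub>R (bs ! snd a) = (\<Sum>t\<in>fst a. of_int (n t) *\<^sub>R t))" ..
  have "\<exists>n. of_nat m *\<^sub>R (bs ! j) = (\<Sum>t\<in>T. of_int (n t) *\<^sub>R t)"
    if "T \<subseteq> X" "span T = UNIV" "j < d" for T j
    using m[THEN conjunct2, rule_format, of "(T, j)"] that by simp
  then show ?thesis using m[THEN conjunct1] by (intro exI[of _ m] conjI allI impI)
qed

lemma vertices_iff: "e \<in> vertices \<Lambda> X \<longleftrightarrow> e \<in> torus \<Lambda> \<and> span (set (fix_part e X)) = UNIV"
proof -
  have "(\<exists>B. B \<subseteq> set X \<and> independent B \<and> span B = UNIV \<and> (\<forall>b\<in>B. e b = 1)) \<longleftrightarrow> span (set (fix_part e X)) = UNIV"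
  proof
    assume "\<exists>B. B \<subseteq> set X \<and> independent B \<and> span B = UNIV \<and> (\<forall>b\<in>B. e b = 1)"
    then obtain B where "B \<subseteq> set (fix_part e X)" "span B = UNIV" by (auto simp: fix_part_def)
    then show "span (set (fix_part e X)) = UNIV" using span_mono by blast
  next
    assume *: "span (set (fix_part e X)) = UNIV"
    obtain B where B: "B \<subseteq> set (fix_part e X)" "independent B" "set (fix_part e X) \<subseteq> span B"
      by (rule maximal_independent_subset)
    then have "span B = UNIV" using * by (metis span_minimal subspace_span top.extremum_uniqueI)
    then show "\<exists>B. B \<subseteq> set X \<and> independent B \<and> span B = UNIV \<and> (\<forall>b\<in>B. e b = 1)"
      using B by (intro exI[of _ B]) (auto simp: fix_part_def)
  qed
  then show ?thesis unfolding vertices_def by blast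
qed

lemma torus_eqI:
  assumes "e \<in> torus \<Lambda>" "e' \<in> torus \<Lambda>" "\<And>j. j < d \<Longrightarrow> e (bs ! j) = e' (bs ! j)"
  shows "e = e'"
proof
  fix x
  show "e x = e' x"
  proof (cases "x \<in> \<Lambda>")
    case True
    then obtain n where x: "x = (\<Sum>b\<in>set bs. of_int (n b) *\<^sub>R b)" using lattice_eq by blast
    have "(\<lambda>v. v \<in> \<Lambda> \<and> e v = e' v) (\<Sum>b\<in>set bs. of_int (n b) *\<^sub>R b)"
    proof (rule int_combination_closed)
      show "0 \<in> \<Lambda> \<and> e 0 = e' 0"
        using lattice_0 torus_0[OF assms(1)] torus_0[OF assms(2)] by simp
      show "x + y \<in> \<Lambda> \<and> e (x + y) = e' (x + y)" if "x \<in> \<Lambda> \<and> e x = e' x" "y \<in> \<Lambda> \<and> e y = e' y" for x y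
        using that assms by (simp add: lattice_add torus_add)
      show "- x \<in> \<Lambda> \<and> e (- x) = e' (- x)" if "x \<in> \<Lambda> \<and> e x = e' x" for x
        using that lattice_diff[OF lattice_0, of x] torus_0[OF assms(1)] torus_0[OF assms(2)]
          torus_diff[OF assms(1) lattice_0, of x] torus_diff[OF assms(2) lattice_0, of x]
        by simp
      show "b \<in> \<Lambda> \<and> e b = e' b" if "b \<in> set bs" for b
        using that assms(3) lattice_basis_in by (metis in_set_conv_nth)
    qed
    then show ?thesis by (simp add: x)
  next
    case False
    then show ?thesis using torus_outside[OF assms(1)] torus_outside[OF assms(2)] by simp
  qed
qed

lemma torus_of_nat:
  assumes "e \<in> torus \<Lambda>" "x \<in> \<Lambda>"
  shows "of_nat n *\<^sub>R x \<in> \<Lambda> \<and> e (of_nat n *\<^sub>R x) = e x ^ n"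
  by (induction n) (use assms in \<open>auto simp: lattice_0 torus_0 scaleR_left_distrib lattice_add torus_add\<close>)

text \<open>A vertex is trivial on a spanning sublist, so its values on the lattice basis are
  \<open>m\<close>-th roots of unity for the common period \<open>m\<close>, and these values
  determine it.\<close>

lemma finite_vertices:
  assumes X: "set X \<subseteq> \<Lambda>"
  shows "finite (vertices \<Lambda> X)"
proof -
  obtain m :: nat where m: "m > 0 \<and> (\<forall>T j. T \<subseteq> set X \<longrightarrow> span T = UNIV \<longrightarrow> j < d \<longrightarrow>
    (\<exists>n. of_nat m *\<^sub>R (bs ! j) = (\<Sum>t\<in>T. of_int (n t) *\<^sub>R t)))"
    using common_period[OF finite_set X] ..
  have root: "e (bs ! j) ^ m = 1" if e: "e \<in> vertices \<Lambda> X" and j: "j < d" for e j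
  proof -
    have e': "e \<in> torus \<Lambda>" "span (set (fix_part e X)) = UNIV" using e by (simp_all add: vertices_iff)
    have sub: "set (fix_part e X) \<subseteq> set X" by (auto simp: fix_part_def)
    obtain n where n: "of_nat m *\<^sub>R (bs ! j) = (\<Sum>t\<in>set (fix_part e X). of_int (n t) *\<^sub>R t)"
      using m[THEN conjunct2, rule_format, OF sub e'(2) j] ..
    have "(\<lambda>v. v \<in> \<Lambda> \<and> e v = 1) (\<Sum>t\<in>set (fix_part e X). of_int (n t) *\<^sub>R t)"
    proof (rule int_combination_closed)
      show "0 \<in> \<Lambda> \<and> e 0 = 1" using lattice_0 torus_0[OF e'(1)] by simp
      show "x + y \<in> \<Lambda> \<and> e (x + y) = 1" if "x \<in> \<Lambda> \<and> e x = 1" "y \<in> \<Lambda> \<and> e y = 1" for x y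
        using that e' by (simp add: lattice_add torus_add)
      show "- x \<in> \<Lambda> \<and> e (- x) = 1" if "x \<in> \<Lambda> \<and> e x = 1" for x
        using that torus_0[OF e'(1)] lattice_diff[OF lattice_0, of x] torus_diff[OF e'(1) lattice_0, of x]
        by simp
      show "b \<in> \<Lambda> \<and> e b = 1" if "b \<in> set (fix_part e X)" for b
        using that X by (auto simp: fix_part_def)
    qed
    then show ?thesis using torus_of_nat[OF e'(1) lattice_basis_in[OF j], of m] n by simp
  qed
  let ?h = "\<lambda>e. \<lambda>j. if j < d then e (bs ! j) else (0::complex)"
  have "finite {z::complex. z ^ m = 1}"
    using m by (intro finite_roots_unity) simp
  then have "finite {g. \<forall>j. (j \<in> {..<d} \<longrightarrow> g j \<in> {z::complex. z ^ m = 1}) \<and> (j \<notin> {..<d} \<longrightarrow> g j = 0)}"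
    by (intro finite_set_of_finite_funs) auto
  moreover have "?h ` vertices \<Lambda> X \<subseteq>
      {g. \<forall>j. (j \<in> {..<d} \<longrightarrow> g j \<in> {z::complex. z ^ m = 1}) \<and> (j \<notin> {..<d} \<longrightarrow> g j = 0)}"
    using root by auto
  ultimately have "finite (?h ` vertices \<Lambda> X)" by (rule finite_subset[rotated])
  moreover have "inj_on ?h (vertices \<Lambda> X)"
  proof (rule inj_onI)
    fix e e' assume *: "e \<in> vertices \<Lambda> X" "e' \<in> vertices \<Lambda> X" "?h e = ?h e'"
    have "e (bs ! j) = e' (bs ! j)" if "j < d" for j
      using fun_cong[OF *(3), of j] that by simp
    then show "e = e'" using * by (intro torus_eqI) (auto simp: vertices_iff)
  qed
  ultimately show ?thesis by (rule finite_imageD)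
qed

lemma translate_action_0_right [simp]: "translate_action p 0 = 0"
  by (simp add: translate_action_def fun_eq_iff)

lemma DM_space_iff:
  "f \<in> DM_space \<Lambda> X \<longleftrightarrow> f \<in> lattice_funs \<Lambda> \<and> (\<forall>C\<in>cocircuits X. translate_action (nab (mset C)) f = 0)"
proof -
  have "translate_action (nab (mset C)) f = 0" if "\<forall>q\<in>J_nabla \<Lambda> X. translate_action q f = 0" "C \<in> cocircuits X" for C
  proof -
    have "nabla_prod C \<in> J_nabla \<Lambda> X"
      unfolding J_nabla_def ideal_gen_def
      by (intro CollectI exI[of _ "\<lambda>_. 1"] exI[of _ "{nabla_prod C}"])
        (use that(2) lattice_0 in \<open>auto simp: group_alg_def\<close>)
    then show ?thesis using that by (simp add: nabla_prod_eq)
  qed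
  moreover have "translate_action q f = 0"
    if C: "\<forall>C\<in>cocircuits X. translate_action (nab (mset C)) f = 0" and q: "q \<in> J_nabla \<Lambda> X" for q
  proof -
    obtain r F where F: "q = (\<Sum>g\<in>F. r g * g)" "F \<subseteq> nabla_prod ` cocircuits X"
      using q unfolding J_nabla_def ideal_gen_def by blast
    have "translate_action (r g * g) f = 0" if "g \<in> F" for g
      using that F(2) C by (auto simp: translate_action_mult nabla_prod_eq)
    then show ?thesis by (simp add: F(1) translate_action_sum_left fun_eq_iff)
  qed
  ultimately show ?thesis unfolding DM_space_def by blast
qed

lemma nab_union: "nab (S + T) = nab S * nab T"
  by (simp add: nab_def)

lemma nab_nonspanning:
  assumes "f \<in> DM_space \<Lambda> X" "Z \<subseteq># mset X" "span (set_mset (mset X - Z)) \<noteq> UNIV"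
  shows "translate_action (nab Z) f = 0"
proof -
  obtain C where C: "C \<in> cocircuits X" "mset C \<subseteq># Z"
    using nonspanning_contains_cocircuit[OF assms(2,3)] by blast
  have "nab Z = nab (Z - mset C) * nab (mset C)"
    using C(2) by (simp flip: nab_union)
  then show ?thesis
    using C(1) assms(1) by (simp add: translate_action_mult DM_space_iff)
qed

text \<open>A function annihilated by \<open>1 - x\<close> for all \<open>x\<close> in a spanning set is \<open>u\<close>-periodic.\<close>

lemma DM_space_nilpotent:
  assumes f: "f \<in> DM_space \<Lambda> X"
    and u: "\<And>T. T \<subseteq> set X \<Longrightarrow> span T = UNIV \<Longrightarrow> \<exists>n. u = (\<Sum>t\<in>T. of_int (n t) *\<^sub>R t)"
    and "Z \<subseteq># mset X"
  shows "translate_action (bdiff u ^ Suc (size (mset X - Z)) * nab Z) f = 0"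
  using assms(3)
proof (induction "size (mset X - Z)" arbitrary: Z rule: less_induct)
  case less
  let ?n = "size (mset X - Z)"
  show ?case
  proof (cases "span (set_mset (mset X - Z)) = UNIV")
    case False
    then show ?thesis using nab_nonspanning[OF f less.prems]
      by (simp add: translate_action_mult)
  next
    case True
    \<comment> \<open>The remaining factor \<open>bdiff u\<close> has to kill \<open>g\<close>. Each
      \<open>bdiff x\<close> with \<open>x\<close> in the complement does so by induction, with one
      vector more in \<open>Z\<close> and one power of \<open>bdiff u\<close> less, and
      \<open>u\<close> is an integer combination of these \<open>x\<close>.\<close>
    define g where "g = translate_action (bdiff u ^ ?n * nab Z) f"
    have per: "g (y - x) = g y" if x: "x \<in># mset X - Z" for x y
    proof -
      have sz: "Suc (size (mset X - add_mset x Z)) = ?n" "size (mset X - add_mset x Z) < ?n"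
        using x size_Diff_singleton[of x "mset X - Z"] size_Diff1_less[of x "mset X - Z"] by (auto simp: nonempty_has_size[symmetric])
      have "translate_action (bdiff u ^ ?n * nab (add_mset x Z)) f = 0"
        using less.hyps[OF sz(2) add_mset_subseteqI[OF less.prems x]] by (simp only: sz(1))
      moreover have "bdiff u ^ ?n * nab (add_mset x Z) =
          bdiff x * (bdiff u ^ ?n * nab Z)"
        by (simp add: nab_def ac_simps)
      ultimately have "translate_action (bdiff x) g = 0"
        by (simp add: g_def translate_action_mult)
      then show ?thesis using translate_action_diff_single[of x g y] by simp
    qed
    have "set_mset (mset X - Z) \<subseteq> set X" using in_diffD by fastforce
    then obtain n where n: "u = (\<Sum>t\<in>set_mset (mset X - Z). of_int (n t) *\<^sub>R t)"
      using u True by blast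
    have "(\<lambda>v. \<forall>y. g (y - v) = g y) (\<Sum>t\<in>set_mset (mset X - Z). of_int (n t) *\<^sub>R t)"
    proof (rule int_combination_closed)
      show "\<forall>y. g (y - (v + w)) = g y" if "\<forall>y. g (y - v) = g y" "\<forall>y. g (y - w) = g y" for v w
        using that by (metis diff_diff_eq)
      show "\<forall>y. g (y - - v) = g y" if "\<forall>y. g (y - v) = g y" for v
        using that by (metis add_diff_cancel_right' diff_minus_eq_add)
    qed (use per in auto)
    then have "translate_action (bdiff u) g = 0"
      by (simp add: n fun_eq_iff translate_action_diff_single)
    then show ?thesis by (simp add: g_def mult.assoc flip: translate_action_mult)
  qed
qed

end

section \<open>Newton expansion of nilpotent functions\<close>

lemma pochhammer_backward_diff:
  "pochhammer x (Suc k) - pochhammer (x - 1) (Suc k) = of_nat (Suc k) * pochhammer x k" for x :: complex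
proof -
  have "pochhammer (x - 1) (Suc k) = (x - 1) * pochhammer x k"
    by (simp add: pochhammer_rec)
  moreover have "pochhammer x (Suc k) = pochhammer x k * (x + of_nat k)" by (rule pochhammer_Suc)
  ultimately show ?thesis by (simp add: algebra_simps)
qed

text \<open>The interpolation formula for backward differences, whence the rising factorials. Both
  sides agree at n = 0 and, by induction applied to the difference of \<open>f\<close>, have the
  same backward difference in n; so they agree in both directions from 0.\<close>

lemma newton_expansion:
  fixes f :: "'a::real_vector \<Rightarrow> complex"
  assumes "translate_action (bdiff u ^ K) f = 0"
  shows "f (x + of_int n *\<^sub>R u) =
    (\<Sum>k<K. pochhammer (of_int n) k / fact k * translate_action (bdiff u ^ k) f x)"
  using assms
proof (induction K arbitrary: f n)
  case 0
  then show ?case by simp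
next
  case (Suc K)
  let ?w = "bdiff u"
  let ?B = "\<lambda>n k. pochhammer (of_int n) k / fact k :: complex" and ?T = "\<lambda>k. translate_action (?w ^ k) f x"
  define R where "R n = (\<Sum>k<Suc K. ?B n k * ?T k)" for n
  define g where "g = translate_action ?w f"
  have pow: "translate_action (?w ^ k) g = translate_action (?w ^ Suc k) f" for k
    by (simp only: g_def power_Suc2 translate_action_mult)
  have Bdiff: "?B n (Suc k) - ?B (n - 1) (Suc k) = ?B n k" for n k
  proof -
    have "?B n (Suc k) - ?B (n - 1) (Suc k) =
        (pochhammer (of_int n) (Suc k) - pochhammer (of_int n - 1) (Suc k)) / fact (Suc k)"
      by (simp add: diff_divide_distrib)
    also have "\<dots> = ?B n k"
      unfolding pochhammer_backward_diff by (simp add: fact_Suc del: of_nat_Suc)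
    finally show ?thesis .
  qed
  have Rdiff: "R n - R (n - 1) = (\<Sum>k<K. ?B n k * ?T (Suc k))" for n
  proof -
    have "R n - R (n - 1) = (\<Sum>k<Suc K. (?B n k - ?B (n - 1) k) * ?T k)"
      by (simp only: R_def left_diff_distrib sum_subtractf)
    also have "\<dots> = (\<Sum>k<K. (?B n (Suc k) - ?B (n - 1) (Suc k)) * ?T (Suc k))"
      unfolding sum.lessThan_Suc_shift by simp
    finally show ?thesis by (simp only: Bdiff)
  qed
  have fdiff: "f (x + of_int n *\<^sub>R u) - f (x + of_int (n - 1) *\<^sub>R u) = (\<Sum>k<K. ?B n k * ?T (Suc k))" for n
  proof -
    have "f (x + of_int n *\<^sub>R u) - f (x + of_int (n - 1) *\<^sub>R u) = g (x + of_int n *\<^sub>R u)"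
      by (simp add: g_def translate_action_diff_single algebra_simps)
    also have "\<dots> = (\<Sum>k<K. ?B n k * translate_action (?w ^ k) g x)"
      using Suc.prems by (intro Suc.IH) (simp only: pow)
    finally show ?thesis by (simp only: pow)
  qed
  have "a - b = a' - b'" if "a - a' = s" "b - b' = s" for a b a' b' s :: complex
    using that by (simp add: algebra_simps)
  from this[OF fdiff Rdiff]
  have step: "f (x + of_int n *\<^sub>R u) - R n = f (x + of_int (n - 1) *\<^sub>R u) - R (n - 1)" for n .
  have "f (x + of_int n *\<^sub>R u) - R n = 0"
  proof (induction n rule: int_induct[where k = 0])
    case base
    have "R 0 = (\<Sum>k<Suc K. if k = 0 then f x else 0)"
      unfolding R_def by (intro sum.cong refl) (auto simp: pochhammer_0_left)
    then show ?case by simp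
  next
    case (step1 i)
    then show ?case using step[of "i + 1"] by simp
  next
    case (step2 i)
    then show ?case using step[of i] by simp
  qed
  then show ?case by (simp add: R_def)
qed

lemma sum_roots_of_unity:
  assumes "N > 0"
  shows "(\<Sum>a<N. cis (2 * pi * of_nat a * of_int m / of_nat N)) = (if int N dvd m then of_nat N else 0)"
proof -
  define w where "w = cis (2 * pi * of_int m / of_nat N)"
  have pw: "cis (2 * pi * of_nat a * of_int m / of_nat N) = w ^ a" for a
    unfolding w_def DeMoivre by (rule arg_cong[of _ _ cis]) simp
  have "w ^ N = cis (2 * pi * of_int m)"
    using assms unfolding w_def DeMoivre by (intro arg_cong[of _ _ cis]) simp
  then have wN: "w ^ N = 1" by simp
  have w1: "w = 1 \<longleftrightarrow> int N dvd m"
  proof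
    assume "w = 1"
    then have "cos (2 * pi * of_int m / of_nat N) = 1" by (simp add: w_def complex_eq_iff)
    then obtain n :: int where n: "2 * pi * of_int m / of_nat N = of_int n * 2 * pi"
      by (auto simp: cos_one_2pi_int)
    have "(2 * pi) * (of_int m / of_nat N) = (2 * pi) * of_int n" using n by (simp add: ac_simps)
    then have "2 * pi = 0 \<or> of_int m / of_nat N = (of_int n :: real)" by (simp only: mult_cancel_left)
    then have "of_int m / of_nat N = (of_int n :: real)" by simp
    then have "of_int m = (of_int (n * int N) :: real)" using assms by (simp add: field_simps)
    then have "m = n * int N" by (simp only: of_int_eq_iff)
    then show "int N dvd m" by simp
  next
    assume "int N dvd m"
    then obtain n where "m = int N * n" by (elim dvdE)
    then have "2 * pi * of_int m / of_nat N = 2 * pi * of_int n" using assms by simp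
    then show "w = 1" unfolding w_def by (simp only: cis_multiple_2pi[OF Ints_of_int])
  qed
  show ?thesis
  proof (cases "w = 1")
    case True
    then show ?thesis using w1 by (simp add: pw)
  next
    case False
    then have "(\<Sum>a<N. w ^ a) = 0" using wN by (simp add: geometric_sum)
    then show ?thesis using w1 False by (simp add: pw)
  qed
qed

text \<open>Newton's expansion on each residue class modulo \<open>N\<close>, the indicator of a class being written
  with roots of unity.\<close>

lemma quasi_polynomial_expansion:
  fixes f :: "'a::real_vector \<Rightarrow> complex"
  assumes N: "N > 0" and f: "translate_action (bdiff (of_nat N *\<^sub>R b) ^ K) f = 0"
  shows "f (x + of_int n *\<^sub>R b) =
    (\<Sum>r<N. \<Sum>a<N. \<Sum>k<K. cis (2 * pi * of_nat a * of_int (n - int r) / of_nat N) / of_nat N *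
      (pochhammer ((of_int n - of_nat r) / of_nat N) k / fact k) *
      translate_action (bdiff (of_nat N *\<^sub>R b) ^ k) f (x + of_nat r *\<^sub>R b))"
proof -
  let ?S = "\<lambda>r. \<Sum>k<K. pochhammer ((of_int n - of_nat r) / of_nat N) k / fact k *
      translate_action (bdiff (of_nat N *\<^sub>R b) ^ k) f (x + of_nat r *\<^sub>R b)"
  \<comment> \<open>Division with remainder, n = q N + r0: the sum over \<open>a\<close> is N times
    the indicator of r = r0, and Newton's formula with step N b starts from x + r0 b.\<close>
  define r0 where "r0 = nat (n mod int N)"
  define q where "q = n div int N"
  have r0: "r0 < N" "int r0 = n mod int N" using N by (simp_all add: r0_def nat_less_iff)
  have n: "n = q * int N + int r0" using r0(2) by (simp add: q_def)
  have dvd: "int N dvd n - int r \<longleftrightarrow> r = r0" if "r < N" for r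
  proof
    assume "int N dvd n - int r"
    then have "n mod int N = int r mod int N" by (simp add: mod_eq_dvd_iff)
    also have "\<dots> = int r" using that by simp
    finally show "r = r0" by (simp add: r0_def)
  qed (use n in simp)
  have "(\<Sum>r<N. \<Sum>a<N. \<Sum>k<K. cis (2 * pi * of_nat a * of_int (n - int r) / of_nat N) / of_nat N *
      (pochhammer ((of_int n - of_nat r) / of_nat N) k / fact k) *
      translate_action (bdiff (of_nat N *\<^sub>R b) ^ k) f (x + of_nat r *\<^sub>R b)) =
    (\<Sum>r<N. (\<Sum>a<N. cis (2 * pi * of_nat a * of_int (n - int r) / of_nat N)) / of_nat N * ?S r)"
    by (simp only: sum_divide_distrib sum_product mult.assoc)
  also have "\<dots> = (\<Sum>r<N. if r = r0 then ?S r0 else 0)"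
    unfolding sum_roots_of_unity[OF N] using N dvd by (intro sum.cong refl) auto
  also have "\<dots> = ?S r0" using r0(1) by simp
  also have "\<dots> = f ((x + of_nat r0 *\<^sub>R b) + of_int q *\<^sub>R (of_nat N *\<^sub>R b))"
  proof -
    have "(of_int n - of_nat r0) / of_nat N = (of_int q :: complex)"
      using N by (simp add: n)
    then show ?thesis unfolding newton_expansion[OF f] by simp
  qed
  also have "(x + of_nat r0 *\<^sub>R b) + of_int q *\<^sub>R (of_nat N *\<^sub>R b) = x + of_int n *\<^sub>R b"
    by (simp add: n scaleR_left_distrib)
  finally show ?thesis ..
qed

context lattice
begin

text \<open>The character with frequency vector a/N, as a function of real coordinates, so that it
  applies to integer tuples and to the coordinates of lattice points alike.\<close>

definition wave :: "nat \<Rightarrow> (nat \<Rightarrow> nat) \<Rightarrow> (nat \<Rightarrow> real) \<Rightarrow> complex"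
  where "wave N a t = cis (2 * pi * (\<Sum>i<d. of_nat (a i) * t i) / of_nat N)"

text \<open>Exponential polynomials as functions of integer tuples, so that the coordinates can be
  expanded one at a time. Inductive generation postpones the families indexed by characters to
  \<open>quasi_expand\<close>.\<close>

inductive_set quasi :: "nat \<Rightarrow> ((nat \<Rightarrow> int) \<Rightarrow> complex) set" for N where
  exponential_monomial: "g \<in> cpolys d \<Longrightarrow>
    (\<lambda>n. wave N a (\<lambda>i. of_int (n i)) * ceval g (\<lambda>i. of_int (n i))) \<in> quasi N"
| add: "G \<in> quasi N \<Longrightarrow> H \<in> quasi N \<Longrightarrow> (\<lambda>n. G n + H n) \<in> quasi N"

lemma wave_add: "wave N a t * wave N b t = wave N (\<lambda>i. a i + b i) t"
  by (simp add: wave_def cis_mult sum.distrib distrib_left distrib_right add_divide_distrib)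

lemma quasi_poly: "g \<in> cpolys d \<Longrightarrow> (\<lambda>n. ceval g (\<lambda>i. of_int (n i))) \<in> quasi N"
  using quasi.exponential_monomial[of g N "\<lambda>_. 0"] by (simp add: wave_def)

lemma quasi_const: "(\<lambda>n. c) \<in> quasi N"
proof -
  have "cconst c \<in> cpolys d" by (simp add: cconst_def cpolys_single)
  from quasi_poly[OF this] show ?thesis by (simp add: ceval_eq_ins)
qed

lemma quasi_mult:
  assumes "G \<in> quasi N" "H \<in> quasi N"
  shows "(\<lambda>n. G n * H n) \<in> quasi N"
  using assms(1)
proof induction
  case (exponential_monomial g a)
  show ?case
    using assms(2)
  proof induction
    case (exponential_monomial h b)
    have "(\<lambda>n. wave N a (\<lambda>i. of_int (n i)) * ceval g (\<lambda>i. of_int (n i)) *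
        (wave N b (\<lambda>i. of_int (n i)) * ceval h (\<lambda>i. of_int (n i)))) =
      (\<lambda>n. wave N (\<lambda>i. a i + b i) (\<lambda>i. of_int (n i)) * ceval (g * h) (\<lambda>i. of_int (n i)))"
      by (simp add: ceval_eq_ins ceval.ins_mult fun_eq_iff flip: wave_add)
    then show ?case
      using quasi.exponential_monomial[OF cpolys_mult[OF \<open>g \<in> cpolys d\<close> \<open>h \<in> cpolys d\<close>]] by metis
  next
    case (add H1 H2)
    show ?case using quasi.add[OF add.IH] by (simp add: distrib_left)
  qed
next
  case (add G1 G2)
  show ?case using quasi.add[OF add.IH] by (simp add: distrib_right)
qed

lemma quasi_sum:
  assumes "\<And>a. a \<in> A \<Longrightarrow> G a \<in> quasi N"
  shows "(\<lambda>n. \<Sum>a\<in>A. G a n) \<in> quasi N"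
  using assms
proof (induction A rule: infinite_finite_induct)
  case (insert x A)
  then have "(\<lambda>n. G x n + (\<Sum>a\<in>A. G a n)) \<in> quasi N" by (intro quasi.add) auto
  then show ?case using insert.hyps by simp
qed (simp_all add: quasi_const)

lemma quasi_cis:
  assumes "j < d"
  shows "(\<lambda>n. cis (2 * pi * of_nat a * of_int (n j - int r) / of_nat N)) \<in> quasi N"
proof -
  let ?a = "\<lambda>i. if i = j then a else 0"
  have "(\<Sum>i<d. of_nat (?a i) * t i) = of_nat a * t j" for t :: "nat \<Rightarrow> real"
  proof -
    have "(\<Sum>i<d. of_nat (?a i) * t i) = (\<Sum>i<d. if i = j then of_nat a * t j else 0)"
      by (intro sum.cong) auto
    then show ?thesis using assms by simp
  qed
  then have w: "wave N ?a t = cis (2 * pi * (of_nat a * t j) / of_nat N)" for t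
    by (simp only: wave_def)
  have "(\<lambda>n. wave N ?a (\<lambda>i. of_int (n i)) * cis (- (2 * pi * of_nat a * of_nat r / of_nat N))) \<in> quasi N"
    using quasi.exponential_monomial[of "cconst (cis (- (2 * pi * of_nat a * of_nat r / of_nat N)))" N ?a]
    by (simp add: cconst_def cpolys_single) (simp add: ceval_eq_ins flip: cconst_def)
  moreover have "wave N ?a (\<lambda>i. of_int (n i)) * cis (- (2 * pi * of_nat a * of_nat r / of_nat N)) =
      cis (2 * pi * of_nat a * of_int (n j - int r) / of_nat N)" for n
    unfolding w cis_mult by (rule arg_cong[of _ _ cis]) (simp add: algebra_simps diff_divide_distrib)
  ultimately show ?thesis by simp
qed

lemma quasi_pochhammer:
  assumes "j < d"
  shows "(\<lambda>n. pochhammer ((of_int (n j) - of_nat r) / of_nat N) k) \<in> quasi M"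
proof (induction k)
  case 0
  show ?case by (simp add: quasi_const)
next
  case (Suc k)
  let ?g = "cscale (1 / of_nat N) (cvar j) + cconst (of_nat k - of_nat r / of_nat N)"
  have "?g \<in> cpolys d"
    using assms unfolding cvar_def cconst_def
    by (intro cpoly.subspace_add cpoly.subspace_scale cpolys_subspace cpolys_single) auto
  then have "(\<lambda>n. ceval ?g (\<lambda>i. of_int (n i))) \<in> quasi M" by (rule quasi_poly)
  moreover have "ceval ?g (\<lambda>i. of_int (n i)) = (of_int (n j) - of_nat r) / of_nat N + of_nat k" for n
    by (simp add: ceval_eq_ins ceval.ins_add diff_divide_distrib)
  ultimately show ?case using quasi_mult[OF Suc] by (simp add: pochhammer_Suc)
qed

text \<open>Induction on the number \<open>j\<close> of coordinates that vary. Expansion in the last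
  one yields differences of \<open>f\<close> at shifted base points; differences commute, so
  nilpotency in all directions is inherited. Hence \<open>f\<close> and \<open>x\<close> are
  generalised.\<close>

lemma quasi_if_nilpotent:
  assumes N: "N > 0" and "j \<le> d"
    and "\<And>i. i < d \<Longrightarrow> translate_action (bdiff (of_nat N *\<^sub>R (bs ! i)) ^ K) f = 0"
  shows "(\<lambda>n. f (x + (\<Sum>i<j. of_int (n i) *\<^sub>R bs ! i))) \<in> quasi N"
  using assms(2,3)
proof (induction j arbitrary: f x)
  case 0
  then show ?case by (simp add: quasi_const)
next
  case (Suc j)
  let ?w = "bdiff (of_nat N *\<^sub>R (bs ! j))"
  let ?y = "\<lambda>n. \<Sum>i<j. of_int (n i) *\<^sub>R bs ! i"
  have IH: "(\<lambda>n. translate_action (?w ^ k) f ((x + of_nat r *\<^sub>R bs ! j) + ?y n)) \<in> quasi N" for k r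
  proof (rule Suc.IH)
    fix i assume i: "i < d"
    let ?v = "bdiff (of_nat N *\<^sub>R (bs ! i))"
    have "translate_action (?v ^ K) (translate_action (?w ^ k) f) = translate_action (?w ^ k) (translate_action (?v ^ K) f)"
      unfolding translate_action_mult[symmetric] by (rule arg_cong2[of _ _ _ _ translate_action, OF mult.commute refl])
    then show "translate_action (?v ^ K) (translate_action (?w ^ k) f) = 0"
      unfolding Suc.prems(2)[OF i] by simp
  qed (use Suc.prems(1) in simp)
  have "(\<lambda>n. \<Sum>r<N. \<Sum>a<N. \<Sum>k<K. cis (2 * pi * of_nat a * of_int (n j - int r) / of_nat N) * (1 / of_nat N) *
      (pochhammer ((of_int (n j) - of_nat r) / of_nat N) k * (1 / fact k)) *
      translate_action (?w ^ k) f ((x + of_nat r *\<^sub>R bs ! j) + ?y n)) \<in> quasi N"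
    using Suc.prems(1) by (intro quasi_sum quasi_mult quasi_const quasi_cis quasi_pochhammer IH) auto
  moreover have "f (x + (\<Sum>i<Suc j. of_int (n i) *\<^sub>R bs ! i)) =
     (\<Sum>r<N. \<Sum>a<N. \<Sum>k<K. cis (2 * pi * of_nat a * of_int (n j - int r) / of_nat N) * (1 / of_nat N) *
      (pochhammer ((of_int (n j) - of_nat r) / of_nat N) k * (1 / fact k)) *
      translate_action (?w ^ k) f ((x + of_nat r *\<^sub>R bs ! j) + ?y n))" for n
  proof -
    have "f (x + (\<Sum>i<Suc j. of_int (n i) *\<^sub>R bs ! i)) = f ((x + ?y n) + of_int (n j) *\<^sub>R bs ! j)"
      by (simp add: add.assoc)
    also have "\<dots> = (\<Sum>r<N. \<Sum>a<N. \<Sum>k<K. cis (2 * pi * of_nat a * of_int (n j - int r) / of_nat N) / of_nat N *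
      (pochhammer ((of_int (n j) - of_nat r) / of_nat N) k / fact k) *
      translate_action (?w ^ k) f ((x + ?y n) + of_nat r *\<^sub>R bs ! j))"
      using Suc.prems(1) by (intro quasi_polynomial_expansion N Suc.prems(2)) simp
    finally have *: "f (x + (\<Sum>i<Suc j. of_int (n i) *\<^sub>R bs ! i)) = \<dots>" .
    have ac: "(x + ?y n) + of_nat r *\<^sub>R bs ! j = (x + of_nat r *\<^sub>R bs ! j) + ?y n" for r
      by (simp only: ac_simps)
    show ?thesis unfolding * ac by simp
  qed
  ultimately show ?case by simp
qed

text \<open>Lattice points have integer coordinates, so the floors are exact. Families over
  different sets of characters are merged by extending each by zero to the union.\<close>

lemma quasi_expand:
  assumes "G \<in> quasi N"
  shows "\<exists>E F. finite E \<and> E \<subseteq> torus \<Lambda> \<and> (\<forall>e. F e \<in> cpolys d) \<and>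
    (\<forall>y\<in>\<Lambda>. G (\<lambda>i. \<lfloor>co y i\<rfloor>) = (\<Sum>e\<in>E. e y * eval_at bs (F e) y))"
  using assms
proof induction
  case (exponential_monomial g a)
  define e where "e y = (if y \<in> \<Lambda> then wave N a (co y) else 0)" for y
  have "e (x + y) = e x * e y" if "x \<in> \<Lambda>" "y \<in> \<Lambda>" for x y
    using that by (simp add: e_def lattice_add wave_def co_add cis_mult sum.distrib distrib_left add_divide_distrib)
  then have "e \<in> torus \<Lambda>"
    by (simp add: torus_def lattice_funs_def e_def) (simp add: wave_def)
  moreover have "wave N a (\<lambda>i. of_int \<lfloor>co y i\<rfloor>) * ceval g (\<lambda>i. of_int \<lfloor>co y i\<rfloor>) = e y * eval_at bs g y"
    if "y \<in> \<Lambda>" for y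
  proof -
    have "wave N a (\<lambda>i. of_int \<lfloor>co y i\<rfloor>) = wave N a (co y)"
      unfolding wave_def using co_lattice[OF that] by (intro arg_cong[of _ _ cis]) simp
    moreover have "of_int \<lfloor>co y i\<rfloor> = complex_of_real (co y i)" if "i < d" for i
      using co_lattice[OF \<open>y \<in> \<Lambda>\<close> that] by (metis of_real_of_int_eq)
    then have "ceval g (\<lambda>i. of_int \<lfloor>co y i\<rfloor>) = eval_at bs g y"
      unfolding eval_at_eq by (intro ceval_cong[OF exponential_monomial])
    ultimately show ?thesis using that by (simp add: e_def)
  qed
  ultimately show ?case
    using exponential_monomial by (intro exI[of _ "{e}"] exI[of _ "\<lambda>_. g"]) simp
next
  case (add G H)
  obtain E1 F1 where 1: "finite E1" "E1 \<subseteq> torus \<Lambda>" "\<forall>e. F1 e \<in> cpolys d"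
    "\<forall>y\<in>\<Lambda>. G (\<lambda>i. \<lfloor>co y i\<rfloor>) = (\<Sum>e\<in>E1. e y * eval_at bs (F1 e) y)" using add.IH(1) by (elim exE conjE)
  obtain E2 F2 where 2: "finite E2" "E2 \<subseteq> torus \<Lambda>" "\<forall>e. F2 e \<in> cpolys d"
    "\<forall>y\<in>\<Lambda>. H (\<lambda>i. \<lfloor>co y i\<rfloor>) = (\<Sum>e\<in>E2. e y * eval_at bs (F2 e) y)" using add.IH(2) by (elim exE conjE)
  define F where "F e = (if e \<in> E1 then F1 e else 0) + (if e \<in> E2 then F2 e else 0)" for e
  have "F e \<in> cpolys d" for e
    unfolding F_def using 1(3) 2(3) cpoly.subspace_0[OF cpolys_subspace]
    by (intro cpoly.subspace_add cpolys_subspace) auto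
  moreover have "G (\<lambda>i. \<lfloor>co y i\<rfloor>) + H (\<lambda>i. \<lfloor>co y i\<rfloor>) = (\<Sum>e\<in>E1 \<union> E2. e y * eval_at bs (F e) y)"
    if "y \<in> \<Lambda>" for y
  proof -
    have "(\<Sum>e\<in>E1 \<union> E2. e y * eval_at bs (F e) y) =
        (\<Sum>e\<in>E1 \<union> E2. if e \<in> E1 then e y * eval_at bs (F1 e) y else 0) +
        (\<Sum>e\<in>E1 \<union> E2. if e \<in> E2 then e y * eval_at bs (F2 e) y else 0)"
      unfolding sum.distrib[symmetric]
      by (intro sum.cong) (auto simp: F_def eval_at_eq ceval_eq_ins ceval.ins_add algebra_simps)
    also have "(\<Sum>e\<in>E1 \<union> E2. if e \<in> E1 then e y * eval_at bs (F1 e) y else 0) = (\<Sum>e\<in>E1. e y * eval_at bs (F1 e) y)"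
      using 1(1) 2(1) by (intro sum.mono_neutral_cong_right) auto
    also have "(\<Sum>e\<in>E1 \<union> E2. if e \<in> E2 then e y * eval_at bs (F2 e) y else 0) = (\<Sum>e\<in>E2. e y * eval_at bs (F2 e) y)"
      using 1(1) 2(1) by (intro sum.mono_neutral_cong_right) auto
    finally show ?thesis using 1(4) 2(4) that by simp
  qed
  ultimately show ?case using 1(1,2) 2(1,2) by (intro exI[of _ "E1 \<union> E2"] exI[of _ F]) auto
qed

lemma DM_space_exponential_polynomial:
  assumes f: "f \<in> DM_space \<Lambda> X" and X: "set X \<subseteq> \<Lambda>"
  shows "\<exists>E F. finite E \<and> E \<subseteq> torus \<Lambda> \<and> (\<forall>e. F e \<in> cpolys d) \<and>
    (\<forall>y\<in>\<Lambda>. f y = (\<Sum>e\<in>E. e y * eval_at bs (F e) y))"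
proof -
  obtain N :: nat where N: "N > 0 \<and> (\<forall>T j. T \<subseteq> set X \<longrightarrow> span T = UNIV \<longrightarrow> j < d \<longrightarrow>
    (\<exists>n. of_nat N *\<^sub>R (bs ! j) = (\<Sum>t\<in>T. of_int (n t) *\<^sub>R t)))"
    using common_period[OF finite_set X] ..
  \<comment> \<open>The exponent is the bound of \<open>DM_space_nilpotent\<close> for empty
    \<open>Z\<close>: one more than the length of \<open>X\<close>.\<close>
  have nil: "translate_action (bdiff (of_nat N *\<^sub>R (bs ! i)) ^ Suc (size (mset X))) f = 0"
    if i: "i < d" for i
  proof -
    have "translate_action (bdiff (of_nat N *\<^sub>R (bs ! i)) ^ Suc (size (mset X - {#})) * nab {#}) f = 0"
      using N[THEN conjunct2, rule_format, OF _ _ i] by (rule DM_space_nilpotent[OF f]) simp_all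
    then show ?thesis by (simp only: nab_def image_mset_empty prod_mset_empty diff_empty mult_1_right)
  qed
  have "(\<lambda>n. f (0 + (\<Sum>i<d. of_int (n i) *\<^sub>R bs ! i))) \<in> quasi N"
    by (rule quasi_if_nilpotent[OF N[THEN conjunct1] order_refl nil])
  then have q: "(\<lambda>n. f (lat n)) \<in> quasi N" by (simp add: lat_def)
  have "f (lat (\<lambda>i. \<lfloor>co y i\<rfloor>)) = f y" if "y \<in> \<Lambda>" for y
    using lattice_cases[OF that] by simp
  then show ?thesis using quasi_expand[OF q] by (simp cong: ball_cong)
qed

end

section \<open>The discrete space and the pairing\<close>

context lattice
begin

text \<open>The first two clauses of the description behind \<open>DM_component\<close>; the third
  is expressed by \<open>family_sum\<close>.\<close>

definition DM_family :: "'a list \<Rightarrow> (('a \<Rightarrow> complex) \<Rightarrow> cpoly) \<Rightarrow> bool"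
  where "DM_family X F \<longleftrightarrow> (\<forall>e\<in>vertices \<Lambda> X. F e \<in> D_space bs (fix_part e X)) \<and>
    (\<forall>e. e \<notin> vertices \<Lambda> X \<longrightarrow> F e = 0)"

definition family_sum :: "'a list \<Rightarrow> (('a \<Rightarrow> complex) \<Rightarrow> cpoly) \<Rightarrow> 'a \<Rightarrow> complex"
  where "family_sum X F x = (\<Sum>e\<in>vertices \<Lambda> X. e x * eval_at bs (F e) x)"

lemma vertices_torus: "vertices \<Lambda> X \<subseteq> torus \<Lambda>"
  by (auto simp: vertices_def)

lemma mset_fix_part: "mset (fix_part e X) = filter_mset (\<lambda>x. e x = 1) (mset X)"
  by (simp add: fix_part_def)

lemma eval_at_0 [simp]: "eval_at bs 0 x = 0"
  by (simp add: eval_at_eq ceval_eq_ins)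

lemma eval_at_add: "eval_at bs (f + g) x = eval_at bs f x + eval_at bs g x"
  by (simp add: eval_at_eq ceval_eq_ins ceval.ins_add)

lemma eval_at_cscale: "eval_at bs (cscale c f) x = c * eval_at bs f x"
  by (simp add: eval_at_eq ceval_eq_ins)

lemma D_space_cpolys: "f \<in> D_space bs Y \<Longrightarrow> f \<in> cpolys d"
  by (simp add: D_space_iff)

lemma D_space_subspace: "cpoly.subspace (D_space bs Y)"
  using cpolys_subspace[of d]
  by (intro cpoly.subspaceI)
    (auto simp: D_space_iff diff_op_add_right diff_op_cscale_right
      intro: cpoly.subspace_0 cpoly.subspace_add cpoly.subspace_scale)

lemma nab_action_sum:
  assumes "E \<subseteq> torus \<Lambda>" "\<And>e. e \<in> E \<Longrightarrow> F e \<in> deg_less k" "\<And>e. e \<in> E \<Longrightarrow> F e \<in> cpolys d" "set_mset S \<subseteq> \<Lambda>"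
  shows "translate_action (nab S) (\<lambda>x. \<Sum>e\<in>E. e x * eval_at bs (F e) x) =
    (\<lambda>x. \<Sum>e\<in>E. e x * eval_at bs (diff_op (twisted_prod e k S) (F e)) x)"
  unfolding translate_action_sum_right
proof (intro ext sum.cong refl)
  fix x e assume "e \<in> E"
  with assms show "translate_action (nab S) (\<lambda>x. e x * eval_at bs (F e) x) x =
      e x * eval_at bs (diff_op (twisted_prod e k S) (F e)) x"
    by (subst nab_action) auto
qed

text \<open>Restriction to the fixed part shrinks the complement of \<open>Z\<close>, so a
  nonspanning complement stays nonspanning.\<close>

lemma D_space_fix_part:
  assumes "g \<in> D_space bs (fix_part e X)" "Z \<subseteq># mset X" "span (set_mset (mset X - Z)) \<noteq> UNIV"
  shows "diff_op (lprod (filter_mset (\<lambda>x. e x = 1) Z)) g = 0"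
proof -
  let ?P = "\<lambda>x. e x = 1"
  have "filter_mset ?P Z \<subseteq># mset (fix_part e X)"
    unfolding mset_fix_part using assms(2) by (rule multiset_filter_mono)
  moreover have "set_mset (mset (fix_part e X) - filter_mset ?P Z) \<subseteq> set_mset (mset X - Z)"
    unfolding mset_fix_part by (auto simp: in_diff_count split: if_splits)
  then have "span (set_mset (mset (fix_part e X) - filter_mset ?P Z)) \<noteq> UNIV"
    using assms(3) span_mono by blast
  ultimately show ?thesis using assms(1) by (simp add: D_space_iff)
qed

lemma DM_family_cpolys: "DM_family X F \<Longrightarrow> F e \<in> cpolys d"
  using D_space_cpolys cpoly.subspace_0[OF cpolys_subspace] unfolding DM_family_def by (cases "e \<in> vertices \<Lambda> X") auto

lemma family_sum_outside: "x \<notin> \<Lambda> \<Longrightarrow> family_sum X F x = 0"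
  unfolding family_sum_def using vertices_torus[of X] torus_outside by (intro sum.neutral) auto

lemma DM_space_family_sum:
  assumes X: "set X \<subseteq> \<Lambda>" and F: "DM_family X F"
  shows "family_sum X F \<in> DM_space \<Lambda> X"
  unfolding DM_space_iff
proof (intro conjI ballI)
  show "family_sum X F \<in> lattice_funs \<Lambda>"
    by (simp add: lattice_funs_def family_sum_outside)
next
  fix C assume C: "C \<in> cocircuits X"
  have sub: "set_mset (mset C) \<subseteq> \<Lambda>"
    using cocircuit_nonspanning(1)[OF C] X set_mset_mono by fastforce
  obtain k where k: "\<forall>e\<in>vertices \<Lambda> X. F e \<in> deg_less k"
    using exists_common_deg_less[OF finite_vertices[OF X], of F] by blast
  have "translate_action (nab (mset C)) (\<lambda>x. \<Sum>e\<in>vertices \<Lambda> X. e x * eval_at bs (F e) x) =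
      (\<lambda>x. \<Sum>e\<in>vertices \<Lambda> X. e x * eval_at bs (diff_op (twisted_prod e k (mset C)) (F e)) x)"
    using k DM_family_cpolys[OF F] sub vertices_torus by (intro nab_action_sum) auto
  also have "\<dots> = (\<lambda>x. 0)"
  proof (intro ext sum.neutral ballI)
    fix x e assume e: "e \<in> vertices \<Lambda> X"
    then have "F e \<in> D_space bs (fix_part e X)" using F by (simp add: DM_family_def)
    then have "diff_op (lprod (filter_mset (\<lambda>x. e x = 1) (mset C))) (F e) = 0"
      using cocircuit_nonspanning[OF C] by (rule D_space_fix_part)
    then have "diff_op (twisted_prod e k (mset C)) (F e) = 0"
      using diff_op_twisted_prod_eq_0_iff[OF subsetD[OF vertices_torus e] sub] by blast
    then show "e x * eval_at bs (diff_op (twisted_prod e k (mset C)) (F e)) x = 0" by simp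
  qed
  finally show "translate_action (nab (mset C)) (family_sum X F) = 0"
    unfolding family_sum_def[abs_def] by (simp add: fun_eq_iff)
qed

text \<open>In an arbitrary exponential expansion of \<open>f\<close>, independence separates the
  characters, so each cocircuit equation holds summand by summand; characters that are not vertices
  then contribute zero.\<close>

lemma DM_family_exists:
  assumes X: "set X \<subseteq> \<Lambda>" and f: "f \<in> DM_space \<Lambda> X"
  shows "\<exists>F. DM_family X F \<and> (\<forall>x\<in>\<Lambda>. f x = family_sum X F x)"
proof -
  obtain E F where E: "finite E" "E \<subseteq> torus \<Lambda>" "\<forall>e. F e \<in> cpolys d"
    "\<forall>y\<in>\<Lambda>. f y = (\<Sum>e\<in>E. e y * eval_at bs (F e) y)"
    using DM_space_exponential_polynomial[OF f X] by (elim exE conjE)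
  obtain k where k: "\<forall>e\<in>E. F e \<in> deg_less k"
    using exists_common_deg_less[OF E(1), of F] by blast
  have f_eq: "f = (\<lambda>y. \<Sum>e\<in>E. e y * eval_at bs (F e) y)"
  proof
    fix y
    show "f y = (\<Sum>e\<in>E. e y * eval_at bs (F e) y)"
    proof (cases "y \<in> \<Lambda>")
      case True
      then show ?thesis using E(4) by blast
    next
      case False
      have "(\<Sum>e\<in>E. e y * eval_at bs (F e) y) = 0"
        using False E(2) torus_outside by (intro sum.neutral) auto
      moreover have "f y = 0" using f False by (auto simp: DM_space_iff lattice_funs_def)
      ultimately show ?thesis by simp
    qed
  qed
  have killed: "diff_op (lprod (filter_mset (\<lambda>x. e x = 1) (mset C))) (F e) = 0"
    if C: "C \<in> cocircuits X" and e: "e \<in> E" for C e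
  proof -
    have sub: "set_mset (mset C) \<subseteq> \<Lambda>"
      using cocircuit_nonspanning(1)[OF C] X set_mset_mono by fastforce
    have "translate_action (nab (mset C)) f = 0" using f C by (simp add: DM_space_iff)
    moreover have "translate_action (nab (mset C)) f =
        (\<lambda>x. \<Sum>e\<in>E. e x * eval_at bs (diff_op (twisted_prod e k (mset C)) (F e)) x)"
      unfolding f_eq using k E(2,3) sub by (intro nab_action_sum) auto
    ultimately have "(\<Sum>e\<in>E. e x * eval_at bs (diff_op (twisted_prod e k (mset C)) (F e)) x) = 0" for x
      by (metis zero_fun_apply)
    then have "\<forall>e\<in>E. diff_op (twisted_prod e k (mset C)) (F e) = 0"
      using E(3) by (intro exponential_polynomials_independent E(1,2) diff_op_cpolys) auto
    then show ?thesis
      using diff_op_twisted_prod_eq_0_iff[OF subsetD[OF E(2) e] sub] e by blast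
  qed
  have D: "F e \<in> D_space bs (fix_part e X)" if e: "e \<in> E" for e
    unfolding D_space_iff
  proof (intro conjI allI impI)
    show "F e \<in> cpolys d" using E(3) by blast
    fix Z assume Z: "Z \<subseteq># mset (fix_part e X)" "span (set_mset (mset (fix_part e X) - Z)) \<noteq> UNIV"
    let ?P = "\<lambda>x. e x = 1" 
    \<comment> \<open>\<open>Z\<close> is enlarged by all moved vectors. Its complement in
      \<open>X\<close> is then that of \<open>Z\<close> in the fixed part, so some cocircuit of
      \<open>X\<close> fits inside \<open>Z + N\<close>, and its fixed vectors lie in
      \<open>Z\<close>.\<close>
    define N where "N = filter_mset (\<lambda>x. \<not> e x = 1) (mset X)"
    have part: "mset X = mset (fix_part e X) + N"
      unfolding mset_fix_part N_def by (rule multiset_partition)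
    have filter_N: "filter_mset ?P N = {#}" by (simp add: N_def filter_filter_mset)
    have "Z + N \<subseteq># mset X" unfolding part using Z(1) by simp
    moreover have "mset X - (Z + N) = mset (fix_part e X) - Z"
      unfolding part using Z(1) by simp
    ultimately obtain C where C: "C \<in> cocircuits X" "mset C \<subseteq># Z + N"
      using nonspanning_contains_cocircuit[of "Z + N" X] Z(2) by auto
    have "filter_mset ?P (mset C) \<subseteq># filter_mset ?P (Z + N)"
      using C(2) by (rule multiset_filter_mono)
    also have "filter_mset ?P (Z + N) = filter_mset ?P Z"
      by (simp add: filter_N)
    also have "\<dots> \<subseteq># Z" by (rule multiset_filter_subset)
    finally have "lprod Z = lprod (Z - filter_mset ?P (mset C)) * lprod (filter_mset ?P (mset C))"
      by (simp flip: lprod_union)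
    then show "diff_op (lprod Z) (F e) = 0" using killed[OF C(1) e] by (simp add: diff_op_mult)
  qed
  \<comment> \<open>If the fixed part does not span, the empty \<open>Z\<close> has nonspanning
    complement, and its operator is the identity.\<close>
  have zero: "F e = 0" if "e \<in> E" "e \<notin> vertices \<Lambda> X" for e
  proof -
    have "\<not> (e \<in> torus \<Lambda> \<and> span (set (fix_part e X)) = UNIV)"
      using that(2) unfolding vertices_iff .
    then have "span (set (fix_part e X)) \<noteq> UNIV" using subsetD[OF E(2) that(1)] by blast
    then have ne: "span (set_mset (mset (fix_part e X) - {#})) \<noteq> UNIV" unfolding diff_zero set_mset_mset .
    have "diff_op (lprod {#}) (F e) = 0"
      using D[OF that(1)] unfolding D_space_iff by (elim conjE allE[of _ "{#}"] impE) (rule empty_le, rule ne)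
    then show ?thesis by (simp only: lprod_empty diff_op_1)
  qed
  define F' where "F' e = (if e \<in> E \<inter> vertices \<Lambda> X then F e else 0)" for e
  have "DM_family X F'"
    unfolding DM_family_def F'_def using D cpoly.subspace_0[OF D_space_subspace] by auto
  moreover have "f x = family_sum X F' x" if "x \<in> \<Lambda>" for x
  proof -
    have "f x = (\<Sum>e\<in>E \<inter> vertices \<Lambda> X. e x * eval_at bs (F e) x)"
      unfolding f_eq using E(1) zero by (intro sum.mono_neutral_right) auto
    also have "\<dots> = family_sum X F' x"
      unfolding family_sum_def F'_def using finite_vertices[OF X] by (intro sum.mono_neutral_cong_left) auto
    finally show ?thesis .
  qed
  ultimately show ?thesis by blast
qed

lemma DM_family_unique:
  assumes X: "set X \<subseteq> \<Lambda>" and F: "DM_family X F" "DM_family X G"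
    and eq: "\<And>x. x \<in> \<Lambda> \<Longrightarrow> family_sum X F x = family_sum X G x"
  shows "F = G"
proof -
  have "\<forall>e\<in>vertices \<Lambda> X. F e + cscale (- 1) (G e) = 0"
  proof (rule exponential_polynomials_independent[OF finite_vertices[OF X] vertices_torus])
    fix e show "F e + cscale (- 1) (G e) \<in> cpolys d"
      using F by (intro cpoly.subspace_add cpoly.subspace_scale cpolys_subspace DM_family_cpolys)
  next
    fix x assume "x \<in> \<Lambda>"
    from eq[OF this] show "(\<Sum>e\<in>vertices \<Lambda> X. e x * eval_at bs (F e + cscale (- 1) (G e)) x) = 0"
      unfolding eval_at_add eval_at_cscale distrib_left sum.distrib
      by (simp add: family_sum_def sum_negf)
  qed
  then have "F e = G e" if "e \<in> vertices \<Lambda> X" for e using that by simp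
  moreover have "F e = G e" if "e \<notin> vertices \<Lambda> X" for e using that F by (simp add: DM_family_def)
  ultimately show ?thesis by blast
qed

section \<open>Components of functions and of periodic elements\<close>

lemma DM_component_eqI:
  assumes "set X \<subseteq> \<Lambda>" "DM_family X F" "\<And>x. x \<in> \<Lambda> \<Longrightarrow> f x = family_sum X F x"
  shows "DM_component bs \<Lambda> X f = F"
proof -
  have "DM_component bs \<Lambda> X f = (THE F. DM_family X F \<and> (\<forall>x\<in>\<Lambda>. f x = family_sum X F x))"
    unfolding DM_component_def DM_family_def family_sum_def by (simp only: conj_assoc)
  also have "\<dots> = F"
    using assms DM_family_unique[OF assms(1)] by (intro the_equality) auto
  finally show ?thesis .
qed

lemma DM_component:
  assumes "set X \<subseteq> \<Lambda>" "f \<in> DM_space \<Lambda> X"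
  shows "DM_family X (DM_component bs \<Lambda> X f)"
    "x \<in> \<Lambda> \<Longrightarrow> f x = family_sum X (DM_component bs \<Lambda> X f) x"
proof -
  obtain F where F: "DM_family X F" "\<forall>x\<in>\<Lambda>. f x = family_sum X F x"
    using DM_family_exists[OF assms] by blast
  then have "DM_component bs \<Lambda> X f = F" by (intro DM_component_eqI assms) auto
  then show "DM_family X (DM_component bs \<Lambda> X f)" "x \<in> \<Lambda> \<Longrightarrow> f x = family_sum X (DM_component bs \<Lambda> X f) x"
    using F by auto
qed

lemma DM_component_add:
  assumes "set X \<subseteq> \<Lambda>" "f \<in> DM_space \<Lambda> X" "g \<in> DM_space \<Lambda> X"
  shows "DM_component bs \<Lambda> X (f + g) e = DM_component bs \<Lambda> X f e + DM_component bs \<Lambda> X g e"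
proof -
  let ?F = "DM_component bs \<Lambda> X f" and ?G = "DM_component bs \<Lambda> X g"
  have "DM_component bs \<Lambda> X (f + g) = (\<lambda>e. ?F e + ?G e)"
  proof (rule DM_component_eqI[OF assms(1)])
    show "DM_family X (\<lambda>e. ?F e + ?G e)"
      using DM_component(1)[OF assms(1,2)] DM_component(1)[OF assms(1,3)] cpoly.subspace_add[OF D_space_subspace]
      unfolding DM_family_def by simp
    show "(f + g) x = family_sum X (\<lambda>e. ?F e + ?G e) x" if "x \<in> \<Lambda>" for x
      using DM_component(2)[OF assms(1,2) that] DM_component(2)[OF assms(1,3) that]
      by (simp add: family_sum_def eval_at_add distrib_left sum.distrib)
  qed
  then show ?thesis by simp
qed

lemma DM_component_scale:
  assumes "set X \<subseteq> \<Lambda>" "f \<in> DM_space \<Lambda> X"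
  shows "DM_component bs \<Lambda> X (fun_scale c f) e = cscale c (DM_component bs \<Lambda> X f e)"
proof -
  let ?F = "DM_component bs \<Lambda> X f"
  have "DM_component bs \<Lambda> X (fun_scale c f) = (\<lambda>e. cscale c (?F e))"
  proof (rule DM_component_eqI[OF assms(1)])
    show "DM_family X (\<lambda>e. cscale c (?F e))"
      using DM_component(1)[OF assms] cpoly.subspace_scale[OF D_space_subspace]
      unfolding DM_family_def by simp
    show "fun_scale c f x = family_sum X (\<lambda>e. cscale c (?F e)) x" if "x \<in> \<Lambda>" for x
      using DM_component(2)[OF assms that]
      by (simp add: fun_scale_def family_sum_def eval_at_cscale sum_distrib_left mult.left_commute)
  qed
  then show ?thesis by simp
qed

text \<open>Every character takes the value 1 at 0, so zero vectors never belong to the moved part.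
  Hence the prefactor cancels and \<open>per_component\<close> is well defined.\<close>

lemma lin_prod_move_part_nonzero:
  assumes "e \<in> torus \<Lambda>"
  shows "lin_prod bs (move_part e X) \<noteq> 0"
  unfolding lin_prod_eq using torus_0[OF assms] by (intro lprod_nonzero) (auto simp: move_part_def)

lemma per_component_eqI:
  assumes "e \<in> torus \<Lambda>" "q \<in> P_space bs (fix_part e X)" "p e = lin_prod bs (move_part e X) * q"
  shows "per_component bs X p e = q"
  unfolding per_component_def
  using assms lin_prod_move_part_nonzero[OF assms(1), of X] by (intro the_equality) auto

lemma P_per_component:
  assumes "p \<in> P_per bs \<Lambda> X" "e \<in> vertices \<Lambda> X"
  shows "per_component bs X p e \<in> P_space bs (fix_part e X)"
    "p e = lin_prod bs (move_part e X) * per_component bs X p e"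
proof -
  obtain q where q: "q \<in> P_space bs (fix_part e X)" "p e = lin_prod bs (move_part e X) * q"
    using assms unfolding P_per_def by blast
  moreover have "e \<in> torus \<Lambda>" using assms(2) vertices_torus by blast
  ultimately have "per_component bs X p e = q" by (intro per_component_eqI)
  with q show "per_component bs X p e \<in> P_space bs (fix_part e X)"
    "p e = lin_prod bs (move_part e X) * per_component bs X p e" by auto
qed

lemma P_space_subspace: "cpoly.subspace (P_space bs Y)"
  by (simp add: P_space_def)

lemma P_perI:
  assumes "set X \<subseteq> \<Lambda>" "\<And>e. e \<in> vertices \<Lambda> X \<Longrightarrow> q e \<in> P_space bs (fix_part e X)"
    and "\<And>e. p e = (if e \<in> vertices \<Lambda> X then lin_prod bs (move_part e X) * q e else 0)"
  shows "p \<in> P_per bs \<Lambda> X"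
proof -
  have "finite {e. p e \<noteq> 0}"
    by (rule finite_subset[OF _ finite_vertices[OF assms(1)]]) (auto simp: assms(3))
  then show ?thesis unfolding P_per_def using assms(2) by (auto simp: assms(3))
qed

lemma P_per_add:
  assumes X: "set X \<subseteq> \<Lambda>" and "p \<in> P_per bs \<Lambda> X" "p' \<in> P_per bs \<Lambda> X"
  shows "p + p' \<in> P_per bs \<Lambda> X"
proof (rule P_perI[OF X])
  fix e
  show "per_component bs X p e + per_component bs X p' e \<in> P_space bs (fix_part e X)" if "e \<in> vertices \<Lambda> X"
    using that assms P_per_component(1) by (intro cpoly.subspace_add[OF P_space_subspace]) auto
  show "(p + p') e = (if e \<in> vertices \<Lambda> X then lin_prod bs (move_part e X) *
      (per_component bs X p e + per_component bs X p' e) else 0)"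
    using P_per_component(2)[OF assms(2), of e] P_per_component(2)[OF assms(3), of e] assms(2,3)
    by (auto simp: distrib_left P_per_def)
qed

lemma P_per_scale:
  assumes X: "set X \<subseteq> \<Lambda>" and "p \<in> P_per bs \<Lambda> X"
  shows "per_scale c p \<in> P_per bs \<Lambda> X"
proof (rule P_perI[OF X])
  fix e
  show "cscale c (per_component bs X p e) \<in> P_space bs (fix_part e X)" if "e \<in> vertices \<Lambda> X"
    using that assms P_per_component(1) by (intro cpoly.subspace_scale[OF P_space_subspace]) auto
  show "per_scale c p e = (if e \<in> vertices \<Lambda> X then lin_prod bs (move_part e X) *
      cscale c (per_component bs X p e) else 0)"
    using P_per_component(2)[OF assms(2), of e] assms(2)
    by (auto simp: per_scale_def P_per_def)
qed

lemma per_component_add: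
  assumes "p \<in> P_per bs \<Lambda> X" "p' \<in> P_per bs \<Lambda> X" "e \<in> vertices \<Lambda> X"
  shows "per_component bs X (p + p') e = per_component bs X p e + per_component bs X p' e"
proof (rule per_component_eqI)
  show "e \<in> torus \<Lambda>" using assms(3) vertices_torus by blast
  show "per_component bs X p e + per_component bs X p' e \<in> P_space bs (fix_part e X)"
    using assms P_per_component(1) by (intro cpoly.subspace_add[OF P_space_subspace]) auto
  show "(p + p') e = lin_prod bs (move_part e X) * (per_component bs X p e + per_component bs X p' e)"
    using P_per_component(2)[OF assms(1,3)] P_per_component(2)[OF assms(2,3)] by (simp add: distrib_left)
qed

lemma per_component_scale:
  assumes "p \<in> P_per bs \<Lambda> X" "e \<in> vertices \<Lambda> X"
  shows "per_component bs X (per_scale c p) e = cscale c (per_component bs X p e)"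
proof (rule per_component_eqI)
  show "e \<in> torus \<Lambda>" using assms(2) vertices_torus by blast
  show "cscale c (per_component bs X p e) \<in> P_space bs (fix_part e X)"
    using assms P_per_component(1) by (intro cpoly.subspace_scale[OF P_space_subspace]) auto
  show "per_scale c p e = lin_prod bs (move_part e X) * cscale c (per_component bs X p e)"
    using P_per_component(2)[OF assms] by (simp add: per_scale_def)
qed

text \<open>The embedding of one summand into the formal direct sum, which reduces the pairing to a
  single vertex.\<close>

definition inject :: "'a list \<Rightarrow> ('a \<Rightarrow> complex) \<Rightarrow> cpoly \<Rightarrow> ('a \<Rightarrow> complex) \<Rightarrow> cpoly"
  where "inject X e q = (\<lambda>e'. if e' = e then lin_prod bs (move_part e X) * q else 0)"

lemma inject_P_per:
  assumes "set X \<subseteq> \<Lambda>" "e \<in> vertices \<Lambda> X" "q \<in> P_space bs (fix_part e X)"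
  shows "inject X e q \<in> P_per bs \<Lambda> X"
proof (rule P_perI[OF assms(1)])
  fix e'
  show "(if e' = e then q else 0) \<in> P_space bs (fix_part e' X)"
    using assms(3) cpoly.subspace_0[OF P_space_subspace] by auto
  show "inject X e q e' = (if e' \<in> vertices \<Lambda> X then lin_prod bs (move_part e' X) * (if e' = e then q else 0) else 0)"
    using assms(2) by (simp add: inject_def)
qed

lemma per_component_inject:
  assumes "e \<in> vertices \<Lambda> X" "e' \<in> vertices \<Lambda> X" "q \<in> P_space bs (fix_part e X)"
  shows "per_component bs X (inject X e q) e' = (if e' = e then q else 0)"
proof (rule per_component_eqI)
  show "e' \<in> torus \<Lambda>" using assms(2) vertices_torus by blast
  show "(if e' = e then q else 0) \<in> P_space bs (fix_part e' X)"
    using assms(3) cpoly.subspace_0[OF P_space_subspace] by auto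
qed (simp add: inject_def)

lemma nabla_pairing_inject:
  assumes X: "set X \<subseteq> \<Lambda>" and e: "e \<in> vertices \<Lambda> X" and q: "q \<in> P_space bs (fix_part e X)"
  shows "nabla_pairing bs \<Lambda> X (inject X e q) f = std_pairing q (DM_component bs \<Lambda> X f e)"
proof -
  have "nabla_pairing bs \<Lambda> X (inject X e q) f =
      (\<Sum>e'\<in>vertices \<Lambda> X. if e' = e then std_pairing q (DM_component bs \<Lambda> X f e) else 0)"
    unfolding nabla_pairing_def
    by (intro sum.cong refl) (simp add: per_component_inject[OF e _ q] std_pairing_wcoef)
  then show ?thesis using finite_vertices[OF X] e by simp
qed

text \<open>Test elements \<open>inject X e q\<close> isolate the component at one vertex, where
  \<open>D_space_eq_0\<close> applies to the difference of the two components.\<close>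

lemma nabla_pairing_injective:
  assumes X: "set X \<subseteq> \<Lambda>" and f: "f \<in> DM_space \<Lambda> X" "g \<in> DM_space \<Lambda> X"
    and eq: "\<And>p. p \<in> P_per bs \<Lambda> X \<Longrightarrow> nabla_pairing bs \<Lambda> X p f = nabla_pairing bs \<Lambda> X p g"
  shows "f = g"
proof -
  let ?F = "DM_component bs \<Lambda> X f" and ?G = "DM_component bs \<Lambda> X g"
  have "?F e = ?G e" if e: "e \<in> vertices \<Lambda> X" for e
  proof -
    have "?F e + cscale (- 1) (?G e) = 0"
    proof (rule D_space_eq_0)
      show "?F e + cscale (- 1) (?G e) \<in> D_space bs (fix_part e X)"
        using DM_component(1)[OF X f(1)] DM_component(1)[OF X f(2)] e unfolding DM_family_def
        by (intro cpoly.subspace_add[OF D_space_subspace] cpoly.subspace_scale[OF D_space_subspace]) auto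
      fix q assume q: "q \<in> P_space bs (fix_part e X)"
      show "std_pairing q (?F e + cscale (- 1) (?G e)) = 0"
        using eq[OF inject_P_per[OF X e q]] nabla_pairing_inject[OF X e q]
        by (simp only: std_pairing_add_right std_pairing_cscale_right) simp
    qed
    then show ?thesis by simp
  qed
  then have "family_sum X ?F x = family_sum X ?G x" for x
    unfolding family_sum_def by (intro sum.cong) auto
  then have "f x = g x" if "x \<in> \<Lambda>" for x
    using DM_component(2)[OF X f(1) that] DM_component(2)[OF X f(2) that] by simp
  moreover have "f x = g x" if "x \<notin> \<Lambda>" for x
    using that f unfolding DM_space_iff lattice_funs_def by auto
  ultimately show ?thesis by blast
qed

text \<open>The functional is restricted to each summand and represented there by
  \<open>D_space_represents\<close>; the polynomials found are assembled into one function, and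
  \<open>p\<close> is the finite sum of its injected components.\<close>

lemma nabla_pairing_surjective:
  assumes X: "set X \<subseteq> \<Lambda>" and L: "linear_on (P_per bs \<Lambda> X) per_scale (*) L"
  shows "\<exists>f\<in>DM_space \<Lambda> X. \<forall>p\<in>P_per bs \<Lambda> X. nabla_pairing bs \<Lambda> X p f = L p"
proof -
  let ?V = "vertices \<Lambda> X"
  have L_add: "L (p + p') = L p + L p'" if "p \<in> P_per bs \<Lambda> X" "p' \<in> P_per bs \<Lambda> X" for p p'
    using L that unfolding linear_on_def by blast
  have L_scale: "L (per_scale c p) = c * L p" if "p \<in> P_per bs \<Lambda> X" for p c
    using L that unfolding linear_on_def by blast
  have "\<exists>g\<in>D_space bs (fix_part e X). \<forall>q\<in>P_space bs (fix_part e X). std_pairing q g = L (inject X e q)"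
    if e: "e \<in> ?V" for e
  proof (rule D_space_represents)
    have add: "inject X e (q + q') = inject X e q + inject X e q'" for q q'
      by (auto simp: inject_def fun_eq_iff distrib_left)
    have scale: "inject X e (cscale c q) = per_scale c (inject X e q)" for c q
      by (auto simp: inject_def fun_eq_iff per_scale_def)
    show "linear_on (P_space bs (fix_part e X)) cscale (*) (\<lambda>q. L (inject X e q))"
      unfolding linear_on_def add scale using inject_P_per[OF X e] L_add L_scale by blast
  qed
  then obtain g where g: "\<And>e. e \<in> ?V \<Longrightarrow> g e \<in> D_space bs (fix_part e X)"
    "\<And>e q. e \<in> ?V \<Longrightarrow> q \<in> P_space bs (fix_part e X) \<Longrightarrow> std_pairing q (g e) = L (inject X e q)"
    by metis
  define F where "F e = (if e \<in> ?V then g e else 0)" for e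
  have F: "DM_family X F" using g(1) by (simp add: DM_family_def F_def)
  have comp: "DM_component bs \<Lambda> X (family_sum X F) = F"
    by (rule DM_component_eqI[OF X F]) simp
  have "nabla_pairing bs \<Lambda> X p (family_sum X F) = L p" if p: "p \<in> P_per bs \<Lambda> X" for p
  proof -
    let ?c = "\<lambda>e. inject X e (per_component bs X p e)"
    have c: "?c e \<in> P_per bs \<Lambda> X" if "e \<in> ?V" for e
      using inject_P_per[OF X that P_per_component(1)[OF p that]] .
    have sub: "(\<Sum>e\<in>A. ?c e) \<in> P_per bs \<Lambda> X \<and> L (\<Sum>e\<in>A. ?c e) = (\<Sum>e\<in>A. L (?c e))"
      if "finite A" "A \<subseteq> ?V" for A
      using that
    proof induction
      case empty
      have 0: "(0 :: ('a \<Rightarrow> complex) \<Rightarrow> cpoly) \<in> P_per bs \<Lambda> X"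
        using cpoly.subspace_0[OF P_space_subspace] by (intro P_perI[OF X, of "\<lambda>_. 0"]) auto
      then have "L (0 + 0) = L 0 + L 0" by (intro L_add)
      then have "L 0 = 0" by (simp only: add_0 add_cancel_right_right)
      with 0 show ?case unfolding sum.empty by blast
    next
      case (insert e A)
      then have *: "?c e \<in> P_per bs \<Lambda> X" "(\<Sum>e\<in>A. ?c e) \<in> P_per bs \<Lambda> X"
        "L (\<Sum>e\<in>A. ?c e) = (\<Sum>e\<in>A. L (?c e))" using c by auto
      show ?case
        unfolding sum.insert[OF insert.hyps] L_add[OF *(1,2)] *(3) using P_per_add[OF X *(1,2)] by blast
    qed
    have "p = (\<Sum>e\<in>?V. ?c e)"
    proof
      fix e'
      have "(\<Sum>e\<in>A. ?c e) e' = (\<Sum>e\<in>A. ?c e e')" for A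
        by (induction A rule: infinite_finite_induct) auto
      then have "(\<Sum>e\<in>?V. ?c e) e' = (\<Sum>e\<in>?V. if e' = e then lin_prod bs (move_part e X) * per_component bs X p e else 0)"
        by (simp add: inject_def)
      also have "\<dots> = (if e' \<in> ?V then lin_prod bs (move_part e' X) * per_component bs X p e' else 0)"
        using finite_vertices[OF X] by simp
      also have "\<dots> = p e'" using P_per_component(2)[OF p, of e'] p by (auto simp: P_per_def)
      finally show "p e' = (\<Sum>e\<in>?V. ?c e) e'" ..
    qed
    then have "L p = (\<Sum>e\<in>?V. L (?c e))" using sub[OF finite_vertices[OF X] subset_refl] by simp
    also have "\<dots> = (\<Sum>e\<in>?V. std_pairing (per_component bs X p e) (F e))"
      using g(2) P_per_component(1)[OF p] by (intro sum.cong) (auto simp: F_def)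
    also have "\<dots> = nabla_pairing bs \<Lambda> X p (family_sum X F)"
      by (simp add: nabla_pairing_def comp)
    finally show ?thesis ..
  qed
  then show ?thesis using DM_space_family_sum[OF X F] by blast
qed

end

theorem theorem7p2:
  fixes \<Lambda> :: "'a::real_vector set" and bs X :: "'a list"
  assumes "is_lattice \<Lambda>" and "lattice_basis bs \<Lambda>"
    and "set X \<subseteq> \<Lambda>" and "span (set X) = UNIV"
  shows "linear_iso fun_scale (DM_space \<Lambda> X)
    fun_scale (dual_space per_scale (P_per bs \<Lambda> X))
    (\<lambda>f. zero_ext (P_per bs \<Lambda> X) (\<lambda>p. nabla_pairing bs \<Lambda> X p f))"
proof -
  interpret lattice bs \<Lambda>
    using assms(2) unfolding lattice_basis_def by unfold_locales auto
  let ?P = "P_per bs \<Lambda> X" and ?DM = "DM_space \<Lambda> X" and ?pair = "nabla_pairing bs \<Lambda> X"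
  let ?h = "\<lambda>f. zero_ext ?P (\<lambda>p. ?pair p f)"
  note X = assms(3)
  have lin_right: "?pair p (f + g) = ?pair p f + ?pair p g" "?pair p (fun_scale c f) = c * ?pair p f"
    if "f \<in> ?DM" "g \<in> ?DM" for p f g c
    using that unfolding nabla_pairing_def
    by (simp_all add: DM_component_add[OF X] DM_component_scale[OF X] std_pairing_add_right
        std_pairing_cscale_right sum.distrib sum_distrib_left)
  have lin_left: "?pair (p + p') f = ?pair p f + ?pair p' f" "?pair (per_scale c p) f = c * ?pair p f"
    if "p \<in> ?P" "p' \<in> ?P" for p p' f c
    using that unfolding nabla_pairing_def
    by (simp_all add: per_component_add per_component_scale std_pairing_add_left
        std_pairing_cscale_left sum.distrib sum_distrib_left)
  have "linear_on ?DM fun_scale fun_scale ?h"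
    unfolding linear_on_def using lin_right by (auto simp: zero_ext_def fun_scale_def fun_eq_iff)
  moreover have "bij_betw ?h ?DM (dual_space per_scale ?P)"
  proof (intro bij_betw_imageI inj_onI subset_antisym subsetI)
    fix f g assume f: "f \<in> ?DM" "g \<in> ?DM" and eq: "?h f = ?h g"
    have "?pair p f = ?pair p g" if "p \<in> ?P" for p
      using fun_cong[OF eq, of p] that by (simp add: zero_ext_def)
    then show "f = g" by (rule nabla_pairing_injective[OF X f])
  next
    fix L assume "L \<in> ?h ` ?DM"
    then obtain f where L: "L = ?h f" by blast
    \<comment> \<open>Closure of \<open>?P\<close> under sums and multiples ensures that the
      extension by zero still takes the value of the pairing there.\<close>
    show "L \<in> dual_space per_scale ?P"
      unfolding dual_space_def linear_on_def L
      using lin_left P_per_add[OF X] P_per_scale[OF X] by (simp add: zero_ext_def)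
  next
    fix L assume L: "L \<in> dual_space per_scale ?P"
    then obtain f where f: "f \<in> ?DM" "\<forall>p\<in>?P. ?pair p f = L p"
      using nabla_pairing_surjective[OF X] unfolding dual_space_def by blast
    have "?h f = L" using f(2) L by (auto simp: zero_ext_def dual_space_def fun_eq_iff)
    then show "L \<in> ?h ` ?DM" using f(1) by blast
  qed
  ultimately show ?thesis unfolding linear_iso_def by blast
qed

end
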